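(* Let $K\ge 2$ be an integer and consider the $K$ user interference channel with a single antenna at every node, frequency-selective channel coefficients that are constant in time, and total transmit power $\rho$ per orthogonal time and frequency dimension (setting described in the context). Let $\mathcal{D}\subset\mathbb{R}_+^K$ be its degrees of freedom region. Then $$\max_{(d_1,\dots,d_K)\in\mathcal{D}} d_1+d_2+\cdots+d_K = \frac{K}{2}.$$
   Context: The $K$ user interference channel: for $k\in\{1,\dots,K\}$, frequency slot $f\in\mathbb{N}$ and time slot $t\in\mathbb{N}$, the output at receiver $k$ is $Y^{[k]}(f,t)=\sum_{j=1}^K H^{[kj]}(f)X^{[j]}(f,t)+Z^{[k]}(f,t)$, where $X^{[j]}(f,t)$ is the input of transmitter $j$, $H^{[kj]}(f)$ is the channel coefficient from transmitter $j$ to receiver $k$ in frequency slot $f$ (varying across frequency slots but constant in time), and the $Z^{[k]}(f,t)$ are i.i.d. zero-mean unit-variance circularly symmetric complex Gaussian noise. The channel coefficients are drawn i.i.d. from a continuous distribution, their absolute values are bounded between a nonzero minimum and a finite maximum, and they are known (causally) to all transmitters and receivers. Transmitter $k$ has an independent message $W_k$ for receiver $k$ only. The total power over all transmitters is $\rho$ per orthogonal time and frequency dimension. For codewords spanning $f_0$ frequency slots and $t_0$ time slots, rates $R_k(\rho)=\log|W_k(\rho)|/(f_0t_0)$ are achievable if all error probabilities can simultaneously be made arbitrarily small for large $f_0t_0$; $\mathcal{C}(\rho)$ is the set of achievable rate tuples. The degrees of freedom region is $\mathcal{D}=\{(d_1,\dots,d_K)\in\mathbb{R}_+^K: \forall (w_1,\dots,w_K)\in\mathbb{R}_+^K,\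 \sum_k w_kd_k\le \limsup_{\rho\to\infty}\big[\sup_{\mathbf{R}(\rho)\in\mathcal{C}(\rho)}\sum_k w_kR_k(\rho)\big]/\log\rho\}$. *)

theory Defs
  imports "HOL-Probability.Probability"
begin

text \<open>Users are indexed by 0..<K. Channel H k j f = coefficient from transmitter j
  to receiver k in frequency slot f. A block of f0 frequency slots and t0 time slots
  is the index set {..<f0} x {..<t0}.\<close>

definition blk :: "nat \<Rightarrow> nat \<Rightarrow> (nat \<times> nat) set" where
  "blk f0 t0 = {..<f0} \<times> {..<t0}"

definition cgauss :: "complex measure" where
  "cgauss = density lborel (\<lambda>z. ennreal (exp (- (cmod z)\<^sup>2) / pi))"

definition noise_space :: "nat \<Rightarrow> nat \<Rightarrow> (nat \<times> nat \<Rightarrow> complex) measure" where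
  "noise_space f0 t0 = PiM (blk f0 t0) (\<lambda>_. cgauss)"

definition rx :: "nat \<Rightarrow> (nat \<Rightarrow> nat \<Rightarrow> nat \<Rightarrow> complex) \<Rightarrow> nat \<Rightarrow> nat
    \<Rightarrow> (nat \<Rightarrow> nat \<Rightarrow> nat \<times> nat \<Rightarrow> complex) \<Rightarrow> (nat \<Rightarrow> nat) \<Rightarrow> nat
    \<Rightarrow> (nat \<times> nat \<Rightarrow> complex) \<Rightarrow> (nat \<times> nat \<Rightarrow> complex)" where
  "rx K H f0 t0 X w k z =
     restrict (\<lambda>(f,t). (\<Sum>j<K. H k j f * X j (w j) (f,t)) + z (f,t)) (blk f0 t0)"

definition err :: "nat \<Rightarrow> (nat \<Rightarrow> nat \<Rightarrow> nat \<Rightarrow> complex) \<Rightarrow> nat \<Rightarrow> nat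
    \<Rightarrow> (nat \<Rightarrow> nat) \<Rightarrow> (nat \<Rightarrow> nat \<Rightarrow> nat \<times> nat \<Rightarrow> complex)
    \<Rightarrow> (nat \<Rightarrow> (nat \<times> nat \<Rightarrow> complex) \<Rightarrow> nat) \<Rightarrow> nat \<Rightarrow> real" where
  "err K H f0 t0 M X g k =
     (\<Sum>w\<in>PiE {..<K} (\<lambda>j. {..<M j}).
        measure (noise_space f0 t0)
          {z \<in> space (noise_space f0 t0). g k (rx K H f0 t0 X w k z) \<noteq> w k})
     / (\<Prod>j<K. real (M j))"

definition is_code :: "nat \<Rightarrow> real \<Rightarrow> nat \<Rightarrow> nat
    \<Rightarrow> (nat \<Rightarrow> nat) \<Rightarrow> (nat \<Rightarrow> nat \<Rightarrow> nat \<times> nat \<Rightarrow> complex)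
    \<Rightarrow> (nat \<Rightarrow> (nat \<times> nat \<Rightarrow> complex) \<Rightarrow> nat) \<Rightarrow> bool" where
  "is_code K \<rho> f0 t0 M X g \<longleftrightarrow>
     (\<forall>k<K. 1 \<le> M k) \<and>
     (\<forall>k<K. g k \<in> measurable (PiM (blk f0 t0) (\<lambda>_. borel)) (count_space UNIV)) \<and>
     (\<Sum>k<K. (\<Sum>w<M k. \<Sum>p\<in>blk f0 t0. (cmod (X k w p))\<^sup>2) / real (M k))
        \<le> \<rho> * real (f0 * t0)"

definition achievable :: "nat \<Rightarrow> (nat \<Rightarrow> nat \<Rightarrow> nat \<Rightarrow> complex) \<Rightarrow> real
    \<Rightarrow> (nat \<Rightarrow> real) \<Rightarrow> bool" where
  "achievable K H \<rho> R \<longleftrightarrow>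
     (\<forall>\<epsilon>>0. \<exists>f0 t0 M X g. 0 < f0 \<and> 0 < t0 \<and> is_code K \<rho> f0 t0 M X g \<and>
        (\<forall>k<K. R k - \<epsilon> \<le> ln (real (M k)) / real (f0 * t0) \<and>
               err K H f0 t0 M X g k \<le> \<epsilon>))"

definition capacity_region :: "nat \<Rightarrow> (nat \<Rightarrow> nat \<Rightarrow> nat \<Rightarrow> complex) \<Rightarrow> real
    \<Rightarrow> (nat \<Rightarrow> real) set" where
  "capacity_region K H \<rho> =
     {R. (\<forall>k<K. 0 \<le> R k) \<and> (\<forall>k. K \<le> k \<longrightarrow> R k = 0) \<and> achievable K H \<rho> R}"

definition dof_region :: "nat \<Rightarrow> (nat \<Rightarrow> nat \<Rightarrow> nat \<Rightarrow> complex) \<Rightarrow> (nat \<Rightarrow> real) set" where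
  "dof_region K H =
     {d. (\<forall>k<K. 0 \<le> d k) \<and> (\<forall>k. K \<le> k \<longrightarrow> d k = 0) \<and>
         (\<forall>w::nat \<Rightarrow> real. (\<forall>k<K. 0 \<le> w k) \<longrightarrow>
            ereal (\<Sum>k<K. w k * d k)
              \<le> Limsup at_top (\<lambda>\<rho>::real.
                   (SUP R\<in>capacity_region K H \<rho>. ereal (\<Sum>k<K. w k * R k)) / ereal (ln \<rho>)))}"

end

theory Submission
  imports Defs "HOL-Real_Asymp.Real_Asymp"
begin

text \<open>Upper bound: from an output of receiver \<open>i\<close> with slightly reduced noise, one can simulate the true
  outputs of receivers \<open>i\<close> and \<open>j\<close> in turn and so decode both messages. Since this single output has
  power \<open>O(\<rho>)\<close> and bounded noise density, comparing the density with a Gaussian weight gives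
  \<open>M\<^sub>i M\<^sub>j \<le> O(\<rho>)\<^sup>n\<close>, without any entropy; hence \<open>d\<^sub>i + d\<^sub>j \<le> 1\<close> for all pairs.

  Lower bound: instead of aligning in generic subspaces, we pair frequency slots whose cross gains agree up to
  a small \<open>b\<close> while the direct gains differ by at least a \<open>c\<close> independent of \<open>b\<close>. By the law of large numbers,
  almost surely nearly all slots of a long block can be matched. Sending the same symbol on both
  slots and subtracting the outputs removes the interference, so each user gets one interference-free
  channel use out of two. There, a quadrature constellation of about \<open>\<rho>\<close> points, protected by a
  Gilbert-Varshamov code against the rare large noise samples, has rate \<open>(1 - o(1)) ln \<rho>\<close>.\<close>

section \<open>Complex Gaussian noise\<close>

text \<open>Only the coefficient of \<open>ln \<rho>\<close> survives in the end, so any loss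
  bounded independently of \<rho> is harmless. For the converse this allows a noise reduction by the
  fixed factor \<open>hmin / hmax\<close> and error probabilities that are merely at most
  \<open>1 / 8\<close>. For the construction it dictates the order of the choices. The spacing of
  the constellation must stay bounded while its size grows with \<rho>, so the lower bound
  \<open>c\<close> on the difference of direct gains has to be fixed before the tolerance
  \<open>b\<close>; the latter must shrink like \<open>1 / sqrt \<rho>\<close>, because the residual
  interference grows with the diameter of the constellation. Both demands are compatible since a law
  without atoms rarely puts the direct gains of two slots close together, however finely the slots
  are sorted by their independent cross gains. A smaller \<open>b\<close> only calls for a longer
  block of frequency slots. At a given \<rho> this \<open>f0\<close> stays fixed, and reliability
  comes from \<open>t0\<close> alone, the gains being constant in time.\<close>

lemma borel_measurable_Complex [measurable]:
  assumes [measurable]: "f \<in> borel_measurable M" "g \<in> borel_measurable M"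
  shows "(\<lambda>x. Complex (f x) (g x)) \<in> borel_measurable M"
  unfolding Complex_eq by measurable

section \<open>Lebesgue measure on the complex plane and affine substitutions\<close>

lemma lborel_complex_eq:
  "(lborel :: complex measure) = distr (lborel \<Otimes>\<^sub>M lborel) borel (\<lambda>(x, y). Complex x y)"
proof (rule lborel_eqI)
  fix l u :: complex
  assume le: "\<And>b. b \<in> Basis \<Longrightarrow> l \<bullet> b \<le> u \<bullet> b"
  have le': "Re l \<le> Re u" "Im l \<le> Im u"
    using le[of 1] le[of \<i>] by (auto simp: Basis_complex_def)
  have "(\<lambda>(x, y). Complex x y) -` box l u = {Re l<..<Re u} \<times> {Im l<..<Im u}"
    by (auto simp: box_def Basis_complex_def)
  then show "emeasure (distr (lborel \<Otimes>\<^sub>M lborel) borel (\<lambda>(x, y). Complex x y)) (box l u)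
      = (\<Prod>b\<in>Basis. (u - l) \<bullet> b)"
    using le'
    by (simp add: emeasure_distr lborel.emeasure_pair_measure_Times space_pair_measure
        Basis_complex_def ennreal_mult)
qed simp

lemma nn_integral_lborel_complex:
  assumes [measurable]: "f \<in> borel_measurable borel"
  shows "(\<integral>\<^sup>+z. f z \<partial>(lborel :: complex measure))
    = (\<integral>\<^sup>+x. \<integral>\<^sup>+y. f (Complex x y) \<partial>lborel \<partial>lborel)"
  by (subst lborel_complex_eq)
    (simp add: nn_integral_distr lborel.nn_integral_fst[symmetric] split_beta)

text \<open>Multiplication by \<open>c = a + b * \<i>\<close> splits into one-dimensional
  substitutions: \<open>u = a * x - b * y\<close> for fixed \<open>y\<close>, then a scaling of
  \<open>y\<close> by \<open>(a\<^sup>2 + b\<^sup>2) / a\<close> for fixed \<open>u\<close>, with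
  factors whose product is \<open>(cmod c)\<^sup>2\<close>. This divides by \<open>a\<close>; for
  \<open>a = 0\<close> the map only swaps and scales the axes.\<close>

lemma nn_integral_complex_mult:
  fixes c :: complex
  assumes [measurable]: "f \<in> borel_measurable borel" and c: "c \<noteq> 0"
  shows "(\<integral>\<^sup>+z. f z \<partial>lborel) = ennreal ((cmod c)\<^sup>2) * (\<integral>\<^sup>+z. f (c * z) \<partial>lborel)"
proof -
  define a b where "a = Re c" and "b = Im c"
  have n: "(cmod c)\<^sup>2 = a\<^sup>2 + b\<^sup>2"
    by (simp add: cmod_power2 a_def b_def)
  have mult: "c * Complex x y = Complex (a * x - b * y) (b * x + a * y)" for x y
    by (simp add: complex_eq_iff a_def b_def algebra_simps)
  have rhs: "(\<integral>\<^sup>+z. f (c * z) \<partial>lborel)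
      = (\<integral>\<^sup>+x. \<integral>\<^sup>+y. f (Complex (a * x - b * y) (b * x + a * y)) \<partial>lborel \<partial>lborel)"
    by (subst nn_integral_lborel_complex) (simp_all add: mult)
  show ?thesis
  proof (cases "a = 0")
    case True
    then have b: "b \<noteq> 0" using c by (auto simp: a_def b_def complex_eq_iff)
    have "(\<integral>\<^sup>+z. f z \<partial>lborel) = (\<integral>\<^sup>+y. \<integral>\<^sup>+x. f (Complex x y) \<partial>lborel \<partial>lborel)"
      by (subst nn_integral_lborel_complex, simp, subst lborel_pair.Fubini'[symmetric]) simp_all
    also have "\<dots> = ennreal \<bar>b\<bar> * (\<integral>\<^sup>+y. \<integral>\<^sup>+x. f (Complex x (b * y)) \<partial>lborel \<partial>lborel)"
      by (subst nn_integral_real_affine[where c = b and t = 0]) (use b in simp_all)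
    also have "\<dots> = ennreal \<bar>b\<bar> * (\<integral>\<^sup>+y. ennreal \<bar>b\<bar> * (\<integral>\<^sup>+x. f (Complex (- (b * x)) (b * y)) \<partial>lborel) \<partial>lborel)"
      by (subst (2) nn_integral_real_affine[where c = "- b" and t = 0]) (use b in simp_all)
    also have "\<dots> = ennreal \<bar>b\<bar> * (ennreal \<bar>b\<bar> * (\<integral>\<^sup>+y. \<integral>\<^sup>+x. f (Complex (- (b * x)) (b * y)) \<partial>lborel \<partial>lborel))"
      by (subst nn_integral_cmult) simp_all
    also have "\<dots> = ennreal ((cmod c)\<^sup>2) * (\<integral>\<^sup>+z. f (c * z) \<partial>lborel)"
      unfolding rhs n using True
      by (simp add: mult.assoc[symmetric] ennreal_mult[symmetric] power2_eq_square)
    finally show ?thesis .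
  next
    case False
    have k: "(a\<^sup>2 + b\<^sup>2) / a \<noteq> 0" using False
      by (simp add: add_nonneg_eq_0_iff)
    have "ennreal \<bar>a\<bar> * (\<integral>\<^sup>+z. f (c * z) \<partial>lborel)
      = ennreal \<bar>a\<bar> * (\<integral>\<^sup>+y. \<integral>\<^sup>+x. f (Complex (a * x - b * y) (b * x + a * y)) \<partial>lborel \<partial>lborel)"
      unfolding rhs by (subst lborel_pair.Fubini'[symmetric]) simp_all
    also have "\<dots> = (\<integral>\<^sup>+y. ennreal \<bar>a\<bar> * (\<integral>\<^sup>+x. f (Complex (a * x - b * y) (b * x + a * y)) \<partial>lborel) \<partial>lborel)"
      by (subst nn_integral_cmult) simp_all
    also have "\<dots> = (\<integral>\<^sup>+y. \<integral>\<^sup>+u. f (Complex u (b / a * u + (a\<^sup>2 + b\<^sup>2) / a * y)) \<partial>lborel \<partial>lborel)"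
    proof (rule nn_integral_cong)
      fix y :: real
      have "b / a * (- b * y + a * x) + (a\<^sup>2 + b\<^sup>2) / a * y = b * x + a * y" for x
        using False by (simp add: power2_eq_square divide_simps) (simp add: algebra_simps)
      then show "ennreal \<bar>a\<bar> * (\<integral>\<^sup>+x. f (Complex (a * x - b * y) (b * x + a * y)) \<partial>lborel)
        = (\<integral>\<^sup>+u. f (Complex u (b / a * u + (a\<^sup>2 + b\<^sup>2) / a * y)) \<partial>lborel)"
        using False
        by (subst (2) nn_integral_real_affine[where c = a and t = "- b * y"])
          (simp_all add: algebra_simps)
    qed
    also have "\<dots> = (\<integral>\<^sup>+u. \<integral>\<^sup>+y. f (Complex u (b / a * u + (a\<^sup>2 + b\<^sup>2) / a * y)) \<partial>lborel \<partial>lborel)"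
      by (subst lborel_pair.Fubini'[symmetric]) simp_all
    finally have 1: "ennreal \<bar>a\<bar> * (\<integral>\<^sup>+z. f (c * z) \<partial>lborel)
      = (\<integral>\<^sup>+u. \<integral>\<^sup>+y. f (Complex u (b / a * u + (a\<^sup>2 + b\<^sup>2) / a * y)) \<partial>lborel \<partial>lborel)" .
    have "(\<integral>\<^sup>+z. f z \<partial>lborel)
      = (\<integral>\<^sup>+u. ennreal \<bar>(a\<^sup>2 + b\<^sup>2) / a\<bar> * (\<integral>\<^sup>+y. f (Complex u (b / a * u + (a\<^sup>2 + b\<^sup>2) / a * y)) \<partial>lborel) \<partial>lborel)"
      by (subst nn_integral_lborel_complex, simp, rule nn_integral_cong,
          rule nn_integral_real_affine, simp, rule k)
    also have "\<dots> = ennreal \<bar>(a\<^sup>2 + b\<^sup>2) / a\<bar> * (ennreal \<bar>a\<bar> * (\<integral>\<^sup>+z. f (c * z) \<partial>lborel))"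
      unfolding 1 by (subst nn_integral_cmult) simp_all
    also have "\<dots> = ennreal ((cmod c)\<^sup>2) * (\<integral>\<^sup>+z. f (c * z) \<partial>lborel)"
      unfolding n using False
      by (simp add: mult.assoc[symmetric] ennreal_mult[symmetric] abs_divide)
    finally show ?thesis .
  qed
qed

lemma nn_integral_complex_affine:
  fixes c t :: complex
  assumes [measurable]: "f \<in> borel_measurable borel" and c: "c \<noteq> 0"
  shows "(\<integral>\<^sup>+z. f z \<partial>lborel) = ennreal ((cmod c)\<^sup>2) * (\<integral>\<^sup>+z. f (t + c * z) \<partial>lborel)"
proof -
  have "(\<integral>\<^sup>+z. f z \<partial>lborel) = (\<integral>\<^sup>+z. f z \<partial>distr lborel borel ((+) t))"
    by (simp add: lborel_distr_plus)
  also have "\<dots> = (\<integral>\<^sup>+z. f (t + z) \<partial>lborel)"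
    by (simp add: nn_integral_distr)
  also have "\<dots> = ennreal ((cmod c)\<^sup>2) * (\<integral>\<^sup>+z. f (t + c * z) \<partial>lborel)"
    by (rule nn_integral_complex_mult) (use c in simp_all)
  finally show ?thesis .
qed

section \<open>Gaussian integrals and the law of one noise sample\<close>

lemma nn_integral_gaussian_real:
  assumes "0 < P"
  shows "(\<integral>\<^sup>+x. ennreal (exp (- (x\<^sup>2 / P))) \<partial>lborel) = ennreal (sqrt (pi * P))"
proof -
  have s: "sqrt (P / 2) > 0" using assms by simp
  \<comment> \<open>The integrand in question is an unnormalised normal density of variance
    \<open>P / 2\<close>.\<close>
  have "(\<integral>\<^sup>+x. ennreal (normal_density 0 (sqrt (P / 2)) x) \<partial>lborel) = ennreal 1"
    using s by (subst nn_integral_eq_integral) auto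
  then have "1 = (\<integral>\<^sup>+x. ennreal (1 / sqrt (pi * P)) * ennreal (exp (- (x\<^sup>2 / P))) \<partial>lborel)"
    using assms by (simp add: normal_density_def ennreal_mult[symmetric] mult.commute)
  also have "\<dots> = ennreal (1 / sqrt (pi * P)) * (\<integral>\<^sup>+x. ennreal (exp (- (x\<^sup>2 / P))) \<partial>lborel)"
    by (subst nn_integral_cmult) auto
  finally have "ennreal (sqrt (pi * P)) * 1 = ennreal (sqrt (pi * P)) * (ennreal (1 / sqrt (pi * P)) * (\<integral>\<^sup>+x. ennreal (exp (- (x\<^sup>2 / P))) \<partial>lborel))"
    by simp
  also have "\<dots> = (\<integral>\<^sup>+x. ennreal (exp (- (x\<^sup>2 / P))) \<partial>lborel)"
    using assms by (simp add: mult.assoc[symmetric] ennreal_mult[symmetric])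
  finally show ?thesis by simp
qed

lemma nn_integral_gaussian_complex:
  assumes "0 < P"
  shows "(\<integral>\<^sup>+z. ennreal (exp (- ((cmod z)\<^sup>2 / P))) \<partial>lborel) = ennreal (pi * P)"
proof -
  have "(\<integral>\<^sup>+z. ennreal (exp (- ((cmod z)\<^sup>2 / P))) \<partial>lborel)
    = (\<integral>\<^sup>+x. \<integral>\<^sup>+y. ennreal (exp (- (x\<^sup>2 / P))) * ennreal (exp (- (y\<^sup>2 / P))) \<partial>lborel \<partial>lborel)"
    by (subst nn_integral_lborel_complex)
      (simp_all add: cmod_power2 ennreal_mult[symmetric] mult_exp_exp add_divide_distrib diff_divide_distrib)
  also have "\<dots> = ennreal (sqrt (pi * P)) * ennreal (sqrt (pi * P))"
    using assms by (simp add: nn_integral_cmult nn_integral_multc nn_integral_gaussian_real)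
  also have "\<dots> = ennreal (pi * P)"
    using assms by (simp add: ennreal_mult[symmetric])
  finally show ?thesis .
qed

lemma sets_cgauss [measurable_cong, simp]: "sets cgauss = sets borel"
  by (simp add: cgauss_def)

lemma space_cgauss [simp]: "space cgauss = UNIV"
  by (simp add: cgauss_def)

lemma nn_integral_cgauss:
  assumes [measurable]: "f \<in> borel_measurable borel"
  shows "(\<integral>\<^sup>+z. f z \<partial>cgauss) = (\<integral>\<^sup>+z. ennreal (exp (- (cmod z)\<^sup>2) / pi) * f z \<partial>lborel)"
  unfolding cgauss_def by (subst nn_integral_density) simp_all

lemma prob_space_cgauss: "prob_space cgauss"
proof
  have "emeasure cgauss (space cgauss) = (\<integral>\<^sup>+z. ennreal (1 / pi) * ennreal (exp (- ((cmod z)\<^sup>2 / 1))) \<partial>lborel)"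
    by (simp add: cgauss_def emeasure_density ennreal_mult[symmetric])
  also have "\<dots> = ennreal (1 / pi) * ennreal (pi * 1)"
    by (subst nn_integral_cmult) (simp_all only: nn_integral_gaussian_complex[of 1], simp_all)
  also have "\<dots> = 1"
    by (simp add: ennreal_mult[symmetric])
  finally show "emeasure cgauss (space cgauss) = 1" .
qed

interpretation cgauss: prob_space cgauss
  by (rule prob_space_cgauss)

text \<open>The exact value is 1, but any constant will do. The inequality
  \<open>v <= 2 * exp (v / 2)\<close> trades the factor \<open>(cmod z)\<^sup>2\<close> for a
  Gaussian of twice the variance.\<close>

lemma cgauss_second_moment_le: "(\<integral>\<^sup>+z. ennreal ((cmod z)\<^sup>2) \<partial>cgauss) \<le> 4"
proof -
  have "(\<integral>\<^sup>+z. ennreal ((cmod z)\<^sup>2) \<partial>cgauss)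
      \<le> (\<integral>\<^sup>+z. ennreal (2 / pi) * ennreal (exp (- ((cmod z)\<^sup>2 / 2))) \<partial>lborel)"
  proof (subst nn_integral_cgauss, simp, rule nn_integral_mono)
    fix z :: complex
    have "(cmod z)\<^sup>2 \<le> 2 * exp ((cmod z)\<^sup>2 / 2)"
      using exp_ge_add_one_self[of "(cmod z)\<^sup>2 / 2"] by linarith
    then have "exp (- (cmod z)\<^sup>2) * (cmod z)\<^sup>2 \<le> exp (- (cmod z)\<^sup>2) * (2 * exp ((cmod z)\<^sup>2 / 2))"
      by (intro mult_left_mono) auto
    also have "\<dots> = 2 * exp (- ((cmod z)\<^sup>2 / 2))"
      by (simp add: mult_exp_exp)
    finally show "ennreal (exp (- (cmod z)\<^sup>2) / pi) * ennreal ((cmod z)\<^sup>2)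
      \<le> ennreal (2 / pi) * ennreal (exp (- ((cmod z)\<^sup>2 / 2)))"
      by (simp add: ennreal_mult[symmetric] divide_right_mono ennreal_leI)
  qed
  also have "\<dots> = ennreal (2 / pi) * ennreal (pi * 2)"
    by (subst nn_integral_cmult) (simp_all only: nn_integral_gaussian_complex[of 2], simp_all)
  also have "\<dots> = 4"
    by (simp add: ennreal_mult[symmetric])
  finally show ?thesis .
qed

text \<open>The density of \<open>t + s * z\<close> is at most
  \<open>1 / (pi * (cmod s)\<^sup>2)\<close>, uniformly in \<open>t\<close>. This uniformity lets
  the converse treat all message tuples alike.\<close>

lemma nn_integral_cgauss_affine_le:
  fixes s t :: complex
  assumes [measurable]: "f \<in> borel_measurable borel" and s: "s \<noteq> 0"
  shows "(\<integral>\<^sup>+z. f (t + s * z) \<partial>cgauss) \<le> ennreal (1 / (pi * (cmod s)\<^sup>2)) * (\<integral>\<^sup>+z. f z \<partial>lborel)"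
proof -
  have "(\<integral>\<^sup>+z. f (t + s * z) \<partial>cgauss) \<le> (\<integral>\<^sup>+z. ennreal (1 / pi) * f (t + s * z) \<partial>lborel)"
    by (subst nn_integral_cgauss) (auto intro!: nn_integral_mono mult_right_mono ennreal_leI divide_right_mono)
  also have "\<dots> = ennreal (1 / pi) * (\<integral>\<^sup>+z. f (t + s * z) \<partial>lborel)"
    by (subst nn_integral_cmult) simp_all
  also have "\<dots> = ennreal (1 / (pi * (cmod s)\<^sup>2)) * (ennreal ((cmod s)\<^sup>2) * (\<integral>\<^sup>+z. f (t + s * z) \<partial>lborel))"
    using s by (simp add: mult.assoc[symmetric] ennreal_mult[symmetric])
  also have "\<dots> = ennreal (1 / (pi * (cmod s)\<^sup>2)) * (\<integral>\<^sup>+z. f z \<partial>lborel)"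
    using s by (subst nn_integral_complex_affine[symmetric]) simp_all
  finally show ?thesis .
qed

text \<open>For fixed \<open>u = \<alpha> x + \<beta> y\<close> the exponent is a complete square in \<open>x\<close>:
  \<open>|x|\<^sup>2 + |y|\<^sup>2 = |u|\<^sup>2 + |x - cnj \<alpha> u|\<^sup>2 / |\<beta>|\<^sup>2\<close>.\<close>

lemma cgauss_complete_square:
  fixes \<alpha> \<beta> x y :: complex
  assumes "(cmod \<alpha>)\<^sup>2 + (cmod \<beta>)\<^sup>2 = 1"
  shows "(cmod \<beta>)\<^sup>2 * ((cmod x)\<^sup>2 + (cmod y)\<^sup>2)
    = (cmod \<beta>)\<^sup>2 * (cmod (\<alpha> * x + \<beta> * y))\<^sup>2 + (cmod (x - cnj \<alpha> * (\<alpha> * x + \<beta> * y)))\<^sup>2"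
proof -
  have 1: "\<alpha> * cnj \<alpha> = 1 - \<beta> * cnj \<beta>"
    using assms by (metis add_diff_cancel_right' complex_norm_square of_real_1 of_real_add)
  have "x - cnj \<alpha> * (\<alpha> * x + \<beta> * y) = \<beta> * (cnj \<beta> * x - cnj \<alpha> * y)"
  proof -
    have "x - cnj \<alpha> * (\<alpha> * x + \<beta> * y) = x - (\<alpha> * cnj \<alpha>) * x - cnj \<alpha> * \<beta> * y"
      by (simp add: algebra_simps)
    then show ?thesis
      unfolding 1 by (simp add: algebra_simps)
  qed
  then have 2: "(cmod (x - cnj \<alpha> * (\<alpha> * x + \<beta> * y)))\<^sup>2 = (cmod \<beta>)\<^sup>2 * (cmod (cnj \<beta> * x - cnj \<alpha> * y))\<^sup>2"
    by (simp add: norm_mult power_mult_distrib)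
  have "complex_of_real ((cmod (\<alpha> * x + \<beta> * y))\<^sup>2 + (cmod (cnj \<beta> * x - cnj \<alpha> * y))\<^sup>2)
      = (\<alpha> * cnj \<alpha> + \<beta> * cnj \<beta>) * (x * cnj x + y * cnj y)"
    unfolding of_real_add complex_norm_square by (simp add: algebra_simps)
  also have "\<dots> = complex_of_real ((cmod x)\<^sup>2 + (cmod y)\<^sup>2)"
    unfolding 1 of_real_add complex_norm_square by simp
  finally have "(cmod (\<alpha> * x + \<beta> * y))\<^sup>2 + (cmod (cnj \<beta> * x - cnj \<alpha> * y))\<^sup>2 = (cmod x)\<^sup>2 + (cmod y)\<^sup>2"
    using of_real_eq_iff by blast
  then show ?thesis
    unfolding 2 by (metis distrib_left)
qed

lemma nn_integral_cgauss_rotate: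
  fixes \<alpha> :: complex
  assumes [measurable]: "f \<in> borel_measurable borel" and "cmod \<alpha> = 1"
  shows "(\<integral>\<^sup>+x. f (\<alpha> * x) \<partial>cgauss) = (\<integral>\<^sup>+x. f x \<partial>cgauss)"
proof -
  have "\<alpha> \<noteq> 0" using assms by auto
  then have "(\<integral>\<^sup>+x. f x \<partial>cgauss)
      = ennreal ((cmod \<alpha>)\<^sup>2) * (\<integral>\<^sup>+z. ennreal (exp (- (cmod (\<alpha> * z))\<^sup>2) / pi) * f (\<alpha> * z) \<partial>lborel)"
    by (subst nn_integral_cgauss, simp, subst nn_integral_complex_mult[of _ \<alpha>]) simp_all
  also have "\<dots> = (\<integral>\<^sup>+x. f (\<alpha> * x) \<partial>cgauss)"
    using assms by (subst nn_integral_cgauss) (simp_all add: norm_mult)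
  finally show ?thesis by simp
qed

text \<open>This is what lets a receiver top up reduced noise to unit variance. After substituting
  \<open>u = \<alpha> * x + \<beta> * y\<close> for \<open>y\<close> and completing the square, the
  integral over \<open>x\<close> is that of a normalised Gaussian centred at
  \<open>cnj \<alpha> * u\<close>. The substitution divides by \<open>\<beta>\<close>, hence the
  separate case \<open>\<beta> = 0\<close>, a pure rotation.\<close>

lemma nn_integral_cgauss_convolution:
  fixes \<alpha> \<beta> :: complex
  assumes [measurable]: "f \<in> borel_measurable borel"
    and ab: "(cmod \<alpha>)\<^sup>2 + (cmod \<beta>)\<^sup>2 = 1"
  shows "(\<integral>\<^sup>+x. \<integral>\<^sup>+y. f (\<alpha> * x + \<beta> * y) \<partial>cgauss \<partial>cgauss) = (\<integral>\<^sup>+z. f z \<partial>cgauss)"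
proof (cases "\<beta> = 0")
  case True
  then have "cmod \<alpha> = 1" using ab by (smt (verit) norm_ge_zero power2_eq_1_iff norm_zero power_zero_numeral)
  then show ?thesis using True
    by (simp add: nn_integral_cgauss_rotate cgauss.emeasure_space_1[simplified])
next
  case False
  define B where "B = (cmod \<beta>)\<^sup>2"
  have B: "B > 0" using False by (simp add: B_def)
  have inner: "(\<integral>\<^sup>+y. ennreal (exp (- (cmod y)\<^sup>2) / pi) * f (\<alpha> * x + \<beta> * y) \<partial>lborel) * ennreal (exp (- (cmod x)\<^sup>2) / pi)
    = (\<integral>\<^sup>+u. ennreal (exp (- (cmod u)\<^sup>2) / pi) * f u * (ennreal (exp (- ((cmod (x - cnj \<alpha> * u))\<^sup>2 / B))) * ennreal (1 / (pi * B))) \<partial>lborel)"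
    (is "?L = ?R") for x
  proof -
    have "?R = ennreal B * (\<integral>\<^sup>+y. ennreal (exp (- (cmod (\<alpha> * x + \<beta> * y))\<^sup>2) / pi) * f (\<alpha> * x + \<beta> * y) *
       (ennreal (exp (- ((cmod (x - cnj \<alpha> * (\<alpha> * x + \<beta> * y)))\<^sup>2 / B))) * ennreal (1 / (pi * B))) \<partial>lborel)"
      unfolding B_def by (rule nn_integral_complex_affine) (use False in simp_all)
    also have "\<dots> = (\<integral>\<^sup>+y. ennreal B * (ennreal (exp (- (cmod (\<alpha> * x + \<beta> * y))\<^sup>2) / pi) * f (\<alpha> * x + \<beta> * y) *
       (ennreal (exp (- ((cmod (x - cnj \<alpha> * (\<alpha> * x + \<beta> * y)))\<^sup>2 / B))) * ennreal (1 / (pi * B)))) \<partial>lborel)"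
      by (subst nn_integral_cmult) simp_all
    also have "\<dots> = (\<integral>\<^sup>+y. ennreal (exp (- (cmod y)\<^sup>2) / pi) * f (\<alpha> * x + \<beta> * y) * ennreal (exp (- (cmod x)\<^sup>2) / pi) \<partial>lborel)"
    proof (rule nn_integral_cong)
      fix y
      let ?u = "\<alpha> * x + \<beta> * y"
      have "(cmod x)\<^sup>2 + (cmod y)\<^sup>2 = (cmod ?u)\<^sup>2 + (cmod (x - cnj \<alpha> * ?u))\<^sup>2 / B"
        using cgauss_complete_square[OF ab, of x y] B by (simp add: B_def[symmetric] field_simps)
      then have "exp (- (cmod ?u)\<^sup>2) * exp (- ((cmod (x - cnj \<alpha> * ?u))\<^sup>2 / B))
          = exp (- (cmod y)\<^sup>2) * exp (- (cmod x)\<^sup>2)"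
        by (simp add: mult_exp_exp)
      then have "B * (exp (- (cmod ?u)\<^sup>2) / pi * (exp (- ((cmod (x - cnj \<alpha> * ?u))\<^sup>2 / B)) * (1 / (pi * B))))
          = exp (- (cmod y)\<^sup>2) / pi * (exp (- (cmod x)\<^sup>2) / pi)"
        using B by (simp add: field_simps)
      then have e: "ennreal B * (ennreal (exp (- (cmod ?u)\<^sup>2) / pi) * (ennreal (exp (- ((cmod (x - cnj \<alpha> * ?u))\<^sup>2 / B))) * ennreal (1 / (pi * B))))
          = ennreal (exp (- (cmod y)\<^sup>2) / pi) * ennreal (exp (- (cmod x)\<^sup>2) / pi)"
        using B by (simp add: ennreal_mult[symmetric])
      show "ennreal B * (ennreal (exp (- (cmod ?u)\<^sup>2) / pi) * f ?u *
          (ennreal (exp (- ((cmod (x - cnj \<alpha> * ?u))\<^sup>2 / B))) * ennreal (1 / (pi * B))))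
        = ennreal (exp (- (cmod y)\<^sup>2) / pi) * f ?u * ennreal (exp (- (cmod x)\<^sup>2) / pi)"
        using arg_cong[OF e, of "\<lambda>t. f ?u * t"] by (simp only: mult_ac)
    qed
    also have "\<dots> = ?L"
      by (subst nn_integral_multc) simp_all
    finally show ?thesis by simp
  qed
  have g: "(\<integral>\<^sup>+x. ennreal (exp (- ((cmod (x - cnj \<alpha> * u))\<^sup>2 / B))) * ennreal (1 / (pi * B)) \<partial>lborel) = 1" for u
  proof -
    have "(\<integral>\<^sup>+x. ennreal (exp (- ((cmod (x - cnj \<alpha> * u))\<^sup>2 / B))) \<partial>lborel) = ennreal (pi * B)"
      by (subst nn_integral_complex_affine[where c = 1 and t = "cnj \<alpha> * u"])
        (use nn_integral_gaussian_complex[OF B] in simp_all)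
    then show ?thesis
      using B by (subst nn_integral_multc) (simp_all add: ennreal_mult[symmetric])
  qed
  have "(\<integral>\<^sup>+x. \<integral>\<^sup>+y. f (\<alpha> * x + \<beta> * y) \<partial>cgauss \<partial>cgauss)
    = (\<integral>\<^sup>+x. (\<integral>\<^sup>+y. ennreal (exp (- (cmod y)\<^sup>2) / pi) * f (\<alpha> * x + \<beta> * y) \<partial>lborel) * ennreal (exp (- (cmod x)\<^sup>2) / pi) \<partial>lborel)"
    by (simp add: nn_integral_cgauss mult.commute)
  also have "\<dots> = (\<integral>\<^sup>+u. \<integral>\<^sup>+x. ennreal (exp (- (cmod u)\<^sup>2) / pi) * f u * (ennreal (exp (- ((cmod (x - cnj \<alpha> * u))\<^sup>2 / B))) * ennreal (1 / (pi * B))) \<partial>lborel \<partial>lborel)"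
    unfolding inner by (subst lborel_pair.Fubini'[symmetric]) simp_all
  also have "\<dots> = (\<integral>\<^sup>+u. ennreal (exp (- (cmod u)\<^sup>2) / pi) * f u \<partial>lborel)"
    by (subst nn_integral_cmult, simp) (simp add: g)
  also have "\<dots> = (\<integral>\<^sup>+z. f z \<partial>cgauss)"
    by (simp add: nn_integral_cgauss)
  finally show ?thesis .
qed

section \<open>Blocks of Gaussian noise\<close>

interpretation cgauss_prod: product_sigma_finite "\<lambda>_. cgauss" ..

interpretation lborel_prod: product_sigma_finite "\<lambda>_. lborel" ..

lemma prob_space_PiM_cgauss: "prob_space (PiM I (\<lambda>_. cgauss))"
  by (rule prob_space_PiM) (rule prob_space_cgauss)

lemma PiM_cgauss_borel [measurable_cong]: "sets (PiM I (\<lambda>_. cgauss)) = sets (PiM I (\<lambda>_. borel))"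
  by (rule sets_PiM_cong) simp_all

lemma PiM_lborel_borel [measurable_cong]: "sets (PiM I (\<lambda>_. lborel)) = sets (PiM I (\<lambda>_. borel))"
  by (rule sets_PiM_cong) simp_all

text \<open>The coefficients may vary with \<open>p\<close> because the ratio of two channel gains
  varies with the frequency slot. Agreement on boxes suffices, where the indicator factors over the
  coordinates.\<close>

lemma distr_PiM_cgauss_convolution:
  fixes \<alpha> \<beta> :: "'i \<Rightarrow> complex"
  assumes I: "finite I" and ab: "\<And>p. p \<in> I \<Longrightarrow> (cmod (\<alpha> p))\<^sup>2 + (cmod (\<beta> p))\<^sup>2 = 1"
  shows "distr (PiM I (\<lambda>_. cgauss) \<Otimes>\<^sub>M PiM I (\<lambda>_. cgauss)) (PiM I (\<lambda>_. cgauss))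
    (\<lambda>(x, y). \<lambda>p\<in>I. \<alpha> p * x p + \<beta> p * y p) = PiM I (\<lambda>_. cgauss)" (is "?D = ?N")
proof (rule cgauss_prod.PiM_eqI)
  interpret N: prob_space ?N by (rule prob_space_PiM_cgauss)
  fix A :: "'i \<Rightarrow> complex set"
  assume A: "\<And>p. p \<in> I \<Longrightarrow> A p \<in> sets cgauss"
  note A' = A[simplified]
  have m: "(\<lambda>(x, y). \<lambda>p\<in>I. \<alpha> p * x p + \<beta> p * y p) \<in> ?N \<Otimes>\<^sub>M ?N \<rightarrow>\<^sub>M ?N"
    unfolding split_beta by measurable
  have S: "Pi\<^sub>E I A \<in> sets ?N"
    using I A by (intro sets_PiM_I_finite) auto
  have e: "indicator (Pi\<^sub>E I A) (\<lambda>p\<in>I. \<alpha> p * x p + \<beta> p * y p)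
    = (\<Prod>p\<in>I. indicator (A p) (\<alpha> p * x p + \<beta> p * y p) :: ennreal)" for x y
    using I by (auto simp: indicator_def PiE_def Pi_def extensional_def intro!: prod.neutral[symmetric])
  have "emeasure ?D (Pi\<^sub>E I A) = (\<integral>\<^sup>+u. indicator (Pi\<^sub>E I A) u \<partial>?D)"
    using S by simp
  also have "\<dots> = (\<integral>\<^sup>+x. \<integral>\<^sup>+y. indicator (Pi\<^sub>E I A) (\<lambda>p\<in>I. \<alpha> p * x p + \<beta> p * y p) \<partial>?N \<partial>?N)"
    using S m by (subst nn_integral_distr) (simp_all add: N.nn_integral_fst[symmetric] split_beta)
  also have "\<dots> = (\<integral>\<^sup>+x. (\<Prod>p\<in>I. \<integral>\<^sup>+y. indicator (A p) (\<alpha> p * x p + \<beta> p * y) \<partial>cgauss) \<partial>?N)"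
    unfolding e
  proof (rule nn_integral_cong)
    fix x
    show "(\<integral>\<^sup>+y. (\<Prod>p\<in>I. indicator (A p) (\<alpha> p * x p + \<beta> p * y p)) \<partial>?N)
      = (\<Prod>p\<in>I. \<integral>\<^sup>+y. indicator (A p) (\<alpha> p * x p + \<beta> p * y) \<partial>cgauss)"
      by (rule cgauss_prod.product_nn_integral_prod[OF I]) (use A' in measurable)
  qed
  also have "\<dots> = (\<Prod>p\<in>I. \<integral>\<^sup>+x. \<integral>\<^sup>+y. indicator (A p) (\<alpha> p * x + \<beta> p * y) \<partial>cgauss \<partial>cgauss)"
    by (rule cgauss_prod.product_nn_integral_prod[OF I]) (use A' in measurable)
  also have "\<dots> = (\<Prod>p\<in>I. emeasure cgauss (A p))"
    by (intro prod.cong refl, subst nn_integral_cgauss_convolution) (use A' ab in simp_all)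
  finally show "emeasure ?D (Pi\<^sub>E I A) = (\<Prod>p\<in>I. emeasure cgauss (A p))" .
qed (use I in simp_all)

lemma nn_integral_PiM_cgauss_convolution:
  fixes \<alpha> \<beta> :: "'i \<Rightarrow> complex"
  assumes I: "finite I" and ab: "\<And>p. p \<in> I \<Longrightarrow> (cmod (\<alpha> p))\<^sup>2 + (cmod (\<beta> p))\<^sup>2 = 1"
    and [measurable]: "F \<in> borel_measurable (PiM I (\<lambda>_. borel))"
  shows "(\<integral>\<^sup>+x. \<integral>\<^sup>+y. F (\<lambda>p\<in>I. \<alpha> p * x p + \<beta> p * y p) \<partial>PiM I (\<lambda>_. cgauss) \<partial>PiM I (\<lambda>_. cgauss))
    = (\<integral>\<^sup>+z. F z \<partial>PiM I (\<lambda>_. cgauss))"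
proof -
  interpret N: prob_space "PiM I (\<lambda>_. cgauss)" by (rule prob_space_PiM_cgauss)
  have m: "(\<lambda>(x, y). \<lambda>p\<in>I. \<alpha> p * x p + \<beta> p * y p) \<in> PiM I (\<lambda>_. cgauss) \<Otimes>\<^sub>M PiM I (\<lambda>_. cgauss) \<rightarrow>\<^sub>M PiM I (\<lambda>_. cgauss)"
    unfolding split_beta by measurable
  show ?thesis
    by (subst (3) distr_PiM_cgauss_convolution[OF I ab, symmetric], assumption)
      (use m in \<open>simp add: nn_integral_distr N.nn_integral_fst[symmetric] split_beta\<close>)
qed

text \<open>Compares the law of a noisy output with Lebesgue measure, at a cost exponential in the
  number of slots but independent of the signal \<open>t\<close>.\<close>

lemma nn_integral_PiM_cgauss_affine_le:
  fixes s :: complex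
  assumes "finite I" and s: "s \<noteq> 0"
    and "F \<in> borel_measurable (PiM I (\<lambda>_. borel))"
  shows "(\<integral>\<^sup>+x. F (\<lambda>p\<in>I. t p + s * x p) \<partial>PiM I (\<lambda>_. cgauss))
    \<le> ennreal (1 / (pi * (cmod s)\<^sup>2)) ^ card I * (\<integral>\<^sup>+u. F u \<partial>PiM I (\<lambda>_. lborel))"
  using assms(1,3)
proof (induction I arbitrary: F)
  case empty
  show ?case
    by (subst cgauss_prod.nn_integral_empty, simp, subst lborel_prod.nn_integral_empty)
      (simp_all add: restrict_def)
next
  case (insert i I)
  note [measurable] = insert.prems
  let ?c = "ennreal (1 / (pi * (cmod s)\<^sup>2))"
  define T where "T x = (\<lambda>p\<in>I. t p + s * x p)" for x
  have eq: "(\<lambda>p\<in>insert i I. t p + s * (x(i := y)) p) = (T x)(i := t i + s * y)" for x y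
    using insert.hyps by (auto simp: T_def fun_eq_iff)
  have [measurable]: "T \<in> PiM I (\<lambda>_. borel) \<rightarrow>\<^sub>M PiM I (\<lambda>_. borel)"
    unfolding T_def by measurable
  have [measurable]: "(\<lambda>z. F ((fst z)(i := snd z))) \<in> borel_measurable (PiM I (\<lambda>_. borel) \<Otimes>\<^sub>M borel)"
    by measurable
  have Tm: "T x \<in> space (PiM I (\<lambda>_. borel))" for x
    by (simp add: T_def space_PiM)
  have Fm: "(\<lambda>y. F ((T x)(i := y))) \<in> borel_measurable borel" for x
    using measurable_Pair2[of "\<lambda>z. F ((fst z)(i := snd z))" "PiM I (\<lambda>_. borel)" borel borel, OF _ Tm]
    by simp
  have gm: "(\<lambda>x. \<integral>\<^sup>+y. F (x(i := y)) \<partial>lborel) \<in> borel_measurable (PiM I (\<lambda>_. borel))"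
    by measurable
  have "(\<integral>\<^sup>+x. F (\<lambda>p\<in>insert i I. t p + s * x p) \<partial>PiM (insert i I) (\<lambda>_. cgauss))
    = (\<integral>\<^sup>+x. \<integral>\<^sup>+y. F ((T x)(i := t i + s * y)) \<partial>cgauss \<partial>PiM I (\<lambda>_. cgauss))"
    using insert.hyps by (subst cgauss_prod.product_nn_integral_insert) (simp_all only: eq, simp_all)
  also have "\<dots> \<le> (\<integral>\<^sup>+x. ?c * (\<integral>\<^sup>+y. F ((T x)(i := y)) \<partial>lborel) \<partial>PiM I (\<lambda>_. cgauss))"
    by (intro nn_integral_mono nn_integral_cgauss_affine_le s Fm)
  also have "\<dots> = ?c * (\<integral>\<^sup>+x. (\<integral>\<^sup>+y. F ((T x)(i := y)) \<partial>lborel) \<partial>PiM I (\<lambda>_. cgauss))"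
    by (subst nn_integral_cmult) simp_all
  also have "\<dots> \<le> ?c * (?c ^ card I * (\<integral>\<^sup>+x. (\<integral>\<^sup>+y. F (x(i := y)) \<partial>lborel) \<partial>PiM I (\<lambda>_. lborel)))"
    unfolding T_def by (rule mult_left_mono[OF insert.IH[OF gm]]) simp
  also have "\<dots> = ?c ^ card (insert i I) * (\<integral>\<^sup>+u. F u \<partial>PiM (insert i I) (\<lambda>_. lborel))"
    using insert.hyps by (subst lborel_prod.product_nn_integral_insert) (simp_all add: mult.assoc)
  finally show ?case .
qed

lemma nn_integral_PiM_gaussian:
  assumes "finite I" "0 < P"
  shows "(\<integral>\<^sup>+u. (\<Prod>p\<in>I. ennreal (exp (- ((cmod (u p))\<^sup>2 / P)))) \<partial>PiM I (\<lambda>_. lborel)) = ennreal (pi * P) ^ card I"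
  using assms by (subst lborel_prod.product_nn_integral_prod) (simp_all add: nn_integral_gaussian_complex)

text \<open>On the ball \<open>\<Sum>|u\<^sub>p|\<^sup>2 \<le> n P\<close> the weight \<open>exp (n - \<Sum>|u\<^sub>p|\<^sup>2 / P)\<close> is at least \<open>1\<close>;
  this replaces the volume of the ball by a Gaussian integral.\<close>

lemma nn_integral_PiM_cgauss_truncated_le:
  fixes s :: complex and P :: real
  assumes I: "finite I" and s: "s \<noteq> 0" and P: "0 < P"
    and [measurable]: "F \<in> borel_measurable (PiM I (\<lambda>_. borel))"
  shows "(\<integral>\<^sup>+x. (if (\<Sum>p\<in>I. (cmod (t p + s * x p))\<^sup>2) \<le> card I * P
            then F (\<lambda>p\<in>I. t p + s * x p) else 0) \<partial>PiM I (\<lambda>_. cgauss))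
    \<le> ennreal (exp 1 / (pi * (cmod s)\<^sup>2)) ^ card I
        * (\<integral>\<^sup>+u. F u * (\<Prod>p\<in>I. ennreal (exp (- ((cmod (u p))\<^sup>2 / P)))) \<partial>PiM I (\<lambda>_. lborel))"
proof -
  let ?w = "\<lambda>u. (\<Prod>p\<in>I. ennreal (exp (- ((cmod (u p))\<^sup>2 / P))))"
  define G where "G u = ennreal (exp (card I)) * (F u * ?w u)" for u
  have [measurable]: "G \<in> borel_measurable (PiM I (\<lambda>_. borel))"
    unfolding G_def by measurable
  have le: "(if (\<Sum>p\<in>I. (cmod (t p + s * x p))\<^sup>2) \<le> card I * P then F (\<lambda>p\<in>I. t p + s * x p) else 0)
      \<le> G (\<lambda>p\<in>I. t p + s * x p)" for x
  proof (cases "(\<Sum>p\<in>I. (cmod (t p + s * x p))\<^sup>2) \<le> card I * P")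
    case True
    let ?u = "\<lambda>p\<in>I. t p + s * x p"
    have "?w ?u = ennreal (exp (\<Sum>p\<in>I. - ((cmod (t p + s * x p))\<^sup>2 / P)))"
      using I by (simp add: exp_sum prod_ennreal)
    moreover have "1 \<le> exp (real (card I)) * exp (\<Sum>p\<in>I. - ((cmod (t p + s * x p))\<^sup>2 / P))"
      using True P by (simp add: mult_exp_exp sum_negf sum_divide_distrib[symmetric] pos_divide_le_eq)
    ultimately have "1 \<le> ennreal (exp (card I)) * ?w ?u"
      by (simp add: ennreal_mult[symmetric])
    from mult_left_mono[OF this, of "F ?u"] show ?thesis
      using True by (simp add: G_def mult_ac)
  qed simp
  have "(\<integral>\<^sup>+x. (if (\<Sum>p\<in>I. (cmod (t p + s * x p))\<^sup>2) \<le> card I * P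
            then F (\<lambda>p\<in>I. t p + s * x p) else 0) \<partial>PiM I (\<lambda>_. cgauss))
    \<le> (\<integral>\<^sup>+x. G (\<lambda>p\<in>I. t p + s * x p) \<partial>PiM I (\<lambda>_. cgauss))"
    by (intro nn_integral_mono le)
  also have "\<dots> \<le> ennreal (1 / (pi * (cmod s)\<^sup>2)) ^ card I * (\<integral>\<^sup>+u. G u \<partial>PiM I (\<lambda>_. lborel))"
    by (rule nn_integral_PiM_cgauss_affine_le[OF I s]) simp
  also have "\<dots> = ennreal (1 / (pi * (cmod s)\<^sup>2)) ^ card I * (ennreal (exp (card I)) * (\<integral>\<^sup>+u. F u * ?w u \<partial>PiM I (\<lambda>_. lborel)))"
    unfolding G_def by (subst nn_integral_cmult) simp_all
  also have "\<dots> = ennreal (exp 1 / (pi * (cmod s)\<^sup>2)) ^ card I * (\<integral>\<^sup>+u. F u * ?w u \<partial>PiM I (\<lambda>_. lborel))"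
    by (simp add: mult.assoc[symmetric] ennreal_power ennreal_mult[symmetric] exp_of_nat_mult[symmetric]
        power_divide power_mult_distrib)
  finally show ?thesis .
qed

section \<open>Counting message tuples\<close>

lemma sum_PiE_coordinate:
  fixes f :: "'b \<Rightarrow> real"
  assumes "finite I" "i \<in> I" "\<And>j. j \<in> I \<Longrightarrow> finite (A j)"
  shows "(\<Sum>w\<in>PiE I A. f (w i)) = (\<Prod>j\<in>I - {i}. real (card (A j))) * (\<Sum>v\<in>A i. f v)"
proof -
  \<comment> \<open>Distributing a product of sums in which only the factor at \<open>i\<close>
    carries \<open>f\<close> and all other summands are 1.\<close>
  have "(\<Prod>j\<in>I. \<Sum>v\<in>A j. (if j = i then f v else 1)) = (\<Sum>w\<in>PiE I A. \<Prod>j\<in>I. if j = i then f (w j) else 1)"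
    using assms by (intro prod_sum_PiE) auto
  moreover have "(\<Prod>j\<in>I. if j = i then f (w j) else 1) = f (w i)" for w
    using assms by simp
  moreover have "(\<Prod>j\<in>I. \<Sum>v\<in>A j. (if j = i then f v else 1))
      = (\<Sum>v\<in>A i. f v) * (\<Prod>j\<in>I - {i}. \<Sum>v\<in>A j. (if j = i then f v else 1))"
    using assms by (subst prod.remove[of _ i]) simp_all
  ultimately show ?thesis
    by (simp add: mult.commute)
qed

text \<open>The function \<open>b\<close> may depend on all coordinates but \<open>j\<close>: once the coordinates other than
  \<open>i, j\<close> are fixed, the constraints determine first \<open>w i\<close> and then \<open>w j\<close>.\<close>

lemma card_PiE_two_determined:
  assumes I: "finite I" "i \<in> I" "j \<in> I" "i \<noteq> j" and A: "\<And>l. l \<in> I \<Longrightarrow> finite (A l)"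
    and b: "\<And>v w. v \<in> PiE I A \<Longrightarrow> w \<in> PiE I A \<Longrightarrow> (\<And>l. l \<in> I \<Longrightarrow> l \<noteq> j \<Longrightarrow> v l = w l) \<Longrightarrow> b v = b w"
  shows "card {w \<in> PiE I A. w i = a \<and> w j = b w} \<le> (\<Prod>l\<in>I - {i, j}. card (A l))"
proof -
  let ?S = "{w \<in> PiE I A. w i = a \<and> w j = b w}"
  let ?r = "\<lambda>w. restrict w (I - {i, j})"
  have "inj_on ?r ?S"
  proof (rule inj_onI)
    fix v w assume v: "v \<in> ?S" and w: "w \<in> ?S" and eq: "?r v = ?r w"
    have 1: "v l = w l" if "l \<in> I" "l \<noteq> j" for l
    proof (cases "l = i")
      case False
      then have "l \<in> I - {i, j}" using that by auto
      then show ?thesis using fun_cong[OF eq, of l] by simp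
    qed (use v w in auto)
    then have "b v = b w" using v w by (intro b) auto
    then have "v l = w l" if "l \<in> I" for l
      using 1[OF that] v w by (cases "l = j") auto
    then show "v = w" using v w by (intro PiE_ext[of v I A w]) auto
  qed
  moreover have "?r ` ?S \<subseteq> PiE (I - {i, j}) A"
    by (auto simp: PiE_def Pi_def)
  moreover have "finite (PiE (I - {i, j}) A)"
    using I A by (intro finite_PiE) auto
  ultimately have "card ?S \<le> card (PiE (I - {i, j}) A)"
    by (rule card_inj_on_le)
  then show ?thesis
    using I by (simp add: card_PiE)
qed

section \<open>Upper bound on the degrees of freedom\<close>

definition rx_signal :: "nat \<Rightarrow> (nat \<Rightarrow> nat \<Rightarrow> nat \<Rightarrow> complex)
    \<Rightarrow> (nat \<Rightarrow> nat \<Rightarrow> nat \<times> nat \<Rightarrow> complex) \<Rightarrow> (nat \<Rightarrow> nat) \<Rightarrow> nat \<Rightarrow> nat \<times> nat \<Rightarrow> complex" where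
  "rx_signal K H X w k p = (\<Sum>l<K. H k l (fst p) * X l (w l) p)"

lemma rx_eq: "rx K H f0 t0 X w k z = (\<lambda>p\<in>blk f0 t0. rx_signal K H X w k p + z p)"
  by (auto simp: rx_def rx_signal_def fun_eq_iff)

lemma finite_blk [simp]: "finite (blk f0 t0)"
  by (simp add: blk_def)

lemma card_blk [simp]: "card (blk f0 t0) = f0 * t0"
  by (simp add: blk_def)

lemma prob_space_noise_space: "prob_space (noise_space f0 t0)"
  unfolding noise_space_def by (rule prob_space_PiM_cgauss)

lemma sets_noise_space [measurable_cong]: "sets (noise_space f0 t0) = sets (PiM (blk f0 t0) (\<lambda>_. borel))"
  unfolding noise_space_def by (rule PiM_cgauss_borel)

lemma nn_integral_noise_component:
  assumes "p \<in> blk f0 t0" and [measurable]: "f \<in> borel_measurable borel"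
  shows "(\<integral>\<^sup>+x. f (x p) \<partial>noise_space f0 t0) = (\<integral>\<^sup>+z. f z \<partial>cgauss)"
proof -
  have "cgauss = distr (noise_space f0 t0) cgauss (\<lambda>x. x p)"
    unfolding noise_space_def
    by (rule distr_PiM_component[symmetric]) (use assms prob_space_cgauss in auto)
  then have "(\<integral>\<^sup>+z. f z \<partial>cgauss) = (\<integral>\<^sup>+z. f z \<partial>distr (noise_space f0 t0) cgauss (\<lambda>x. x p))"
    by simp
  also have "\<dots> = (\<integral>\<^sup>+x. f (x p) \<partial>noise_space f0 t0)"
    using assms by (subst nn_integral_distr) auto
  finally show ?thesis by simp
qed

text \<open>Receiver \<open>i\<close>, given the less noisy output \<open>u = S\<^sub>i + s x\<close>, can simulate its own output and decode
  message \<open>i\<close>; it then knows everything in \<open>u\<close> but the signal of user \<open>j\<close> and, after rescaling by \<open>ratio\<close>,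
  can also simulate the output of receiver \<open>j\<close>.\<close>

locale two_user_converse =
  fixes K f0 t0 :: nat and H :: "nat \<Rightarrow> nat \<Rightarrow> nat \<Rightarrow> complex" and \<rho> hmin hmax :: real
    and M :: "nat \<Rightarrow> nat" and X :: "nat \<Rightarrow> nat \<Rightarrow> nat \<times> nat \<Rightarrow> complex"
    and g :: "nat \<Rightarrow> (nat \<times> nat \<Rightarrow> complex) \<Rightarrow> nat" and i j :: nat
  assumes ij: "i < K" "j < K" "i \<noteq> j" and f0: "0 < f0" and t0: "0 < t0"
    and hmin: "0 < hmin" "hmin \<le> hmax" and rho: "0 \<le> \<rho>"
    and H: "\<And>k l f. k < K \<Longrightarrow> l < K \<Longrightarrow> hmin \<le> cmod (H k l f) \<and> cmod (H k l f) \<le> hmax"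
    and code: "is_code K \<rho> f0 t0 M X g"
    and err: "err K H f0 t0 M X g i \<le> 1 / 8" "err K H f0 t0 M X g j \<le> 1 / 8"
begin

abbreviation "I \<equiv> blk f0 t0"
abbreviation "N \<equiv> noise_space f0 t0"
abbreviation "W \<equiv> PiE {..<K} (\<lambda>l. {..<M l})"
text \<open>Small enough that \<open>ratio p * s\<close> has modulus at most 1 for all admissible
  gains, so noise only has to be added, never removed.\<close>

definition "s = hmin / hmax"
text \<open>Four times the bound \<open>2 * hmax\<^sup>2 * K * \<rho> + 8\<close> for the mean
  energy per slot in \<open>sum_large\<close>, so that Markov's inequality yields exactly
  \<open>1 / 4\<close>.\<close>

definition "P = 8 * hmax\<^sup>2 * real K * \<rho> + 32"
definition "S k w p = rx_signal K H X w k p"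
definition "ratio p = H j j (fst p) / H i j (fst p)"
text \<open>\<open>ratio\<close> equalises the coefficients of user \<open>j\<close> in both
  signals, so \<open>T\<close> does not depend on the message of user \<open>j\<close>.\<close>

definition "T w p = S j w p - ratio p * S i w p"
text \<open>The amplitude with which the reduced noise reaches the simulated output of receiver
  \<open>j\<close>. \<open>\<beta>\<close> and \<open>s'\<close> are the amplitudes of the fresh
  noise that restores unit variance at receivers \<open>j\<close> and \<open>i\<close>.\<close>

definition "\<alpha> p = ratio p * of_real s"
definition "\<beta> p = complex_of_real (sqrt (1 - (cmod (\<alpha> p))\<^sup>2))"
definition "s' = complex_of_real (sqrt (1 - s\<^sup>2))"
text \<open>Both decoders are fed from the same \<open>u\<close>. Through \<open>T w p\<close> the
  second one gets the true signals of all users but \<open>j\<close>, as if from a genie.\<close>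

definition ok :: "(nat \<times> nat \<Rightarrow> complex) \<Rightarrow> (nat \<times> nat \<Rightarrow> complex) \<Rightarrow> (nat \<Rightarrow> nat) \<Rightarrow> (nat \<times> nat \<Rightarrow> complex) \<Rightarrow> ennreal" where
  "ok x' x'' w u = (if g i (\<lambda>p\<in>I. u p + s' * x' p) = w i \<and>
      g j (\<lambda>p\<in>I. ratio p * u p + T w p + \<beta> p * x'' p) = w j then 1 else 0)"
definition fail :: "nat \<Rightarrow> (nat \<Rightarrow> nat) \<Rightarrow> (nat \<times> nat \<Rightarrow> complex) \<Rightarrow> ennreal" where
  "fail k w z = (if g k (\<lambda>p\<in>I. S k w p + z p) = w k then 0 else 1)"
definition large :: "(nat \<Rightarrow> nat) \<Rightarrow> (nat \<times> nat \<Rightarrow> complex) \<Rightarrow> ennreal" where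
  "large w x = (if (\<Sum>p\<in>I. (cmod (S i w p + of_real s * x p))\<^sup>2) \<le> card I * P then 0 else 1)"
definition good :: "(nat \<times> nat \<Rightarrow> complex) \<Rightarrow> (nat \<times> nat \<Rightarrow> complex) \<Rightarrow> (nat \<Rightarrow> nat) \<Rightarrow> (nat \<times> nat \<Rightarrow> complex) \<Rightarrow> ennreal" where
  "good x' x'' w x = (if (\<Sum>p\<in>I. (cmod (S i w p + of_real s * x p))\<^sup>2) \<le> card I * P
      then ok x' x'' w (\<lambda>p\<in>I. S i w p + of_real s * x p) else 0)"

lemma s_bounds: "0 < s" "s \<le> 1"
  using hmin by (auto simp: s_def)

lemma P_pos: "0 < P"
  using rho by (simp add: P_def add_nonneg_pos)

lemma g_measurable [measurable]:
  "g i \<in> measurable (PiM I (\<lambda>_. borel)) (count_space UNIV)"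
  "g j \<in> measurable (PiM I (\<lambda>_. borel)) (count_space UNIV)"
  using code ij by (auto simp: is_code_def)

lemma M_pos: "l < K \<Longrightarrow> 0 < M l"
  using code by (auto simp: is_code_def Suc_le_eq)

lemma noise_split:
  "(cmod s')\<^sup>2 + (cmod (of_real s))\<^sup>2 = 1" "(cmod (\<beta> p))\<^sup>2 + (cmod (\<alpha> p))\<^sup>2 = 1"
proof -
  have "s\<^sup>2 \<le> 1" using s_bounds by (simp add: power_le_one)
  then show "(cmod s')\<^sup>2 + (cmod (of_real s))\<^sup>2 = 1"
    by (simp add: s'_def)
  have h: "cmod (H j j (fst p)) \<le> hmax" "hmin \<le> cmod (H i j (fst p))"
    using H ij by auto
  have "cmod (\<alpha> p) = cmod (H j j (fst p)) / cmod (H i j (fst p)) * (hmin / hmax)"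
    using hmin by (simp add: \<alpha>_def ratio_def norm_mult norm_divide s_def)
  also have "\<dots> \<le> (hmax / hmin) * (hmin / hmax)"
    using h hmin by (intro mult_right_mono frac_le) auto
  also have "\<dots> = 1" using hmin by simp
  finally have "(cmod (\<alpha> p))\<^sup>2 \<le> 1" by (simp add: power_le_one)
  then show "(cmod (\<beta> p))\<^sup>2 + (cmod (\<alpha> p))\<^sup>2 = 1"
    by (simp add: \<beta>_def)
qed

text \<open>A union bound in pointwise form. The two simulated noises share \<open>x\<close> and are
  therefore dependent, which does no harm: each term is integrated separately, so only its own
  marginal matters.\<close>

lemma one_le_cases:
  "1 \<le> fail i w (\<lambda>p\<in>I. s' * x' p + of_real s * x p) + fail j w (\<lambda>p\<in>I. \<beta> p * x'' p + \<alpha> p * x p)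
        + large w x + good x' x'' w x"
proof -
  have 1: "(\<lambda>p\<in>I. (\<lambda>p\<in>I. S i w p + of_real s * x p) p + s' * x' p)
      = (\<lambda>p\<in>I. S i w p + (\<lambda>p\<in>I. s' * x' p + of_real s * x p) p)"
    by (auto simp: fun_eq_iff)
  have 2: "(\<lambda>p\<in>I. ratio p * (\<lambda>p\<in>I. S i w p + of_real s * x p) p + T w p + \<beta> p * x'' p)
      = (\<lambda>p\<in>I. S j w p + (\<lambda>p\<in>I. \<beta> p * x'' p + \<alpha> p * x p) p)"
    by (auto simp: fun_eq_iff T_def \<alpha>_def algebra_simps)
  show ?thesis
    unfolding good_def ok_def 1 2 by (auto simp: fail_def large_def)
qed

lemma fail_restrict:
  "fail k w (\<lambda>p\<in>I. z p) = (if g k (\<lambda>p\<in>I. S k w p + z p) = w k then 0 else 1)"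
  by (simp add: fail_def cong: restrict_cong)

lemma ok_restrict:
  "ok x' x'' w (\<lambda>p\<in>I. u p) = (if g i (\<lambda>p\<in>I. u p + s' * x' p) = w i \<and>
      g j (\<lambda>p\<in>I. ratio p * u p + T w p + \<beta> p * x'' p) = w j then 1 else 0)"
  by (simp add: ok_def cong: restrict_cong)

lemma measurable_fail_i [measurable]:
  "(\<lambda>(x', x). fail i w (\<lambda>p\<in>I. s' * x' p + of_real s * x p)) \<in> borel_measurable (N \<Otimes>\<^sub>M N)"
  unfolding fail_restrict split_beta by measurable

lemma measurable_fail_j [measurable]:
  "(\<lambda>(x'', x). fail j w (\<lambda>p\<in>I. \<beta> p * x'' p + \<alpha> p * x p)) \<in> borel_measurable (N \<Otimes>\<^sub>M N)"
  unfolding fail_restrict split_beta by measurable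

lemma measurable_large [measurable]: "large w \<in> borel_measurable N"
  unfolding large_def by measurable

lemma measurable_good [measurable]:
  "(\<lambda>(x', x'', x). good x' x'' w x) \<in> borel_measurable (N \<Otimes>\<^sub>M N \<Otimes>\<^sub>M N)"
  unfolding good_def ok_restrict split_beta by measurable

lemma measurable_fail [measurable]:
  "fail i w \<in> borel_measurable (PiM I (\<lambda>_. borel))" "fail j w \<in> borel_measurable (PiM I (\<lambda>_. borel))"
  unfolding fail_def by measurable

lemma measurable_ok [measurable]: "ok x' x'' w \<in> borel_measurable (PiM I (\<lambda>_. borel))"
  unfolding ok_def by measurable

lemma measurable_good_integral:
  shows "x' \<in> space N \<Longrightarrow> x'' \<in> space N \<Longrightarrow> good x' x'' w \<in> borel_measurable N"
    and "x' \<in> space N \<Longrightarrow> (\<lambda>x''. \<integral>\<^sup>+x. good x' x'' w x \<partial>N) \<in> borel_measurable N"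
    and "(\<lambda>x'. \<integral>\<^sup>+x''. \<integral>\<^sup>+x. good x' x'' w x \<partial>N \<partial>N) \<in> borel_measurable N"
proof -
  interpret N: prob_space N by (rule prob_space_noise_space)
  have "(\<lambda>(y, x). good (fst y) (snd y) w x) \<in> borel_measurable ((N \<Otimes>\<^sub>M N) \<Otimes>\<^sub>M N)"
    using measurable_compose[OF _ measurable_good, of "\<lambda>(y, x). (fst y, snd y, x)"]
    by (simp add: split_beta)
  then have G: "(\<lambda>y. \<integral>\<^sup>+x. good (fst y) (snd y) w x \<partial>N) \<in> borel_measurable (N \<Otimes>\<^sub>M N)"
    by (rule N.borel_measurable_nn_integral)
  show "good x' x'' w \<in> borel_measurable N" if "x' \<in> space N" "x'' \<in> space N"
    using measurable_Pair2[OF measurable_Pair2[OF measurable_good that(1), simplified] that(2)] by simp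
  show "(\<lambda>x''. \<integral>\<^sup>+x. good x' x'' w x \<partial>N) \<in> borel_measurable N" if "x' \<in> space N"
    using measurable_Pair2[OF G that] by simp
  show "(\<lambda>x'. \<integral>\<^sup>+x''. \<integral>\<^sup>+x. good x' x'' w x \<partial>N \<partial>N) \<in> borel_measurable N"
    using G by (intro N.borel_measurable_nn_integral) (simp add: split_beta)
qed

text \<open>By convolution the first two terms become the error probabilities of the actual
  receivers. In the last term \<open>x\<close> is integrated innermost, so that the density bound
  can be applied for fixed top-up noises.\<close>

lemma one_le_integrals:
  "1 \<le> (\<integral>\<^sup>+z. fail i w z \<partial>N) + (\<integral>\<^sup>+z. fail j w z \<partial>N) + (\<integral>\<^sup>+x. large w x \<partial>N)
      + (\<integral>\<^sup>+x'. \<integral>\<^sup>+x''. \<integral>\<^sup>+x. good x' x'' w x \<partial>N \<partial>N \<partial>N)"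
proof -
  interpret N: prob_space N by (rule prob_space_noise_space)
  define D1 where "D1 x' x = fail i w (\<lambda>p\<in>I. s' * x' p + of_real s * x p)" for x' x
  define D2 where "D2 x'' x = fail j w (\<lambda>p\<in>I. \<beta> p * x'' p + \<alpha> p * x p)" for x'' x
  let ?c = "\<integral>\<^sup>+x. large w x \<partial>N"
  have D1: "(\<lambda>(x', x). D1 x' x) \<in> borel_measurable (N \<Otimes>\<^sub>M N)"
    unfolding D1_def by (rule measurable_fail_i)
  have D2: "(\<lambda>(x'', x). D2 x'' x) \<in> borel_measurable (N \<Otimes>\<^sub>M N)"
    unfolding D2_def by (rule measurable_fail_j)
  have mD1: "D1 x' \<in> borel_measurable N" and mD2: "D2 x' \<in> borel_measurable N" if "x' \<in> space N" for x'
    using measurable_Pair2[OF D1 that] measurable_Pair2[OF D2 that] by simp_all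
  have iD1: "(\<lambda>x'. \<integral>\<^sup>+x. D1 x' x \<partial>N) \<in> borel_measurable N"
    and iD2: "(\<lambda>x''. \<integral>\<^sup>+x. D2 x'' x \<partial>N) \<in> borel_measurable N"
    using D1 D2 by (auto intro!: N.borel_measurable_nn_integral)
  have i1: "1 \<le> (\<integral>\<^sup>+x. D1 x' x \<partial>N) + (\<integral>\<^sup>+x. D2 x'' x \<partial>N) + ?c + (\<integral>\<^sup>+x. good x' x'' w x \<partial>N)"
    if x: "x' \<in> space N" "x'' \<in> space N" for x' x''
  proof -
    note [measurable] = mD1[OF x(1)] mD2[OF x(2)] measurable_good_integral(1)[OF x]
    have "1 = (\<integral>\<^sup>+x. 1 \<partial>N)"
      by (simp add: N.emeasure_space_1)
    also have "\<dots> \<le> (\<integral>\<^sup>+x. D1 x' x + D2 x'' x + large w x + good x' x'' w x \<partial>N)"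
      unfolding D1_def D2_def by (intro nn_integral_mono one_le_cases)
    also have "\<dots> = (\<integral>\<^sup>+x. D1 x' x \<partial>N) + (\<integral>\<^sup>+x. D2 x'' x \<partial>N) + ?c + (\<integral>\<^sup>+x. good x' x'' w x \<partial>N)"
      by (simp add: nn_integral_add)
    finally show ?thesis .
  qed
  have i2: "1 \<le> (\<integral>\<^sup>+x. D1 x' x \<partial>N) + (\<integral>\<^sup>+x''. \<integral>\<^sup>+x. D2 x'' x \<partial>N \<partial>N) + ?c
      + (\<integral>\<^sup>+x''. \<integral>\<^sup>+x. good x' x'' w x \<partial>N \<partial>N)"
    if x: "x' \<in> space N" for x'
  proof -
    note [measurable] = iD2 measurable_good_integral(2)[OF x]
    have "1 = (\<integral>\<^sup>+x. 1 \<partial>N)"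
      by (simp add: N.emeasure_space_1)
    also have "\<dots> \<le> (\<integral>\<^sup>+x''. (\<integral>\<^sup>+x. D1 x' x \<partial>N) + (\<integral>\<^sup>+x. D2 x'' x \<partial>N) + ?c + (\<integral>\<^sup>+x. good x' x'' w x \<partial>N) \<partial>N)"
      by (intro nn_integral_mono i1 x)
    also have "\<dots> = (\<integral>\<^sup>+x. D1 x' x \<partial>N) + (\<integral>\<^sup>+x''. \<integral>\<^sup>+x. D2 x'' x \<partial>N \<partial>N) + ?c
      + (\<integral>\<^sup>+x''. \<integral>\<^sup>+x. good x' x'' w x \<partial>N \<partial>N)"
      by (simp add: nn_integral_add N.emeasure_space_1)
    finally show ?thesis .
  qed
  note [measurable] = iD1 measurable_good_integral(3)
  have "1 = (\<integral>\<^sup>+x. 1 \<partial>N)"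
    by (simp add: N.emeasure_space_1)
  also have "\<dots> \<le> (\<integral>\<^sup>+x'. (\<integral>\<^sup>+x. D1 x' x \<partial>N) + (\<integral>\<^sup>+x''. \<integral>\<^sup>+x. D2 x'' x \<partial>N \<partial>N) + ?c
      + (\<integral>\<^sup>+x''. \<integral>\<^sup>+x. good x' x'' w x \<partial>N \<partial>N) \<partial>N)"
    by (intro nn_integral_mono i2)
  also have "\<dots> = (\<integral>\<^sup>+x'. \<integral>\<^sup>+x. D1 x' x \<partial>N \<partial>N) + (\<integral>\<^sup>+x''. \<integral>\<^sup>+x. D2 x'' x \<partial>N \<partial>N) + ?c
      + (\<integral>\<^sup>+x'. \<integral>\<^sup>+x''. \<integral>\<^sup>+x. good x' x'' w x \<partial>N \<partial>N \<partial>N)"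
    by (simp add: nn_integral_add N.emeasure_space_1)
  also have "(\<integral>\<^sup>+x'. \<integral>\<^sup>+x. D1 x' x \<partial>N \<partial>N) = (\<integral>\<^sup>+z. fail i w z \<partial>N)"
    unfolding noise_space_def D1_def
    by (rule nn_integral_PiM_cgauss_convolution) (use noise_split in simp_all)
  also have "(\<integral>\<^sup>+x'. \<integral>\<^sup>+x. D2 x' x \<partial>N \<partial>N) = (\<integral>\<^sup>+z. fail j w z \<partial>N)"
    unfolding noise_space_def D2_def
    by (rule nn_integral_PiM_cgauss_convolution) (use noise_split in simp_all)
  finally show ?thesis .
qed

lemma card_W: "real (card W) = (\<Prod>l<K. real (M l))"
  by (simp add: card_PiE)

lemma sum_fail:
  assumes k: "k < K" "k = i \<or> k = j"
  shows "(\<Sum>w\<in>W. \<integral>\<^sup>+z. fail k w z \<partial>N) \<le> ennreal (real (card W) / 8)"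
proof -
  interpret N: prob_space N by (rule prob_space_noise_space)
  have [measurable]: "g k \<in> measurable (PiM I (\<lambda>_. borel)) (count_space UNIV)"
    using k(2) g_measurable by blast
  have "(\<integral>\<^sup>+z. fail k w z \<partial>N) = ennreal (measure N {z \<in> space N. g k (rx K H f0 t0 X w k z) \<noteq> w k})" for w
  proof -
    have [measurable]: "{z \<in> space N. g k (rx K H f0 t0 X w k z) \<noteq> w k} \<in> sets N"
      unfolding rx_eq by measurable
    have "(\<integral>\<^sup>+z. fail k w z \<partial>N) = (\<integral>\<^sup>+z. indicator {z \<in> space N. g k (rx K H f0 t0 X w k z) \<noteq> w k} z \<partial>N)"
      by (intro nn_integral_cong) (auto simp: fail_def S_def rx_eq)
    then show ?thesis by (simp add: N.emeasure_eq_measure)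
  qed
  then have "(\<Sum>w\<in>W. \<integral>\<^sup>+z. fail k w z \<partial>N)
      = ennreal (\<Sum>w\<in>W. measure N {z \<in> space N. g k (rx K H f0 t0 X w k z) \<noteq> w k})"
    by simp
  also have "(\<Sum>w\<in>W. measure N {z \<in> space N. g k (rx K H f0 t0 X w k z) \<noteq> w k})
      = err K H f0 t0 M X g k * real (card W)"
    using M_pos by (auto simp: err_def card_W prod_zero_iff)
  also have "\<dots> \<le> 1 / 8 * real (card W)"
    using err k(2) by (intro mult_right_mono) auto
  finally show ?thesis by (simp add: ennreal_leI)
qed

text \<open>Codewords need not have mean zero, so cross terms between users need not cancel;
  Cauchy-Schwarz over the users avoids them at the price of a factor \<open>K\<close>.\<close>

lemma sum_signal_power:
  "(\<Sum>w\<in>W. \<Sum>p\<in>I. (cmod (S i w p))\<^sup>2) \<le> hmax\<^sup>2 * real K * \<rho> * real (f0 * t0) * real (card W)"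
proof -
  have 1: "(cmod (S i w p))\<^sup>2 \<le> real K * hmax\<^sup>2 * (\<Sum>l<K. (cmod (X l (w l) p))\<^sup>2)" for w p
  proof -
    have "cmod (S i w p) \<le> (\<Sum>l<K. cmod (H i l (fst p) * X l (w l) p))"
      unfolding S_def rx_signal_def by (rule norm_sum)
    also have "\<dots> \<le> (\<Sum>l<K. hmax * cmod (X l (w l) p))"
      using H ij by (intro sum_mono) (auto simp: norm_mult intro!: mult_right_mono)
    finally have "(cmod (S i w p))\<^sup>2 \<le> (\<Sum>l<K. hmax * cmod (X l (w l) p))\<^sup>2"
      by (intro power_mono) auto
    also have "\<dots> \<le> (\<Sum>l<K. (1::real)\<^sup>2) * (\<Sum>l<K. (hmax * cmod (X l (w l) p))\<^sup>2)"
      using Cauchy_Schwarz_ineq_sum[of "\<lambda>_. 1" "\<lambda>l. hmax * cmod (X l (w l) p)" "{..<K}"] by simp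
    also have "\<dots> = real K * hmax\<^sup>2 * (\<Sum>l<K. (cmod (X l (w l) p))\<^sup>2)"
      by (simp add: power_mult_distrib sum_distrib_left mult.assoc)
    finally show ?thesis .
  qed
  have 2: "(\<Sum>w\<in>W. \<Sum>p\<in>I. (cmod (X l (w l) p))\<^sup>2)
      = real (card W) * ((\<Sum>v<M l. \<Sum>p\<in>I. (cmod (X l v p))\<^sup>2) / real (M l))" if l: "l < K" for l
  proof -
    have "(\<Sum>w\<in>W. \<Sum>p\<in>I. (cmod (X l (w l) p))\<^sup>2)
        = (\<Prod>k\<in>{..<K} - {l}. real (M k)) * (\<Sum>v<M l. \<Sum>p\<in>I. (cmod (X l v p))\<^sup>2)"
      using sum_PiE_coordinate[of "{..<K}" l "\<lambda>l. {..<M l}" "\<lambda>v. \<Sum>p\<in>I. (cmod (X l v p))\<^sup>2"] l by simp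
    also have "(\<Prod>k\<in>{..<K} - {l}. real (M k)) = real (card W) / real (M l)"
      using l M_pos[OF l] by (simp add: card_W prod.remove[of "{..<K}" l])
    finally show ?thesis by simp
  qed
  have "(\<Sum>w\<in>W. \<Sum>p\<in>I. (cmod (S i w p))\<^sup>2)
      \<le> (\<Sum>w\<in>W. \<Sum>p\<in>I. real K * hmax\<^sup>2 * (\<Sum>l<K. (cmod (X l (w l) p))\<^sup>2))"
    by (intro sum_mono 1)
  also have "\<dots> = real K * hmax\<^sup>2 * (\<Sum>w\<in>W. \<Sum>p\<in>I. \<Sum>l<K. (cmod (X l (w l) p))\<^sup>2)"
    by (simp add: sum_distrib_left)
  also have "(\<Sum>w\<in>W. \<Sum>p\<in>I. \<Sum>l<K. (cmod (X l (w l) p))\<^sup>2)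
      = (\<Sum>w\<in>W. \<Sum>l<K. \<Sum>p\<in>I. (cmod (X l (w l) p))\<^sup>2)"
    by (intro sum.cong refl sum.swap)
  also have "\<dots> = (\<Sum>l<K. \<Sum>w\<in>W. \<Sum>p\<in>I. (cmod (X l (w l) p))\<^sup>2)"
    by (rule sum.swap)
  also have "\<dots> = real (card W) * (\<Sum>l<K. (\<Sum>v<M l. \<Sum>p\<in>I. (cmod (X l v p))\<^sup>2) / real (M l))"
    unfolding sum_distrib_left by (intro sum.cong refl 2) simp
  also have "real K * hmax\<^sup>2 * \<dots> \<le> real K * hmax\<^sup>2 * (real (card W) * (\<rho> * real (f0 * t0)))"
    using code by (intro mult_left_mono) (auto simp: is_code_def)
  finally show ?thesis by (simp add: mult_ac)
qed

text \<open>Markov's inequality for the received energy, written pointwise as a bound on the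
  indicator. The energy of a sum is at most twice the sum of the energies, and the noise contributes
  twice its second moment bound 4.\<close>

lemma sum_large: "(\<Sum>w\<in>W. \<integral>\<^sup>+x. large w x \<partial>N) \<le> ennreal (real (card W) / 4)"
proof -
  interpret N: prob_space N by (rule prob_space_noise_space)
  let ?n = "real (f0 * t0)"
  have n: "0 < ?n" using f0 t0 by simp
  have nP: "0 < ?n * P" using n P_pos by simp
  have pt: "large w x \<le> (\<Sum>p\<in>I. ennreal (2 * (cmod (S i w p))\<^sup>2 / (?n * P)) + ennreal (2 / (?n * P)) * ennreal ((cmod (x p))\<^sup>2))" for w x
  proof (cases "(\<Sum>p\<in>I. (cmod (S i w p + of_real s * x p))\<^sup>2) \<le> card I * P")
    case False
    have "(cmod (S i w p + of_real s * x p))\<^sup>2 \<le> 2 * (cmod (S i w p))\<^sup>2 + 2 * (cmod (x p))\<^sup>2" for p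
    proof -
      have "s * cmod (x p) \<le> 1 * cmod (x p)"
        using s_bounds by (intro mult_right_mono) auto
      then have "cmod (S i w p + of_real s * x p) \<le> cmod (S i w p) + cmod (x p)"
        using norm_triangle_ineq[of "S i w p" "of_real s * x p"] s_bounds by (simp add: norm_mult)
      then have "(cmod (S i w p + of_real s * x p))\<^sup>2 \<le> (cmod (S i w p) + cmod (x p))\<^sup>2"
        by (intro power_mono) auto
      also have "\<dots> \<le> 2 * (cmod (S i w p))\<^sup>2 + 2 * (cmod (x p))\<^sup>2"
        using sum_squares_bound[of "cmod (S i w p)" "cmod (x p)"] by (simp add: power2_sum)
      finally show ?thesis .
    qed
    then have "?n * P \<le> (\<Sum>p\<in>I. 2 * (cmod (S i w p))\<^sup>2 + 2 * (cmod (x p))\<^sup>2)"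
      using False by (smt (verit) sum_mono card_blk)
    then have "1 \<le> (\<Sum>p\<in>I. 2 * (cmod (S i w p))\<^sup>2 + 2 * (cmod (x p))\<^sup>2) / (?n * P)"
      using nP by (subst le_divide_eq_1_pos)
    also have "\<dots> = (\<Sum>p\<in>I. 2 * (cmod (S i w p))\<^sup>2 / (?n * P) + (2 / (?n * P)) * (cmod (x p))\<^sup>2)"
      by (simp add: sum_divide_distrib add_divide_distrib)
    finally have "ennreal 1 \<le> ennreal (\<Sum>p\<in>I. 2 * (cmod (S i w p))\<^sup>2 / (?n * P) + (2 / (?n * P)) * (cmod (x p))\<^sup>2)"
      by (rule ennreal_leI)
    also have "\<dots> = (\<Sum>p\<in>I. ennreal (2 * (cmod (S i w p))\<^sup>2 / (?n * P)) + ennreal (2 / (?n * P)) * ennreal ((cmod (x p))\<^sup>2))"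
      using nP by (subst sum_ennreal[symmetric]) (auto simp: ennreal_mult[symmetric] ennreal_plus intro!: sum.cong)
    finally show ?thesis using False by (simp add: large_def)
  qed (simp add: large_def)
  have "(\<integral>\<^sup>+x. large w x \<partial>N) \<le> ennreal (2 / (?n * P) * (\<Sum>p\<in>I. (cmod (S i w p))\<^sup>2) + 8 / P)" for w
  proof -
    have "(\<integral>\<^sup>+x. large w x \<partial>N)
      \<le> (\<integral>\<^sup>+x. (\<Sum>p\<in>I. ennreal (2 * (cmod (S i w p))\<^sup>2 / (?n * P)) + ennreal (2 / (?n * P)) * ennreal ((cmod (x p))\<^sup>2)) \<partial>N)"
      by (intro nn_integral_mono pt)
    also have "\<dots> = (\<Sum>p\<in>I. \<integral>\<^sup>+x. ennreal (2 * (cmod (S i w p))\<^sup>2 / (?n * P)) + ennreal (2 / (?n * P)) * ennreal ((cmod (x p))\<^sup>2) \<partial>N)"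
      by (rule nn_integral_sum) measurable
    also have "\<dots> = (\<Sum>p\<in>I. ennreal (2 * (cmod (S i w p))\<^sup>2 / (?n * P)) + ennreal (2 / (?n * P)) * (\<integral>\<^sup>+z. ennreal ((cmod z)\<^sup>2) \<partial>cgauss))"
    proof (rule sum.cong[OF refl])
      fix p assume p: "p \<in> I"
      then have [measurable]: "(\<lambda>x. x p) \<in> N \<rightarrow>\<^sub>M borel"
        by measurable
      show "(\<integral>\<^sup>+x. ennreal (2 * (cmod (S i w p))\<^sup>2 / (?n * P)) + ennreal (2 / (?n * P)) * ennreal ((cmod (x p))\<^sup>2) \<partial>N)
        = ennreal (2 * (cmod (S i w p))\<^sup>2 / (?n * P)) + ennreal (2 / (?n * P)) * (\<integral>\<^sup>+z. ennreal ((cmod z)\<^sup>2) \<partial>cgauss)"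
        using nn_integral_noise_component[OF p, of "\<lambda>z. ennreal ((cmod z)\<^sup>2)"]
        by (simp add: nn_integral_add nn_integral_cmult N.emeasure_space_1)
    qed
    also have "\<dots> \<le> (\<Sum>p\<in>I. ennreal (2 * (cmod (S i w p))\<^sup>2 / (?n * P)) + ennreal (2 / (?n * P)) * ennreal 4)"
      using cgauss_second_moment_le by (intro sum_mono add_left_mono mult_left_mono) auto
    also have "\<dots> = (\<Sum>p\<in>I. ennreal (2 * (cmod (S i w p))\<^sup>2 / (?n * P) + 2 / (?n * P) * 4))"
      using nP by (intro sum.cong refl) (subst ennreal_mult[symmetric], auto simp: ennreal_plus)
    also have "\<dots> = ennreal (\<Sum>p\<in>I. 2 * (cmod (S i w p))\<^sup>2 / (?n * P) + 2 / (?n * P) * 4)"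
      using nP by (intro sum_ennreal) auto
    also have "(\<Sum>p\<in>I. 2 * (cmod (S i w p))\<^sup>2 / (?n * P) + 2 / (?n * P) * 4)
      = 2 / (?n * P) * (\<Sum>p\<in>I. (cmod (S i w p))\<^sup>2) + 8 / P"
      using f0 t0 by (simp add: sum.distrib sum_distrib_left)
    finally show ?thesis .
  qed
  then have "(\<Sum>w\<in>W. \<integral>\<^sup>+x. large w x \<partial>N) \<le> (\<Sum>w\<in>W. ennreal (2 / (?n * P) * (\<Sum>p\<in>I. (cmod (S i w p))\<^sup>2) + 8 / P))"
    by (rule sum_mono)
  also have "\<dots> = ennreal (\<Sum>w\<in>W. 2 / (?n * P) * (\<Sum>p\<in>I. (cmod (S i w p))\<^sup>2) + 8 / P)"
    using nP P_pos
    by (intro sum_ennreal add_nonneg_nonneg mult_nonneg_nonneg divide_nonneg_nonneg sum_nonneg)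
      (simp_all add: less_imp_le)
  also have "(\<Sum>w\<in>W. 2 / (?n * P) * (\<Sum>p\<in>I. (cmod (S i w p))\<^sup>2) + 8 / P)
      = 2 / (?n * P) * (\<Sum>w\<in>W. \<Sum>p\<in>I. (cmod (S i w p))\<^sup>2) + real (card W) * (8 / P)"
    unfolding sum.distrib sum_constant by (subst sum_distrib_left) (rule refl)
  also have "ennreal \<dots> \<le> ennreal (2 / (?n * P) * (hmax\<^sup>2 * real K * \<rho> * ?n * real (card W)) + real (card W) * (8 / P))"
    using nP by (intro ennreal_leI add_right_mono mult_left_mono sum_signal_power) auto
  also have "2 / (?n * P) * (hmax\<^sup>2 * real K * \<rho> * ?n * real (card W)) + real (card W) * (8 / P)
      = real (card W) * ((2 * (hmax\<^sup>2 * real K * \<rho>) + 8) / P)"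
    using f0 t0 P_pos by (simp add: field_simps)
  also have "(2 * (hmax\<^sup>2 * real K * \<rho>) + 8) / P = 1 / 4"
    using P_pos by (simp add: P_def field_simps)
  finally show ?thesis by simp
qed

text \<open>Given \<open>u\<close> and the top-up noises, the first test prescribes
  \<open>w i\<close>. The second prescribes \<open>w j\<close> through the other messages, because
  \<open>T\<close> is free of user \<open>j\<close>. Hence only the remaining coordinates are
  free.\<close>

lemma sum_ok: "(\<Sum>w\<in>W. ok x' x'' w u) \<le> ennreal (real (card W) / (real (M i) * real (M j)))"
proof -
  define a where "a = g i (\<lambda>p\<in>I. u p + s' * x' p)"
  define b where "b w = g j (\<lambda>p\<in>I. ratio p * u p + T w p + \<beta> p * x'' p)" for w
  have T_eq: "T w p = (\<Sum>l\<in>{..<K} - {j}. (H j l (fst p) - ratio p * H i l (fst p)) * X l (w l) p)" for w p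
  proof -
    have "H i j (fst p) \<noteq> 0" using H[of i j "fst p"] ij hmin by auto
    moreover have "T w p = (\<Sum>l<K. (H j l (fst p) - ratio p * H i l (fst p)) * X l (w l) p)"
      by (simp add: T_def S_def rx_signal_def sum_distrib_left sum_subtractf[symmetric] algebra_simps)
    ultimately show ?thesis
      using ij by (subst (asm) sum.remove[of _ j]) (simp_all add: ratio_def)
  qed
  have bdep: "b v = b w" if "\<And>l. l \<in> {..<K} \<Longrightarrow> l \<noteq> j \<Longrightarrow> v l = w l" for v w
  proof -
    have "T v p = T w p" for p
      unfolding T_eq using that by (intro sum.cong) auto
    then show ?thesis by (simp add: b_def)
  qed
  have "card {w \<in> W. w i = a \<and> w j = b w} \<le> (\<Prod>l\<in>{..<K} - {i, j}. card {..<M l})"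
    by (rule card_PiE_two_determined) (use ij in simp_all, rule bdep, simp)
  then have c: "real (card {w \<in> W. w i = a \<and> w j = b w}) \<le> (\<Prod>l\<in>{..<K} - {i, j}. real (M l))"
    using of_nat_mono[where 'a = real] by fastforce
  have d: "(\<Prod>l\<in>{..<K} - {i, j}. real (M l)) = real (card W) / (real (M i) * real (M j))"
  proof -
    have "real (card W) = (\<Prod>l\<in>{i, j}. real (M l)) * (\<Prod>l\<in>{..<K} - {i, j}. real (M l))"
      unfolding card_W using ij by (subst mult.commute) (intro prod.subset_diff, auto)
    then show ?thesis using ij M_pos[of i] M_pos[of j] by simp
  qed
  have "(\<Sum>w\<in>W. ok x' x'' w u) = (\<Sum>w\<in>W. if w i = a \<and> w j = b w then 1 else 0)"
    by (simp only: ok_def a_def[symmetric] b_def[symmetric] eq_commute[of a "w i" for w] eq_commute[of "b w" "w j" for w])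
  also have "\<dots> = ennreal (real (card {w \<in> W. w i = a \<and> w j = b w}))"
    by (subst sum.inter_filter[symmetric]) (simp_all add: finite_PiE ennreal_of_nat_eq_real_of_nat)
  also have "\<dots> \<le> ennreal (\<Prod>l\<in>{..<K} - {i, j}. real (M l))"
    by (rule ennreal_leI[OF c])
  finally show ?thesis unfolding d .
qed

text \<open>For fixed top-up noises the comparison with Lebesgue measure removes \<open>w\<close>
  from the law of \<open>u\<close>: all tuples share one weight, so the sum moves under the integral
  and \<open>sum_ok\<close> applies at each \<open>u\<close>. The weight itself integrates to
  \<open>(pi * P) ^ (f0 * t0)\<close>.\<close>

lemma sum_good:
  "(\<Sum>w\<in>W. \<integral>\<^sup>+x'. \<integral>\<^sup>+x''. \<integral>\<^sup>+x. good x' x'' w x \<partial>N \<partial>N \<partial>N)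
    \<le> ennreal (real (card W) / (real (M i) * real (M j)) * (exp 1 * P / s\<^sup>2) ^ (f0 * t0))"
proof -
  interpret N: prob_space N by (rule prob_space_noise_space)
  let ?L = "real (card W) / (real (M i) * real (M j))"
  let ?C = "ennreal (exp 1 / (pi * s\<^sup>2)) ^ (f0 * t0)"
  let ?wt = "\<lambda>u. (\<Prod>p\<in>I. ennreal (exp (- ((cmod (u p))\<^sup>2 / P))))"
  have inner: "(\<Sum>w\<in>W. \<integral>\<^sup>+x. good x' x'' w x \<partial>N) \<le> ennreal (?L * (exp 1 * P / s\<^sup>2) ^ (f0 * t0))"
    if "x' \<in> space N" "x'' \<in> space N" for x' x''
  proof -
    have "(\<integral>\<^sup>+x. good x' x'' w x \<partial>N) \<le> ?C * (\<integral>\<^sup>+u. ok x' x'' w u * ?wt u \<partial>PiM I (\<lambda>_. lborel))" for w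
      using nn_integral_PiM_cgauss_truncated_le[where I = I and s = "of_real s" and P = P
          and F = "ok x' x'' w" and t = "S i w"] s_bounds P_pos
      by (simp add: good_def noise_space_def)
    then have "(\<Sum>w\<in>W. \<integral>\<^sup>+x. good x' x'' w x \<partial>N)
      \<le> (\<Sum>w\<in>W. ?C * (\<integral>\<^sup>+u. ok x' x'' w u * ?wt u \<partial>PiM I (\<lambda>_. lborel)))"
      by (rule sum_mono)
    also have "\<dots> = ?C * (\<integral>\<^sup>+u. (\<Sum>w\<in>W. ok x' x'' w u) * ?wt u \<partial>PiM I (\<lambda>_. lborel))"
      by (simp add: sum_distrib_left[symmetric] sum_distrib_right nn_integral_sum)
    also have "\<dots> \<le> ?C * (\<integral>\<^sup>+u. ennreal ?L * ?wt u \<partial>PiM I (\<lambda>_. lborel))"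
      by (intro mult_left_mono nn_integral_mono mult_right_mono sum_ok) auto
    also have "\<dots> = ?C * (ennreal ?L * ennreal (pi * P) ^ (f0 * t0))"
      using P_pos by (subst nn_integral_cmult) (simp_all add: nn_integral_PiM_gaussian)
    also have "\<dots> = ennreal (?L * (exp 1 * P / s\<^sup>2) ^ (f0 * t0))"
    proof -
      have "exp 1 / (pi * s\<^sup>2) * (pi * P) = exp 1 * P / s\<^sup>2"
        by simp
      then have e: "(exp 1 / (pi * s\<^sup>2)) ^ (f0 * t0) * (pi * P) ^ (f0 * t0) = (exp 1 * P / s\<^sup>2) ^ (f0 * t0)"
        by (metis power_mult_distrib)
      have "?C * (ennreal ?L * ennreal (pi * P) ^ (f0 * t0))
        = ennreal ((exp 1 / (pi * s\<^sup>2)) ^ (f0 * t0) * (?L * (pi * P) ^ (f0 * t0)))"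
        using P_pos by (simp only: ennreal_power ennreal_mult[symmetric] zero_le_power
            zero_le_mult_iff zero_le_divide_iff zero_le_power2 exp_ge_zero of_nat_0_le_iff pi_ge_zero less_imp_le simp_thms)
      also have "(exp 1 / (pi * s\<^sup>2)) ^ (f0 * t0) * (?L * (pi * P) ^ (f0 * t0)) = ?L * (exp 1 * P / s\<^sup>2) ^ (f0 * t0)"
        unfolding e[symmetric] by (simp only: mult_ac)
      finally show ?thesis .
    qed
    finally show ?thesis .
  qed
  have "(\<Sum>w\<in>W. \<integral>\<^sup>+x'. \<integral>\<^sup>+x''. \<integral>\<^sup>+x. good x' x'' w x \<partial>N \<partial>N \<partial>N)
    = (\<integral>\<^sup>+x'. \<integral>\<^sup>+x''. (\<Sum>w\<in>W. \<integral>\<^sup>+x. good x' x'' w x \<partial>N) \<partial>N \<partial>N)"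
    using measurable_good_integral(2,3) by (simp add: nn_integral_sum[symmetric] cong: nn_integral_cong)
  also have "\<dots> \<le> (\<integral>\<^sup>+x'. \<integral>\<^sup>+x''. ennreal (?L * (exp 1 * P / s\<^sup>2) ^ (f0 * t0)) \<partial>N \<partial>N)"
    by (intro nn_integral_mono inner)
  also have "\<dots> = ennreal (?L * (exp 1 * P / s\<^sup>2) ^ (f0 * t0))"
    by (simp add: N.emeasure_space_1)
  finally show ?thesis .
qed

text \<open>Decoding failures and large outputs account for at most
  \<open>1 / 8 + 1 / 8 + 1 / 4\<close> of the tuples on average, so the good term must supply the
  other half. This gives the factor 2.\<close>

lemma messages_le: "real (M i) * real (M j) \<le> 2 * (exp 1 * P / s\<^sup>2) ^ (f0 * t0)"
proof -
  let ?m = "real (M i) * real (M j)" and ?Q = "(exp 1 * P / s\<^sup>2) ^ (f0 * t0)"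
  have m: "0 < ?m" using M_pos ij by simp
  have c: "0 < real (card W)"
    unfolding card_W using M_pos by (intro prod_pos) auto
  have "ennreal (real (card W)) = (\<Sum>w\<in>W. 1)"
    by (simp add: ennreal_of_nat_eq_real_of_nat)
  also have "\<dots> \<le> (\<Sum>w\<in>W. (\<integral>\<^sup>+z. fail i w z \<partial>N) + (\<integral>\<^sup>+z. fail j w z \<partial>N) + (\<integral>\<^sup>+x. large w x \<partial>N)
      + (\<integral>\<^sup>+x'. \<integral>\<^sup>+x''. \<integral>\<^sup>+x. good x' x'' w x \<partial>N \<partial>N \<partial>N))"
    by (intro sum_mono one_le_integrals)
  also have "\<dots> = (\<Sum>w\<in>W. \<integral>\<^sup>+z. fail i w z \<partial>N) + (\<Sum>w\<in>W. \<integral>\<^sup>+z. fail j w z \<partial>N) + (\<Sum>w\<in>W. \<integral>\<^sup>+x. large w x \<partial>N)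
      + (\<Sum>w\<in>W. \<integral>\<^sup>+x'. \<integral>\<^sup>+x''. \<integral>\<^sup>+x. good x' x'' w x \<partial>N \<partial>N \<partial>N)"
    by (simp add: sum.distrib)
  also have "\<dots> \<le> ennreal (real (card W) / 8) + ennreal (real (card W) / 8) + ennreal (real (card W) / 4)
      + ennreal (real (card W) / ?m * ?Q)"
    using ij by (intro add_mono sum_fail sum_large sum_good) auto
  also have "\<dots> = ennreal (real (card W) / 8 + real (card W) / 8 + real (card W) / 4 + real (card W) / ?m * ?Q)"
    using m P_pos by (simp add: ennreal_plus[symmetric] del: ennreal_plus)
  finally have "real (card W) \<le> real (card W) / 8 + real (card W) / 8 + real (card W) / 4 + real (card W) / ?m * ?Q"
    using m P_pos by (subst (asm) ennreal_le_iff) auto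
  then have "real (card W) * 1 \<le> real (card W) * (2 * ?Q / ?m)"
    by (simp add: mult.left_commute)
  then have "1 \<le> 2 * ?Q / ?m"
    using c by (subst (asm) mult_le_cancel_left_pos)
  then show ?thesis
    using m by (simp add: pos_le_divide_eq)
qed

end

lemma achievable_pair_le:
  fixes hmin hmax :: real
  assumes ij: "i < K" "j < K" "i \<noteq> j" and hmin: "0 < hmin" "hmin \<le> hmax"
    and H: "\<And>k l f. k < K \<Longrightarrow> l < K \<Longrightarrow> hmin \<le> cmod (H k l f) \<and> cmod (H k l f) \<le> hmax"
  shows "\<exists>C. \<forall>\<rho> R. 1 \<le> \<rho> \<longrightarrow> achievable K H \<rho> R \<longrightarrow> R i + R j \<le> ln \<rho> + C"
proof -
  \<comment> \<open>For \<open>1 \<le> \<rho>\<close> the additive constant in \<open>P\<close> is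
    absorbed into a multiple of \<rho>, which leaves \<open>c * \<rho>\<close> as the base of the
    power in \<open>messages_le\<close>.\<close>
  define c where "c = exp 1 * (8 * hmax\<^sup>2 * real K + 32) / (hmin / hmax)\<^sup>2"
  have "0 < 8 * hmax\<^sup>2 * real K + 32"
    by (intro add_nonneg_pos) auto
  then have c: "0 < c"
    using hmin by (simp add: c_def)
  \<comment> \<open>\<open>1 / 4\<close> is twice the slack \<open>1 / 8\<close> in the rates.
    \<open>ln 2\<close> comes from the factor 2 in \<open>messages_le\<close>, whose share per
    channel use is at most \<open>ln 2\<close>.\<close>
  have "R i + R j \<le> ln \<rho> + (ln c + ln 2 + 1 / 4)" if rho1: "1 \<le> \<rho>" and ach: "achievable K H \<rho> R" for \<rho> R
  proof -
    obtain f0 t0 M X g where *: "0 < f0" "0 < t0" "is_code K \<rho> f0 t0 M X g"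
      and R: "\<And>k. k < K \<Longrightarrow> R k - 1 / 8 \<le> ln (real (M k)) / real (f0 * t0)"
      and e: "\<And>k. k < K \<Longrightarrow> err K H f0 t0 M X g k \<le> 1 / 8"
      using ach unfolding achievable_def by (metis zero_less_divide_1_iff zero_less_numeral)
    interpret two_user_converse K f0 t0 H \<rho> hmin hmax M X g i j
      by unfold_locales (use ij hmin H * e rho1 in auto)
    let ?n = "real (f0 * t0)"
    have n: "1 \<le> ?n" using *(1,2) by (simp add: Suc_le_eq del: of_nat_mult)
    have "P \<le> (8 * hmax\<^sup>2 * real K + 32) * \<rho>"
      using rho1 by (simp add: P_def algebra_simps)
    then have "exp 1 * P / s\<^sup>2 \<le> c * \<rho>"
      using s_bounds by (simp add: c_def s_def divide_right_mono)
    then have "(exp 1 * P / s\<^sup>2) ^ (f0 * t0) \<le> (c * \<rho>) ^ (f0 * t0)"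
      using P_pos by (intro power_mono) auto
    then have le: "real (M i) * real (M j) \<le> 2 * (c * \<rho>) ^ (f0 * t0)"
      using messages_le by linarith
    have Mp: "0 < real (M i)" "0 < real (M j)"
      using M_pos ij by auto
    have "ln (real (M i)) + ln (real (M j)) = ln (real (M i) * real (M j))"
      using Mp by (simp add: ln_mult)
    also have "\<dots> \<le> ln (2 * (c * \<rho>) ^ (f0 * t0))"
      using le Mp by (intro ln_mono) (auto intro: mult_pos_pos)
    also have "\<dots> = ln 2 + ?n * (ln c + ln \<rho>)"
      using c rho1 by (simp add: ln_mult ln_realpow)
    also have "\<dots> \<le> ?n * ln 2 + ?n * (ln c + ln \<rho>)"
      using mult_right_mono[OF n, of "ln 2"] by simp
    finally have "(ln (real (M i)) + ln (real (M j))) / ?n \<le> ln 2 + (ln c + ln \<rho>)"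
      using n by (simp add: pos_divide_le_eq algebra_simps del: of_nat_mult)
    then show ?thesis
      using R[OF ij(1)] R[OF ij(2)] by (simp add: add_divide_distrib)
  qed
  then show ?thesis by blast
qed

lemma dof_pair_le:
  fixes hmin hmax :: real
  assumes ij: "i < K" "j < K" "i \<noteq> j" and hmin: "0 < hmin" "hmin \<le> hmax"
    and H: "\<And>k l f. k < K \<Longrightarrow> l < K \<Longrightarrow> hmin \<le> cmod (H k l f) \<and> cmod (H k l f) \<le> hmax"
    and d: "d \<in> dof_region K H"
  shows "d i + d j \<le> 1"
proof -
  obtain C where C: "\<And>\<rho> R. 1 \<le> \<rho> \<Longrightarrow> achievable K H \<rho> R \<Longrightarrow> R i + R j \<le> ln \<rho> + C"
    using achievable_pair_le[where H = H, OF ij hmin H] by blast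
  \<comment> \<open>The region is cut out by weighted sums, and this weight isolates the
    pair.\<close>
  define w :: "nat \<Rightarrow> real" where "w l = (if l = i \<or> l = j then 1 else 0)" for l
  have w_sum: "(\<Sum>k<K. w k * x k) = x i + x j" for x
  proof -
    have "(\<Sum>k<K. w k * x k) = (\<Sum>k\<in>{i, j}. w k * x k)"
      using ij by (intro sum.mono_neutral_right) (auto simp: w_def)
    then show ?thesis using ij by (simp add: w_def)
  qed
  have "ereal (d i + d j) = ereal (\<Sum>k<K. w k * d k)"
    by (simp add: w_sum)
  also have "\<dots> \<le> Limsup at_top (\<lambda>\<rho>::real. (SUP R\<in>capacity_region K H \<rho>. ereal (\<Sum>k<K. w k * R k)) / ereal (ln \<rho>))"
  proof -
    have "\<forall>k<K. 0 \<le> w k" by (simp add: w_def)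
    then show ?thesis using d unfolding dof_region_def by blast
  qed
  also have "\<dots> \<le> Limsup at_top (\<lambda>\<rho>::real. ereal ((ln \<rho> + C) / ln \<rho>))"
  proof (rule Limsup_mono)
    show "eventually (\<lambda>\<rho>. (SUP R\<in>capacity_region K H \<rho>. ereal (\<Sum>k<K. w k * R k)) / ereal (ln \<rho>)
        \<le> ereal ((ln \<rho> + C) / ln \<rho>)) at_top"
      using eventually_gt_at_top[of 1]
    proof eventually_elim
      case (elim \<rho>)
      have "(SUP R\<in>capacity_region K H \<rho>. ereal (\<Sum>k<K. w k * R k)) \<le> ereal (ln \<rho> + C)"
        using elim C by (intro SUP_least) (auto simp: capacity_region_def w_sum)
      then have "(SUP R\<in>capacity_region K H \<rho>. ereal (\<Sum>k<K. w k * R k)) / ereal (ln \<rho>) \<le> ereal (ln \<rho> + C) / ereal (ln \<rho>)"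
        using elim by (intro ereal_divide_right_mono) auto
      then show ?case using elim by simp
    qed
  qed
  also have "\<dots> = 1"
  proof (rule lim_imp_Limsup)
    have "((\<lambda>\<rho>::real. (ln \<rho> + C) / ln \<rho>) \<longlongrightarrow> 1) at_top"
      by real_asymp
    then show "((\<lambda>\<rho>::real. ereal ((ln \<rho> + C) / ln \<rho>)) \<longlongrightarrow> 1) at_top"
      by (simp add: one_ereal_def)
  qed simp
  finally show ?thesis by simp
qed

text \<open>Summation over all ordered pairs: every user occurs in \<open>2 * (K - 1)\<close> of the
  \<open>K * (K - 1)\<close> inequalities.\<close>

lemma sum_le_of_pairs:
  fixes d :: "nat \<Rightarrow> real"
  assumes K: "2 \<le> K" and d: "\<And>i j. i < K \<Longrightarrow> j < K \<Longrightarrow> i \<noteq> j \<Longrightarrow> d i + d j \<le> 1"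
  shows "(\<Sum>k<K. d k) \<le> real K / 2"
proof -
  have inner: "(\<Sum>j\<in>{..<K} - {i}. d i + d j) = real (K - 2) * d i + (\<Sum>k<K. d k)" if "i < K" for i
    using that K by (simp add: sum.distrib sum_diff1 of_nat_diff algebra_simps)
  have "(\<Sum>i<K. \<Sum>j\<in>{..<K} - {i}. d i + d j) \<le> (\<Sum>i<K. \<Sum>j\<in>{..<K} - {i}. 1)"
    using d by (intro sum_mono) auto
  also have "\<dots> = real K * real (K - 1)"
    using K by (simp add: of_nat_diff)
  also have "(\<Sum>i<K. \<Sum>j\<in>{..<K} - {i}. d i + d j) = 2 * real (K - 1) * (\<Sum>k<K. d k)"
  proof -
    have "(\<Sum>i<K. \<Sum>j\<in>{..<K} - {i}. d i + d j) = (\<Sum>i<K. real (K - 2) * d i + (\<Sum>k<K. d k))"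
      by (intro sum.cong refl inner) simp
    also have "\<dots> = real (K - 2) * (\<Sum>k<K. d k) + real K * (\<Sum>k<K. d k)"
      by (simp add: sum.distrib sum_distrib_left)
    finally show ?thesis using K by (simp add: of_nat_diff algebra_simps)
  qed
  finally have "real (K - 1) * (2 * (\<Sum>k<K. d k)) \<le> real (K - 1) * real K"
    by (simp add: mult_ac)
  then show ?thesis
    using K by (subst (asm) mult_le_cancel_left_pos) auto
qed

section \<open>Codes and matchings\<close>

text \<open>A word in the ball is determined by the set of positions where it differs from
  \<open>y\<close> and by its values there. Bounding the number of such sets by
  \<open>2 ^ card I\<close> costs at most \<open>ln 2\<close> of rate per symbol, independently of
  \<rho>.\<close>

lemma card_hamming_ball_le:
  assumes I: "finite I" and Q: "0 < Q"
  shows "card {x \<in> PiE I (\<lambda>_. {..<Q::nat}). card {p \<in> I. x p \<noteq> y p} \<le> d} \<le> 2 ^ card I * Q ^ d"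
proof -
  let ?D = "{D. D \<subseteq> I \<and> card D \<le> d}"
  let ?put = "\<lambda>D z. \<lambda>p\<in>I. if p \<in> D then z p else y p"
  have finD: "finite ?D" using I by simp
  have "{x \<in> PiE I (\<lambda>_. {..<Q}). card {p \<in> I. x p \<noteq> y p} \<le> d} \<subseteq> (\<Union>D\<in>?D. ?put D ` PiE D (\<lambda>_. {..<Q}))"
  proof
    fix x assume x: "x \<in> {x \<in> PiE I (\<lambda>_. {..<Q}). card {p \<in> I. x p \<noteq> y p} \<le> d}"
    let ?E = "{p \<in> I. x p \<noteq> y p}"
    have "x = ?put ?E (restrict x ?E)"
      using x by (auto simp: fun_eq_iff PiE_def extensional_def)
    moreover have "restrict x ?E \<in> PiE ?E (\<lambda>_. {..<Q})"
      using x by (auto simp: PiE_def)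
    ultimately show "x \<in> (\<Union>D\<in>?D. ?put D ` PiE D (\<lambda>_. {..<Q}))"
      using x by blast
  qed
  moreover have fin: "finite (PiE D (\<lambda>_. {..<Q}))" if "D \<in> ?D" for D
    using that I by (intro finite_PiE) (auto intro: finite_subset)
  ultimately have "card {x \<in> PiE I (\<lambda>_. {..<Q}). card {p \<in> I. x p \<noteq> y p} \<le> d}
      \<le> card (\<Union>D\<in>?D. ?put D ` PiE D (\<lambda>_. {..<Q}))"
    using finD by (intro card_mono) auto
  also have "\<dots> \<le> (\<Sum>D\<in>?D. card (?put D ` PiE D (\<lambda>_. {..<Q})))"
    using finD by (rule card_UN_le)
  also have "\<dots> \<le> (\<Sum>D\<in>?D. Q ^ d)"
  proof (rule sum_mono)
    fix D assume D: "D \<in> ?D"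
    then have "finite D" using I by (auto intro: finite_subset)
    then have "card (?put D ` PiE D (\<lambda>_. {..<Q})) \<le> Q ^ card D"
      using card_image_le[OF fin[OF D], of "?put D"] by (simp add: card_PiE)
    also have "\<dots> \<le> Q ^ d" using D Q by (intro power_increasing) auto
    finally show "card (?put D ` PiE D (\<lambda>_. {..<Q})) \<le> Q ^ d" .
  qed
  also have "\<dots> = card ?D * Q ^ d" by simp
  also have "card ?D \<le> card (Pow I)"
    using I by (intro card_mono) auto
  then have "card ?D * Q ^ d \<le> 2 ^ card I * Q ^ d"
    using I by (simp add: card_Pow)
  finally show ?thesis .
qed

text \<open>Take a separated set of greatest size. Its balls cover everything, since a word outside
  all of them could be added.\<close>

lemma gilbert_varshamov:
  assumes I: "finite I" and Q: "0 < Q"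
  obtains C where "C \<subseteq> PiE I (\<lambda>_. {..<Q::nat})"
    and "\<And>x y. x \<in> C \<Longrightarrow> y \<in> C \<Longrightarrow> x \<noteq> y \<Longrightarrow> d < card {p \<in> I. x p \<noteq> y p}"
    and "Q ^ card I \<le> card C * (2 ^ card I * Q ^ d)"
proof -
  let ?S = "PiE I (\<lambda>_. {..<Q})"
  let ?ball = "\<lambda>y. {x \<in> ?S. card {p \<in> I. x p \<noteq> y p} \<le> d}"
  define sep where "sep C \<longleftrightarrow> C \<subseteq> ?S \<and> (\<forall>x\<in>C. \<forall>y\<in>C. x \<noteq> y \<longrightarrow> d < card {p \<in> I. x p \<noteq> y p})" for C
  have finS: "finite ?S" using I by (intro finite_PiE) auto
  have "sep {}" by (simp add: sep_def)
  moreover have "\<forall>C. sep C \<longrightarrow> card C < Suc (card ?S)"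
    using finS by (auto simp: sep_def less_Suc_eq_le intro: card_mono)
  ultimately have "\<exists>C. sep C \<and> (\<forall>C'. sep C' \<longrightarrow> card C' \<le> card C)"
    by (rule Lattices_Big.ex_has_greatest_nat)
  then obtain C where C: "sep C" and max: "\<And>C'. sep C' \<Longrightarrow> card C' \<le> card C"
    by auto
  have finC: "finite C" using C finS by (auto simp: sep_def intro: finite_subset)
  have "?S \<subseteq> (\<Union>y\<in>C. ?ball y)"
  proof
    fix x assume x: "x \<in> ?S"
    show "x \<in> (\<Union>y\<in>C. ?ball y)"
    proof (rule ccontr)
      assume n: "x \<notin> (\<Union>y\<in>C. ?ball y)"
      have far: "d < card {p \<in> I. x p \<noteq> y p}" if "y \<in> C" for y
        using n x that by auto
      have far': "d < card {p \<in> I. y p \<noteq> x p}" if "y \<in> C" for y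
        using far[OF that] by (simp add: eq_commute)
      have "x \<notin> C" using far[of x] by auto
      moreover have "sep (insert x C)"
      proof -
        have "d < card {p \<in> I. a p \<noteq> b p}" if ab: "a \<in> insert x C" "b \<in> insert x C" "a \<noteq> b" for a b
        proof -
          consider "a = x" "b \<in> C" | "b = x" "a \<in> C" | "a \<in> C" "b \<in> C"
            using ab by auto
          then show ?thesis
            using far far' C ab(3) by cases (auto simp: sep_def)
        qed
        then show ?thesis using C x by (simp add: sep_def)
      qed
      ultimately show False using max[of "insert x C"] finC by simp
    qed
  qed
  then have "card ?S \<le> card (\<Union>y\<in>C. ?ball y)"
    using finC finS by (intro card_mono) auto
  also have "\<dots> \<le> (\<Sum>y\<in>C. card (?ball y))"
    using finC by (rule card_UN_le)
  also have "\<dots> \<le> (\<Sum>y\<in>C. 2 ^ card I * Q ^ d)"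
    by (intro sum_mono card_hamming_ball_le I Q)
  finally have "Q ^ card I \<le> card C * (2 ^ card I * Q ^ d)"
    using I by (simp add: card_PiE)
  with C show thesis by (intro that[of C]) (auto simp: sep_def)
qed

text \<open>Greedy choice: remove any related pair and match the rest. The unmatched elements are
  the same as in the smaller instance, so maximality carries over at once.\<close>

lemma exists_maximal_matching:
  assumes "finite F"
  shows "\<exists>P m. P \<subseteq> F \<and> m ` P \<subseteq> F \<and> inj_on m P \<and> P \<inter> m ` P = {} \<and> (\<forall>f\<in>P. r f (m f)) \<and>
    (\<forall>f\<in>F - P - m ` P. \<forall>f'\<in>F - P - m ` P. f \<noteq> f' \<longrightarrow> \<not> r f f')"
  using assms
proof (induction F rule: finite_psubset_induct)
  case (psubset F)
  show ?case
  proof (cases "\<exists>a\<in>F. \<exists>b\<in>F. a \<noteq> b \<and> r a b")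
    case False
    then show ?thesis by (intro exI[of _ "{}"]) auto
  next
    case True
    then obtain a b where ab: "a \<in> F" "b \<in> F" "a \<noteq> b" "r a b" by blast
    then have "F - {a, b} \<subset> F" by auto
    from psubset.IH[OF this] obtain P m where
      P: "P \<subseteq> F - {a, b}" "m ` P \<subseteq> F - {a, b}" "inj_on m P" "P \<inter> m ` P = {}" "\<forall>f\<in>P. r f (m f)"
      and max: "\<forall>f\<in>F - {a, b} - P - m ` P. \<forall>f'\<in>F - {a, b} - P - m ` P. f \<noteq> f' \<longrightarrow> \<not> r f f'"
      by (elim exE conjE) (rule that)
    let ?m = "m(a := b)"
    have a: "a \<notin> P" and b: "b \<notin> P" "b \<notin> m ` P" using P by auto
    have im: "?m ` insert a P = insert b (m ` P)"
      using a by (auto simp: image_iff)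
    have "inj_on ?m (insert a P)"
      using P(3) a b by (auto simp: inj_on_def)
    moreover have "insert a P \<inter> insert b (m ` P) = {}"
      using P ab b by auto
    moreover have "\<forall>f\<in>insert a P. r f (?m f)"
      using P(5) ab a by auto
    moreover have "F - insert a P - insert b (m ` P) = F - {a, b} - P - m ` P"
      by auto
    moreover have "insert a P \<subseteq> F" "insert b (m ` P) \<subseteq> F"
      using P ab by auto
    ultimately show ?thesis
      using max by (intro exI[of _ "insert a P"] exI[of _ ?m]) (simp only: im)
  qed
qed

section \<open>Rare large noise samples\<close>

lemma measure_cgauss_tail:
  assumes "0 < L"
  shows "measure cgauss {z. L < cmod z} \<le> 4 / L\<^sup>2"
proof -
  have [measurable]: "{z. L < cmod z} \<in> sets cgauss" by simp
  have "ennreal (L\<^sup>2) * emeasure cgauss {z. L < cmod z} = (\<integral>\<^sup>+z. ennreal (L\<^sup>2) * indicator {z. L < cmod z} z \<partial>cgauss)"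
    by (subst nn_integral_cmult_indicator) simp_all
  also have "\<dots> \<le> (\<integral>\<^sup>+z. ennreal ((cmod z)\<^sup>2) \<partial>cgauss)"
    using assms by (intro nn_integral_mono) (auto simp: indicator_def intro!: ennreal_leI power_mono)
  also have "\<dots> \<le> 4" by (rule cgauss_second_moment_le)
  finally have "ennreal (L\<^sup>2 * measure cgauss {z. L < cmod z}) \<le> ennreal 4"
    by (simp add: cgauss.emeasure_eq_measure ennreal_mult)
  then have "L\<^sup>2 * measure cgauss {z. L < cmod z} \<le> 4"
    by (subst (asm) ennreal_le_iff) auto
  then show ?thesis
    using assms by (simp add: pos_le_divide_eq mult.commute)
qed

text \<open>A union bound over the sets of \<open>r\<close> positions, with independence inside each
  set. The factor \<open>2 ^ card I\<close> is affordable because the tail probability will be made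
  as small as \<open>(1 / 4) ^ T\<close> while \<open>r\<close> exceeds
  \<open>card I / T\<close>.\<close>

lemma measure_many_large_noise:
  fixes I :: "'i set" and L :: real
  assumes I: "finite I"
  shows "measure (PiM I (\<lambda>_. cgauss)) {z \<in> space (PiM I (\<lambda>_. cgauss)). r \<le> card {p \<in> I. L < cmod (z p)}}
    \<le> 2 ^ card I * measure cgauss {z. L < cmod z} ^ r"
proof -
  let ?N = "PiM I (\<lambda>_. cgauss)" and ?B = "{z. L < cmod z}"
  interpret N: prob_space ?N by (rule prob_space_PiM_cgauss)
  let ?D = "{D. D \<subseteq> I \<and> card D = r}"
  let ?A = "\<lambda>D. PiE I (\<lambda>p. if p \<in> D then ?B else UNIV)"
  have [simp]: "?B \<in> sets borel" by simp
  have finD: "finite ?D" using I by simp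
  have A: "?A D \<in> sets ?N" for D
    using I by (intro sets_PiM_I_finite) auto
  have mA: "measure ?N (?A D) = measure cgauss ?B ^ r" if "D \<in> ?D" for D
  proof -
    have "emeasure ?N (?A D) = (\<Prod>p\<in>I. emeasure cgauss (if p \<in> D then ?B else UNIV))"
      using I by (intro cgauss_prod.emeasure_PiM) auto
    also have "\<dots> = (\<Prod>p\<in>I. if p \<in> D then emeasure cgauss ?B else 1)"
      using cgauss.emeasure_space_1 by (intro prod.cong refl) auto
    also have "\<dots> = emeasure cgauss ?B ^ r"
      using that I by (simp add: prod.If_cases Int_absorb1)
    finally show ?thesis
      by (simp add: N.emeasure_eq_measure cgauss.emeasure_eq_measure ennreal_power)
  qed
  have "{z \<in> space ?N. r \<le> card {p \<in> I. L < cmod (z p)}} \<subseteq> (\<Union>D\<in>?D. ?A D)"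
  proof
    fix z assume z: "z \<in> {z \<in> space ?N. r \<le> card {p \<in> I. L < cmod (z p)}}"
    then obtain D where D: "D \<subseteq> {p \<in> I. L < cmod (z p)}" "card D = r"
      using obtain_subset_with_card_n[of r "{p \<in> I. L < cmod (z p)}"] by auto
    have "z \<in> ?A D"
      using z D by (auto simp: space_PiM PiE_def)
    moreover have "D \<in> ?D"
      using D by auto
    ultimately show "z \<in> (\<Union>D\<in>?D. ?A D)"
      by (rule UN_I[rotated])
  qed
  then have "measure ?N {z \<in> space ?N. r \<le> card {p \<in> I. L < cmod (z p)}} \<le> measure ?N (\<Union>D\<in>?D. ?A D)"
    using A finD by (intro N.finite_measure_mono sets.finite_UN) auto
  also have "\<dots> \<le> (\<Sum>D\<in>?D. measure ?N (?A D))"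
    using A finD by (intro N.finite_measure_subadditive_finite) auto
  also have "\<dots> = card ?D * measure cgauss ?B ^ r"
    using mA by simp
  also have "\<dots> \<le> 2 ^ card I * measure cgauss ?B ^ r"
  proof -
    have "card ?D \<le> card (Pow I)" using I by (intro card_mono) auto
    then have "real (card ?D) \<le> 2 ^ card I"
      using I by (simp add: card_Pow flip: of_nat_le_iff)
    then show ?thesis by (intro mult_right_mono) auto
  qed
  finally show ?thesis .
qed

section \<open>Typical blocks of frequency slots\<close>

lemma borel_measurable_card:
  assumes "finite A" and "\<And>a. a \<in> A \<Longrightarrow> Measurable.pred M (Q a)"
  shows "(\<lambda>x. real (card {a \<in> A. Q a x})) \<in> borel_measurable M"
proof -
  have "real (card {a \<in> A. Q a x}) = (\<Sum>a\<in>A. if Q a x then 1 else 0)" for x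
    using assms(1) by (simp add: sum.inter_filter[symmetric])
  then show ?thesis
    using assms(2) by simp
qed

locale iid_channel =
  fixes \<mu> :: "complex measure"
  assumes prob_mu: "prob_space \<mu>" and sets_mu [measurable_cong, simp]: "sets \<mu> = sets borel"
begin

sublocale mu: prob_space \<mu>
  by (rule prob_mu)

abbreviation \<Omega> :: "(nat \<times> nat \<times> nat \<Rightarrow> complex) measure" where
  "\<Omega> \<equiv> PiM UNIV (\<lambda>_. \<mu>)"

sublocale product_prob_space "\<lambda>_::nat \<times> nat \<times> nat. \<mu>" UNIV ..

lemma space_mu [simp]: "space \<mu> = UNIV"
  using sets_eq_imp_space_eq[OF sets_mu] by simp

definition slot_in :: "(nat \<times> nat) set \<Rightarrow> (nat \<times> nat \<Rightarrow> complex set) \<Rightarrow> nat \<Rightarrow> (nat \<times> nat \<times> nat \<Rightarrow> complex) \<Rightarrow> bool" where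
  "slot_in J S f H \<longleftrightarrow> (\<forall>p\<in>J. H (fst p, snd p, f) \<in> S p)"

lemma pred_slot_in:
  assumes "finite J" "\<And>p. p \<in> J \<Longrightarrow> S p \<in> sets borel"
  shows "Measurable.pred \<Omega> (slot_in J S f)"
  unfolding slot_in_def using assms
  by (intro pred_intros_finite pred_sets2[where N = \<mu>] measurable_component_singleton) auto

lemma indep_vars_coordinates: "indep_vars (\<lambda>_. \<mu>) (\<lambda>i H. H i) UNIV"
proof (subst indep_vars_iff_distr_eq_PiM')
  have "distr \<Omega> \<Omega> (\<lambda>x. \<lambda>i\<in>UNIV. x i) = \<Omega>"
    by (simp add: restrict_def distr_id2)
  moreover have "(\<Pi>\<^sub>M i\<in>UNIV. distr \<Omega> \<mu> (\<lambda>H. H i)) = \<Omega>"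
    by (intro PiM_cong refl PiM_component) auto
  ultimately show "distr \<Omega> \<Omega> (\<lambda>x. \<lambda>i\<in>UNIV. x i) = (\<Pi>\<^sub>M i\<in>UNIV. distr \<Omega> \<mu> (\<lambda>H. H i))"
    by simp
qed auto

text \<open>Distinct slots read disjoint sets of coordinates of the product space.\<close>

lemma indep_vars_slots:
  assumes J: "finite J" and S: "\<And>p. p \<in> J \<Longrightarrow> S p \<in> sets borel"
  shows "indep_vars (\<lambda>_. borel) (\<lambda>f H. if slot_in J S f H then 1 else 0 :: real) {..<n}"
proof -
  let ?K = "\<lambda>f. (\<lambda>p. (fst p, snd p, f)) ` J"
  let ?Y = "\<lambda>f y. if slot_in J S f y then 1 else 0 :: real"
  have "disjoint_family_on ?K {..<n}"
    by (auto simp: disjoint_family_on_def)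
  then have "indep_vars (\<lambda>f. PiM (?K f) (\<lambda>_. \<mu>)) (\<lambda>f H. restrict (\<lambda>i. H i) (?K f)) {..<n}"
    by (intro indep_vars_restrict[OF indep_vars_coordinates]) auto
  then have "indep_vars (\<lambda>_. borel) (\<lambda>f H. ?Y f (restrict (\<lambda>i. H i) (?K f))) {..<n}"
  proof (rule indep_vars_compose2)
    fix f
    have "Measurable.pred (PiM (?K f) (\<lambda>_. \<mu>)) (slot_in J S f)"
      unfolding slot_in_def using assms
      by (intro pred_intros_finite pred_sets2[where N = \<mu>] measurable_component_singleton) auto
    then show "?Y f \<in> borel_measurable (PiM (?K f) (\<lambda>_. \<mu>))"
      by measurable
  qed
  moreover have "?Y f (restrict (\<lambda>i. H i) (?K f)) = ?Y f H" for f H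
    by (auto simp: slot_in_def)
  ultimately show ?thesis by simp
qed

lemma prob_slot_in:
  assumes J: "finite J" and S: "\<And>p. p \<in> J \<Longrightarrow> S p \<in> sets borel"
  shows "prob {H \<in> space \<Omega>. slot_in J S f H} = (\<Prod>p\<in>J. measure \<mu> (S p))"
proof -
  let ?e = "\<lambda>p::nat \<times> nat. (fst p, snd p, f)"
  have inj: "inj_on ?e J" by (auto simp: inj_on_def)
  have "{H \<in> space \<Omega>. slot_in J S f H} = {H \<in> space \<Omega>. \<forall>i\<in>?e ` J. H i \<in> S (fst i, fst (snd i))}"
    by (auto simp: slot_in_def)
  then have "emeasure \<Omega> {H \<in> space \<Omega>. slot_in J S f H} = (\<Prod>i\<in>?e ` J. emeasure \<mu> (S (fst i, fst (snd i))))"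
    using assms by (simp only:) (rule emeasure_PiM_Collect, auto)
  also have "\<dots> = (\<Prod>p\<in>J. emeasure \<mu> (S p))"
    using inj by (subst prod.reindex) simp_all
  also have "\<dots> = ennreal (\<Prod>p\<in>J. measure \<mu> (S p))"
    by (simp add: mu.emeasure_eq_measure prod_ennreal)
  finally show ?thesis
    by (simp add: emeasure_eq_measure prod_nonneg)
qed

text \<open>Hoeffding's inequality for the number of hits. Only the upper deviation is bounded,
  since crowded cells are the only obstacle to matching.\<close>

lemma prob_many_slots:
  assumes J: "finite J" and S: "\<And>p. p \<in> J \<Longrightarrow> S p \<in> sets borel" and \<tau>: "0 < \<tau>" and n: "0 < n"
  shows "prob {H \<in> space \<Omega>. ((\<Prod>p\<in>J. measure \<mu> (S p)) + \<tau>) * real n \<le> real (card {f \<in> {..<n}. slot_in J S f H})}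
    \<le> exp (- 2 * \<tau>\<^sup>2 * real n)"
proof -
  let ?X = "\<lambda>f H. if slot_in J S f H then 1 else 0 :: real"
  let ?p = "\<Prod>p\<in>J. measure \<mu> (S p)"
  note [measurable] = pred_slot_in[OF J S]
  have E: "expectation (?X f) = ?p" for f
  proof -
    have "expectation (?X f) = expectation (indicator {H \<in> space \<Omega>. slot_in J S f H})"
      by (intro Bochner_Integration.integral_cong) (auto simp: indicator_def)
    then show ?thesis
      using prob_slot_in[OF J S] by simp
  qed
  interpret Hoeffding_ineq \<Omega> "{..<n}" ?X "\<lambda>_. 0" "\<lambda>_. 1" "\<Sum>f<n. expectation (?X f)"
    by unfold_locales (use indep_vars_slots[OF J S] in auto)
  have "prob {H \<in> space \<Omega>. (\<Sum>f<n. expectation (?X f)) + \<tau> * real n \<le> (\<Sum>f<n. ?X f H)}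
      \<le> exp (- 2 * (\<tau> * real n)\<^sup>2 / (\<Sum>f<n. (1 - 0)\<^sup>2))"
    by (rule Hoeffding_ineq_ge) (use \<tau> n in auto)
  also have "- 2 * (\<tau> * real n)\<^sup>2 / (\<Sum>f<n. (1 - 0 :: real)\<^sup>2) = - 2 * \<tau>\<^sup>2 * real n"
    using n by (simp add: power2_eq_square)
  finally show ?thesis
    by (simp add: E algebra_simps sum.inter_filter[symmetric])
qed

text \<open>A single typical \<open>n\<close> suffices. The event that no \<open>n > 0\<close> is
  typical lies in every \<open>B n\<close> with \<open>n > 0\<close>, and the probabilities of these
  tend to 0.\<close>

lemma AE_exists_typical_block:
  fixes J :: "'a \<Rightarrow> (nat \<times> nat) set" and S :: "'a \<Rightarrow> nat \<times> nat \<Rightarrow> complex set"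
  assumes A: "finite A" and J: "\<And>a. a \<in> A \<Longrightarrow> finite (J a)"
    and S: "\<And>a p. a \<in> A \<Longrightarrow> p \<in> J a \<Longrightarrow> S a p \<in> sets borel" and \<tau>: "0 < \<tau>"
  shows "AE H in \<Omega>. \<exists>n>0. \<forall>a\<in>A. real (card {f \<in> {..<n}. slot_in (J a) (S a) f H})
    \<le> ((\<Prod>p\<in>J a. measure \<mu> (S a p)) + \<tau>) * real n"
proof -
  let ?q = "\<lambda>a. (\<Prod>p\<in>J a. measure \<mu> (S a p)) + \<tau>"
  let ?c = "\<lambda>a n H. real (card {f \<in> {..<n}. slot_in (J a) (S a) f H})"
  define B where "B n = {H \<in> space \<Omega>. \<exists>a\<in>A. ?q a * real n \<le> ?c a n H}" for n
  have m: "{H \<in> space \<Omega>. ?q a * real n \<le> ?c a n H} \<in> events" if "a \<in> A" for a n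
  proof -
    have [measurable]: "?c a n \<in> borel_measurable \<Omega>"
      using that by (intro borel_measurable_card pred_slot_in J S) auto
    show ?thesis by measurable
  qed
  have B_eq: "B n = (\<Union>a\<in>A. {H \<in> space \<Omega>. ?q a * real n \<le> ?c a n H})" for n
    by (auto simp: B_def)
  have B: "B n \<in> events" for n
    unfolding B_eq by (rule sets.finite_UN[OF A m])
  have le: "prob (\<Inter>n\<in>{0<..}. B n) \<le> real (card A) * exp (- 2 * \<tau>\<^sup>2 * real n)" if n: "0 < n" for n
  proof -
    have "prob (\<Inter>n\<in>{0<..}. B n) \<le> prob (B n)"
      using n B by (intro finite_measure_mono) auto
    also have "\<dots> \<le> (\<Sum>a\<in>A. prob {H \<in> space \<Omega>. ?q a * real n \<le> ?c a n H})"
      unfolding B_eq using m by (intro finite_measure_subadditive_finite[OF A] image_subsetI)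
    also have "\<dots> \<le> (\<Sum>a\<in>A. exp (- 2 * \<tau>\<^sup>2 * real n))"
      by (intro sum_mono prob_many_slots J S \<tau> n)
    finally show ?thesis by simp
  qed
  have "(\<lambda>n. real (card A) * exp (- 2 * \<tau>\<^sup>2 * real n)) \<longlonglongrightarrow> 0"
    using \<tau> by real_asymp
  then have "prob (\<Inter>n\<in>{0<..}. B n) \<le> 0"
    by (rule LIMSEQ_le_const) (use le in \<open>auto intro!: exI[of _ 1]\<close>)
  then have "prob (\<Inter>n\<in>{0<..}. B n) = 0"
    by (simp add: measure_le_0_iff)
  moreover have "(\<Inter>n\<in>{0<..}. B n) \<in> events"
    using B by (intro sets.countable_INT) auto
  ultimately have "AE H in \<Omega>. H \<notin> (\<Inter>n\<in>{0<..}. B n)"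
    by (simp add: prob_eq_0)
  then show ?thesis
  proof (rule AE_mp, intro AE_I2 impI)
    fix H assume "H \<in> space \<Omega>" "H \<notin> (\<Inter>n\<in>{0<..}. B n)"
    then obtain n where n: "0 < n" "\<forall>a\<in>A. \<not> ?q a * real n \<le> ?c a n H"
      by (auto simp: B_def)
    then show "\<exists>n>0. \<forall>a\<in>A. ?c a n H \<le> ?q a * real n"
      by (intro exI[of _ n]) (auto simp: not_le less_imp_le)
  qed
qed

end

section \<open>Pairs of slots with nearly equal cross gains\<close>

definition aligned_pairs :: "nat \<Rightarrow> (nat \<Rightarrow> nat \<Rightarrow> nat \<Rightarrow> complex) \<Rightarrow> nat \<Rightarrow> nat set \<Rightarrow> (nat \<Rightarrow> nat) \<Rightarrow> real \<Rightarrow> real \<Rightarrow> bool" where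
  "aligned_pairs K H f0 P m c b \<longleftrightarrow>
    P \<subseteq> {..<f0} \<and> m ` P \<subseteq> {..<f0} \<and> inj_on m P \<and> P \<inter> m ` P = {} \<and>
    (\<forall>f\<in>P. (\<forall>k<K. c \<le> cmod (H k k f - H k k (m f))) \<and>
      (\<forall>k<K. \<forall>j<K. j \<noteq> k \<longrightarrow> cmod (H k j f - H k j (m f)) \<le> b))"

text \<open>Squares of side \<open>s\<close> turn closeness of cross gains into equality of labels
  from a finite set, as needed for counting.\<close>

definition grid_cell :: "real \<Rightarrow> complex \<Rightarrow> int \<times> int" where
  "grid_cell s z = (\<lfloor>Re z / s\<rfloor>, \<lfloor>Im z / s\<rfloor>)"

lemma grid_cell_sets: "{z. grid_cell s z = v} \<in> sets borel"
proof -
  have "{z. grid_cell s z = v} = {z. \<lfloor>Re z / s\<rfloor> = fst v \<and> \<lfloor>Im z / s\<rfloor> = snd v}"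
    by (auto simp: grid_cell_def)
  moreover have "{z \<in> space borel. \<lfloor>Re z / s\<rfloor> = fst v \<and> \<lfloor>Im z / s\<rfloor> = snd v} \<in> sets borel"
    by measurable
  ultimately show ?thesis by simp
qed

lemma same_grid_cell:
  assumes s: "0 < s" and eq: "grid_cell s x = grid_cell s y"
  shows "cmod (x - y) \<le> 2 * s"
proof -
  have *: "\<bar>u - v\<bar> \<le> s" if "\<lfloor>u / s\<rfloor> = \<lfloor>v / s\<rfloor>" for u v
  proof -
    have "\<bar>u / s - v / s\<bar> \<le> 1" using that by linarith
    then show ?thesis
      using s by (simp add: diff_divide_distrib[symmetric] abs_divide)
  qed
  have "cmod (x - y) \<le> \<bar>Re (x - y)\<bar> + \<bar>Im (x - y)\<bar>"
    by (rule cmod_le)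
  then show ?thesis
    using *[of "Re x" "Re y"] *[of "Im x" "Im y"] eq by (simp add: grid_cell_def)
qed

lemma grid_cell_bounded:
  assumes s: "0 < s" and z: "cmod z \<le> h"
  shows "grid_cell s z \<in> {- (\<lceil>h / s\<rceil> + 1)..\<lceil>h / s\<rceil> + 1} \<times> {- (\<lceil>h / s\<rceil> + 1)..\<lceil>h / s\<rceil> + 1}"
proof -
  have *: "\<lfloor>u / s\<rfloor> \<in> {- (\<lceil>h / s\<rceil> + 1)..\<lceil>h / s\<rceil> + 1}" if "\<bar>u\<bar> \<le> h" for u
  proof -
    have "\<bar>u / s\<bar> \<le> h / s"
      using that s by (simp add: abs_divide divide_right_mono)
    then have "- (h / s) \<le> u / s" "u / s \<le> h / s"
      by (simp_all only: abs_le_iff) linarith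
    then have "- (\<lceil>h / s\<rceil> + 1) \<le> \<lfloor>u / s\<rfloor>" "\<lfloor>u / s\<rfloor> \<le> \<lceil>h / s\<rceil> + 1"
      by linarith+
    then show ?thesis by simp
  qed
  show ?thesis
    using *[of "Re z"] *[of "Im z"] abs_Re_le_cmod[of z] abs_Im_le_cmod[of z] z
    by (auto simp: grid_cell_def)
qed

context iid_channel
begin

text \<open>Absolute continuity enters through the absence of atoms: the measures of shrinking balls
  tend to \<open>measure \<mu> {x} = 0\<close>.\<close>

lemma exists_small_ball:
  assumes "absolutely_continuous lborel \<mu>" and "0 < \<eta>"
  shows "\<exists>r>0. measure \<mu> (ball x r) \<le> \<eta>"
proof -
  have "{x} \<in> null_sets lborel" by (simp add: finite_imp_null_set_lborel)
  then have "{x} \<in> null_sets \<mu>"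
    using assms(1) by (auto simp: absolutely_continuous_def)
  then have zero: "measure \<mu> {x} = 0"
    by (auto simp: null_sets_def measure_def)
  have "(\<Inter>n::nat. ball x (1 / real (Suc n))) = {x}"
  proof (intro equalityI subsetI)
    fix y assume y: "y \<in> (\<Inter>n::nat. ball x (1 / real (Suc n)))"
    have "dist x y \<le> 0"
    proof (rule field_le_epsilon)
      fix e :: real assume "0 < e"
      then obtain n :: nat where "1 / real (Suc n) < e"
        using nat_approx_posE by blast
      moreover have "dist x y < 1 / real (Suc n)" using y by auto
      ultimately show "dist x y \<le> 0 + e" by linarith
    qed
    then show "y \<in> {x}" by simp
  qed auto
  moreover have "(\<lambda>n. measure \<mu> (ball x (1 / real (Suc n)))) \<longlonglongrightarrow> measure \<mu> (\<Inter>n::nat. ball x (1 / real (Suc n)))"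
  proof (rule mu.finite_Lim_measure_decseq)
    show "decseq (\<lambda>n. ball x (1 / real (Suc n)))"
      by (intro decseq_SucI subset_ball) (simp add: frac_le)
  qed auto
  ultimately have "(\<lambda>n. measure \<mu> (ball x (1 / real (Suc n)))) \<longlonglongrightarrow> 0"
    using zero by simp
  then have "eventually (\<lambda>n. measure \<mu> (ball x (1 / real (Suc n))) < \<eta>) sequentially"
    using assms(2) by (rule order_tendstoD)
  then obtain n where "measure \<mu> (ball x (1 / real (Suc n))) < \<eta>"
    by (auto simp: eventually_sequentially)
  then show ?thesis
    by (intro exI[of _ "1 / real (Suc n)"]) auto
qed

text \<open>The origin of the gap \<open>c\<close>: it is a Lebesgue number of a finite cover by
  balls of small measure, so it depends on \<open>\<eta>\<close> and \<open>h\<close> but on no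
  tolerance for the cross gains.\<close>

lemma exists_small_cover:
  assumes "absolutely_continuous lborel \<mu>" and "0 < \<eta>"
  obtains \<V> c where "finite \<V>" "\<And>V. V \<in> \<V> \<Longrightarrow> open V" "\<And>V. V \<in> \<V> \<Longrightarrow> measure \<mu> V \<le> \<eta>" "0 < c"
    "\<And>x. cmod x \<le> h \<Longrightarrow> \<exists>V\<in>\<V>. ball x c \<subseteq> V"
proof -
  obtain r where r: "\<And>x. 0 < r x" "\<And>x. measure \<mu> (ball x (r x)) \<le> \<eta>"
    using exists_small_ball[OF assms] by metis
  have "compact (cball (0::complex) h)" by simp
  then obtain D where D: "D \<subseteq> cball 0 h" "finite D" "cball 0 h \<subseteq> (\<Union>x\<in>D. ball x (r x))"
    by (rule compactE_image[where C = "cball 0 h" and f = "\<lambda>x. ball x (r x)"]) (use r(1) in auto)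
  obtain c where c: "0 < c" "\<And>x. x \<in> cball 0 h \<Longrightarrow> \<exists>V\<in>(\<lambda>x. ball x (r x)) ` D. ball x c \<subseteq> V"
    using Heine_Borel_lemma[of "cball (0::complex) h" "(\<lambda>x. ball x (r x)) ` D"] D(3) by auto
  show thesis
    by (rule that[of "(\<lambda>x. ball x (r x)) ` D" c]) (use D(2) r(2) c in auto)
qed

text \<open>Unmatched slots in one cell are pairwise bad, so each has some direct gain within \<open>c\<close> of that of a
  fixed representative; typicality bounds the number of slots with this property.\<close>

lemma card_unmatched_le:
  fixes H :: "nat \<times> nat \<times> nat \<Rightarrow> complex" and cell :: "nat \<Rightarrow> 'c" and \<V> :: "complex set set"
  assumes K: "0 < K" and U: "U \<subseteq> {..<n}" and A: "finite A" "cell ` U \<subseteq> A"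
    and bad: "\<And>f f'. f \<in> U \<Longrightarrow> f' \<in> U \<Longrightarrow> f \<noteq> f' \<Longrightarrow> cell f = cell f' \<Longrightarrow>
      \<exists>k<K. cmod (H (k, k, f) - H (k, k, f')) < c"
    and cover: "\<And>k f. \<exists>V\<in>\<V>. ball (H (k, k, f)) c \<subseteq> V" and c: "0 < c"
    and few: "\<And>a k V. a \<in> A \<Longrightarrow> k < K \<Longrightarrow> V \<in> \<V> \<Longrightarrow>
      real (card {f \<in> {..<n}. cell f = a \<and> H (k, k, f) \<in> V}) \<le> t a"
    and t: "\<And>a. a \<in> A \<Longrightarrow> 0 \<le> t a"
  shows "real (card U) \<le> real K * (\<Sum>a\<in>A. t a)"
proof -
  have finU: "finite U" using U by (rule finite_subset) simp
  have one: "real (card {f \<in> U. cell f = a}) \<le> real K * t a" if a: "a \<in> A" for a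
  proof (cases "{f \<in> U. cell f = a} = {}")
    case True
    then show ?thesis using t[OF a] unfolding True by simp
  next
    case False
    then obtain g where g: "g \<in> U" "cell g = a" by auto
    obtain V where V: "\<And>k. V k \<in> \<V>" "\<And>k. ball (H (k, k, g)) c \<subseteq> V k"
      using cover[of _ g] by metis
    let ?T = "\<lambda>k. {f \<in> {..<n}. cell f = a \<and> H (k, k, f) \<in> V k}"
    have "{f \<in> U. cell f = a} \<subseteq> (\<Union>k<K. ?T k)"
    proof
      fix f assume f: "f \<in> {f \<in> U. cell f = a}"
      have "\<exists>k<K. cmod (H (k, k, f) - H (k, k, g)) < c"
      proof (cases "f = g")
        case True
        then show ?thesis using K c by auto
      next
        case False
        then show ?thesis using bad[of f g] f g by auto
      qed
      then obtain k where k: "k < K" "cmod (H (k, k, f) - H (k, k, g)) < c" by auto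
      then have "H (k, k, f) \<in> ball (H (k, k, g)) c"
        by (simp add: dist_norm norm_minus_commute)
      then have "H (k, k, f) \<in> V k" by (rule subsetD[OF V(2)])
      then show "f \<in> (\<Union>k<K. ?T k)" using f k U by auto
    qed
    then have "card {f \<in> U. cell f = a} \<le> card (\<Union>k<K. ?T k)"
      by (intro card_mono) auto
    also have "\<dots> \<le> (\<Sum>k<K. card (?T k))"
      by (rule card_UN_le) simp
    finally have "real (card {f \<in> U. cell f = a}) \<le> (\<Sum>k<K. real (card (?T k)))"
      by (simp flip: of_nat_sum)
    also have "\<dots> \<le> (\<Sum>k<K. t a)"
      using few[OF a _ V(1)] by (intro sum_mono) simp
    finally show ?thesis by simp
  qed
  have "card U = card (\<Union>a\<in>A. {f \<in> U. cell f = a})"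
    using A by (intro arg_cong[of _ _ card]) auto
  also have "\<dots> \<le> (\<Sum>a\<in>A. card {f \<in> U. cell f = a})"
    using A by (intro card_UN_le)
  finally have "real (card U) \<le> (\<Sum>a\<in>A. real (card {f \<in> U. cell f = a}))"
    by (simp flip: of_nat_sum)
  also have "\<dots> \<le> (\<Sum>a\<in>A. real K * t a)"
    by (intro sum_mono one)
  finally show ?thesis by (simp add: sum_distrib_left)
qed

text \<open>The cover and its \<open>c\<close> are fixed before \<open>b\<close>, and only the grid
  for the cross gains depends on \<open>b\<close>. As direct and cross gains are independent, each
  set of the cover is as unlikely within a cell as it is overall, however fine the grid.\<close>

lemma AE_exists_aligned_pairs:
  assumes ac: "absolutely_continuous lborel \<mu>" and bd: "AE h in \<mu>. cmod h \<le> hmax"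
    and K: "0 < K" and \<eta>: "0 < \<eta>"
  shows "\<exists>c>0. \<forall>b>0. AE H in \<Omega>. \<exists>f0>0. \<exists>P m.
    aligned_pairs K (\<lambda>k j f. H (k, j, f)) f0 P m c b \<and> (1 - \<eta>) * real f0 \<le> 2 * real (card P)"
proof -
  \<comment> \<open>The unmatched fraction will be at most \<open>K * (\<eta>' + \<eta>')\<close>:
    once for the measure of the cover sets and once for the deviations from typicality.\<close>
  define \<eta>' where "\<eta>' = \<eta> / (2 * real K)"
  have \<eta>': "0 < \<eta>'" using \<eta> K by (simp add: \<eta>'_def)
  obtain \<V> c where V: "finite \<V>" "\<And>V. V \<in> \<V> \<Longrightarrow> open V" "\<And>V. V \<in> \<V> \<Longrightarrow> measure \<mu> V \<le> \<eta>'" "0 < c"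
    "\<And>x. cmod x \<le> hmax \<Longrightarrow> \<exists>V\<in>\<V>. ball x c \<subseteq> V"
    using exists_small_cover[OF ac \<eta>'] by metis
  have "AE H in \<Omega>. \<exists>f0>0. \<exists>P m.
    aligned_pairs K (\<lambda>k j f. H (k, j, f)) f0 P m c b \<and> (1 - \<eta>) * real f0 \<le> 2 * real (card P)"
    if b: "0 < b" for b
  proof -
    \<comment> \<open>Points of one cell of side \<open>s\<close> are at distance at most
      \<open>2 * s\<close>.\<close>
    define s where "s = b / 2"
    have s: "0 < s" using b by (simp add: s_def)
    define B where "B = {- (\<lceil>hmax / s\<rceil> + 1)..\<lceil>hmax / s\<rceil> + 1} \<times> {- (\<lceil>hmax / s\<rceil> + 1)..\<lceil>hmax / s\<rceil> + 1}"
    define X where "X = {p \<in> {..<K} \<times> {..<K}. fst p \<noteq> snd p}"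
    define A where "A = PiE X (\<lambda>_. B)"
    have finX: "finite X" by (simp add: X_def)
    have finB: "finite B" by (simp add: B_def)
    have finA: "finite A" unfolding A_def using finX finB by (intro finite_PiE) auto
    \<comment> \<open>The deviations of all \<open>card A\<close> cells together must stay below
      \<open>\<eta>'\<close>; the summand 1 keeps the denominator positive.\<close>
    define \<tau> where "\<tau> = \<eta>' / (real (card A) + 1)"
    have \<tau>: "0 < \<tau>" using \<eta>' by (simp add: \<tau>_def)
    \<comment> \<open>The probability that the cross gains of a slot have the labels
      \<open>a\<close>. Constraining one direct gain to \<open>V\<close> as well multiplies it by
      \<open>measure \<mu> V\<close>, which is what \<open>J\<close> and \<open>S\<close> below
      encode.\<close>
    define pa where "pa a = (\<Prod>p\<in>X. measure \<mu> {z. grid_cell s z = a p})" for a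
    have pa_sum: "(\<Sum>a\<in>A. pa a) \<le> 1"
    proof -
      have "(\<Sum>a\<in>A. pa a) = (\<Prod>p\<in>X. \<Sum>v\<in>B. measure \<mu> {z. grid_cell s z = v})"
        unfolding A_def pa_def using finX finB by (intro prod_sum_PiE[symmetric]) auto
      also have "\<dots> \<le> 1"
      proof (intro prod_le_1 conjI sum_nonneg measure_nonneg)
        have "(\<Sum>v\<in>B. measure \<mu> {z. grid_cell s z = v}) = measure \<mu> (\<Union>v\<in>B. {z. grid_cell s z = v})"
          by (rule mu.finite_measure_finite_Union[symmetric])
            (use finB grid_cell_sets in \<open>auto simp: disjoint_family_on_def\<close>)
        then show "(\<Sum>v\<in>B. measure \<mu> {z. grid_cell s z = v}) \<le> 1"
          by simp
      qed
      finally show ?thesis .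
    qed
    define J where "J x = insert (fst (snd x), fst (snd x)) X" for x :: "(nat \<times> nat \<Rightarrow> int \<times> int) \<times> nat \<times> complex set"
    define S where "S x p = (if p = (fst (snd x), fst (snd x)) then snd (snd x) else {z. grid_cell s z = fst x p})"
      for x :: "(nat \<times> nat \<Rightarrow> int \<times> int) \<times> nat \<times> complex set" and p
    have prod_eq: "(\<Prod>p\<in>J (a, k, V). measure \<mu> (S (a, k, V) p)) = measure \<mu> V * pa a" for a k V
    proof -
      have "(k, k) \<notin> X" by (simp add: X_def)
      moreover have "(\<Prod>p\<in>X. measure \<mu> (S (a, k, V) p)) = pa a"
        unfolding pa_def by (rule prod.cong) (auto simp: S_def X_def)
      ultimately show ?thesis
        using finX by (simp add: J_def) (simp add: S_def)
    qed
    have "AE H in \<Omega>. \<exists>n>0. \<forall>x\<in>A \<times> {..<K} \<times> \<V>. real (card {f \<in> {..<n}. slot_in (J x) (S x) f H})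
        \<le> ((\<Prod>p\<in>J x. measure \<mu> (S x p)) + \<tau>) * real n"
    proof (rule AE_exists_typical_block)
      show "finite (A \<times> {..<K} \<times> \<V>)" using finA V(1) by simp
      show "finite (J x)" for x using finX by (simp add: J_def)
      show "S x p \<in> sets borel" if "x \<in> A \<times> {..<K} \<times> \<V>" for x p
        using that V(2) grid_cell_sets by (auto simp: S_def)
    qed (rule \<tau>)
    \<comment> \<open>Boundedness keeps all cross gains in the finite grid \<open>B\<close> and all
      direct gains in the covered disc.\<close>
    moreover have "AE H in \<Omega>. \<forall>i. cmod (H i) \<le> hmax"
      unfolding AE_all_countable
      by (intro allI AE_PiM_component[where M = "\<lambda>_. \<mu>" and P = "\<lambda>h. cmod h \<le> hmax"] bd) (auto intro: prob_mu)
    ultimately show ?thesis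
    proof eventually_elim
      case (elim H)
      then obtain n where n: "0 < n" and few: "\<And>a k V. a \<in> A \<Longrightarrow> k < K \<Longrightarrow> V \<in> \<V> \<Longrightarrow>
          real (card {f \<in> {..<n}. slot_in (J (a, k, V)) (S (a, k, V)) f H}) \<le> (measure \<mu> V * pa a + \<tau>) * real n"
        and hm: "\<And>i. cmod (H i) \<le> hmax"
        using prod_eq by force
      define cell where "cell f = (\<lambda>p\<in>X. grid_cell s (H (fst p, snd p, f)))" for f
      define r where "r f f' \<longleftrightarrow> (\<forall>k<K. c \<le> cmod (H (k, k, f) - H (k, k, f'))) \<and>
        (\<forall>k<K. \<forall>j<K. j \<noteq> k \<longrightarrow> cmod (H (k, j, f) - H (k, j, f')) \<le> b)" for f f'
      obtain P m where P: "P \<subseteq> {..<n}" "m ` P \<subseteq> {..<n}" "inj_on m P" "P \<inter> m ` P = {}" "\<forall>f\<in>P. r f (m f)"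
        and max: "\<forall>f\<in>{..<n} - P - m ` P. \<forall>f'\<in>{..<n} - P - m ` P. f \<noteq> f' \<longrightarrow> \<not> r f f'"
        using exists_maximal_matching[of "{..<n}" r] by auto
      let ?U = "{..<n} - P - m ` P"
      have slot_eq: "slot_in (J (a, k, V)) (S (a, k, V)) f H \<longleftrightarrow> cell f = a \<and> H (k, k, f) \<in> V"
        if "a \<in> A" for a k V f
      proof -
        have "(k, k) \<notin> X" by (simp add: X_def)
        then have "slot_in (J (a, k, V)) (S (a, k, V)) f H
            \<longleftrightarrow> H (k, k, f) \<in> V \<and> (\<forall>p\<in>X. grid_cell s (H (fst p, snd p, f)) = a p)"
          by (auto simp: slot_in_def J_def S_def)
        moreover have "(\<forall>p\<in>X. grid_cell s (H (fst p, snd p, f)) = a p) \<longleftrightarrow> cell f = a"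
          using that by (auto simp: cell_def A_def PiE_def extensional_def fun_eq_iff)
        ultimately show ?thesis by blast
      qed
      have "real (card ?U) \<le> real K * (\<Sum>a\<in>A. (\<eta>' * pa a + \<tau>) * real n)"
      proof (rule card_unmatched_le[where cell = cell and H = H and c = c and \<V> = \<V>])
        show "cell ` ?U \<subseteq> A"
          using grid_cell_bounded[OF s hm] by (auto simp: cell_def A_def B_def)
        show "\<exists>k<K. cmod (H (k, k, f) - H (k, k, f')) < c"
          if "f \<in> ?U" "f' \<in> ?U" "f \<noteq> f'" "cell f = cell f'" for f f'
        proof -
          have "cmod (H (k, j, f) - H (k, j, f')) \<le> b" if kj: "k < K" "j < K" "j \<noteq> k" for k j
          proof -
            have "(k, j) \<in> X" using kj by (simp add: X_def)
            then have "grid_cell s (H (k, j, f)) = grid_cell s (H (k, j, f'))"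
              using fun_cong[OF \<open>cell f = cell f'\<close>, of "(k, j)"] by (simp add: cell_def)
            from same_grid_cell[OF s this] show ?thesis by (simp add: s_def)
          qed
          moreover have "\<not> r f f'" using max that by auto
          ultimately show ?thesis unfolding r_def by (auto simp: not_le)
        qed
        show "real (card {f \<in> {..<n}. cell f = a \<and> H (k, k, f) \<in> V}) \<le> (\<eta>' * pa a + \<tau>) * real n"
          if "a \<in> A" "k < K" "V \<in> \<V>" for a k V
        proof -
          have "0 \<le> pa a" by (simp add: pa_def prod_nonneg)
          then have "(measure \<mu> V * pa a + \<tau>) * real n \<le> (\<eta>' * pa a + \<tau>) * real n"
            using V(3)[OF that(3)] by (intro mult_right_mono add_right_mono) auto
          then show ?thesis
            using few[OF that] by (simp add: slot_eq[OF that(1)])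
        qed
        show "0 \<le> (\<eta>' * pa a + \<tau>) * real n" for a
          using \<eta>' \<tau> by (simp add: pa_def prod_nonneg)
      qed (use K finA V(4,5) hm in auto)
      also have "(\<Sum>a\<in>A. (\<eta>' * pa a + \<tau>) * real n) = (\<eta>' * (\<Sum>a\<in>A. pa a) + real (card A) * \<tau>) * real n"
        by (simp add: sum_distrib_left sum_distrib_right sum.distrib distrib_right)
      also have "real K * \<dots> \<le> real K * ((\<eta>' * 1 + \<eta>') * real n)"
      proof (intro mult_left_mono mult_right_mono add_mono pa_sum)
        show "real (card A) * \<tau> \<le> \<eta>'"
          using \<eta>' by (simp add: \<tau>_def field_simps)
      qed (use \<eta>' in auto)
      also have "\<dots> = \<eta> * real n"
        using K by (simp add: \<eta>'_def field_simps)
      finally have U: "real (card ?U) \<le> \<eta> * real n" .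
      have fin: "finite P" "finite (m ` P)"
        using P by (auto intro: finite_subset)
      have "{..<n} = (P \<union> m ` P) \<union> ?U"
        using P by auto
      then have "card {..<n} = card (P \<union> m ` P) + card ?U"
        using fin card_Un_disjoint[of "P \<union> m ` P" ?U] by auto
      moreover have "card (P \<union> m ` P) = 2 * card P"
        using P fin by (simp add: card_Un_disjoint card_image)
      ultimately have "real n = 2 * real (card P) + real (card ?U)"
        by simp
      then have "(1 - \<eta>) * real n \<le> 2 * real (card P)"
        using U by (simp add: algebra_simps)
      moreover have "aligned_pairs K (\<lambda>k j f. H (k, j, f)) n P m c b"
        using P by (auto simp: aligned_pairs_def r_def)
      ultimately show ?case using n by blast
    qed
  qed
  then show ?thesis using V(4) by blast
qed

end

section \<open>Coding over aligned pairs of slots\<close>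

text \<open>For \<open>a < q\<^sup>2\<close> these are the points of a square grid of side
  \<open>q\<close> and spacing \<open>D\<close>, indexed by the base-\<open>q\<close> digits of
  \<open>a\<close>. The grid is not centred, as this changes the power by a constant factor
  only.\<close>

definition qam :: "real \<Rightarrow> nat \<Rightarrow> nat \<Rightarrow> complex" where
  "qam D q a = of_real D * Complex (real (a mod q)) (real (a div q))"

lemma qam_power:
  assumes "0 < q" "a < q\<^sup>2"
  shows "(cmod (qam D q a))\<^sup>2 \<le> 2 * D\<^sup>2 * (real q)\<^sup>2"
proof -
  have "a mod q \<le> q" "a div q \<le> q"
    using assms by (auto simp: power2_eq_square less_mult_imp_div_less less_imp_le)
  then have "(real (a mod q))\<^sup>2 \<le> (real q)\<^sup>2" "(real (a div q))\<^sup>2 \<le> (real q)\<^sup>2"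
    by (auto intro!: power_mono simp del: of_nat_power)
  then have "(real (a mod q))\<^sup>2 + (real (a div q))\<^sup>2 \<le> (real q)\<^sup>2 + (real q)\<^sup>2"
    by (rule add_mono)
  then have "D\<^sup>2 * ((real (a mod q))\<^sup>2 + (real (a div q))\<^sup>2) \<le> D\<^sup>2 * ((real q)\<^sup>2 + (real q)\<^sup>2)"
    by (rule mult_left_mono) simp
  then show ?thesis
    by (simp add: qam_def norm_mult power_mult_distrib cmod_power2)
qed

lemma qam_norm:
  assumes "0 < q" "a < q\<^sup>2" "0 < D"
  shows "cmod (qam D q a) \<le> 2 * D * real q"
proof (rule power2_le_imp_le)
  have "(cmod (qam D q a))\<^sup>2 \<le> 2 * D\<^sup>2 * (real q)\<^sup>2"
    by (rule qam_power) (use assms in auto)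
  also have "\<dots> \<le> (2 * D * real q)\<^sup>2"
    by (simp add: power_mult_distrib)
  finally show "(cmod (qam D q a))\<^sup>2 \<le> (2 * D * real q)\<^sup>2" .
qed (use assms in simp)

lemma qam_separated:
  assumes "0 < D" "a \<noteq> a'"
  shows "D \<le> cmod (qam D q a - qam D q a')"
proof -
  have int: "D \<le> \<bar>D * real u - D * real v\<bar>" if "u \<noteq> v" for u v :: nat
  proof -
    have "1 \<le> \<bar>real u - real v\<bar>" using that by linarith
    then have "D * 1 \<le> D * \<bar>real u - real v\<bar>"
      using assms(1) by (intro mult_left_mono) auto
    then show ?thesis
      using assms(1) by (simp add: abs_mult right_diff_distrib[symmetric])
  qed
  show ?thesis
  proof (cases "a mod q = a' mod q")
    case True
    then have "a div q \<noteq> a' div q"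
      using assms(2) by (metis div_mult_mod_eq)
    then have "D \<le> \<bar>Im (qam D q a - qam D q a')\<bar>"
      using int by (simp add: qam_def)
    then show ?thesis using abs_Im_le_cmod[of "qam D q a - qam D q a'"] by linarith
  next
    case False
    then have "D \<le> \<bar>Re (qam D q a - qam D q a')\<bar>"
      using int by (simp add: qam_def)
    then show ?thesis using abs_Re_le_cmod[of "qam D q a - qam D q a'"] by linarith
  qed
qed

text \<open>Every user sends the same symbol on both slots of a pair. The difference of the two outputs
  almost cancels the interference, since the cross gains nearly agree, but not the desired signal.\<close>

locale aligned_code =
  fixes K f0 t0 :: nat and H :: "nat \<Rightarrow> nat \<Rightarrow> nat \<Rightarrow> complex" and P :: "nat set" and m :: "nat \<Rightarrow> nat"
    and c b D L :: real and q r Mn :: nat and e :: "nat \<Rightarrow> nat \<times> nat \<Rightarrow> nat"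
  assumes pairs: "aligned_pairs K H f0 P m c b"
    and c: "0 < c" and b: "0 \<le> b" and D: "0 < D" and q: "0 < q"
    and sep: "real K * b * (2 * D * real q) + 2 * L < c * D / 2"
    and Mn: "0 < Mn"
    and e: "\<And>w. w < Mn \<Longrightarrow> e w \<in> PiE (P \<times> {..<t0}) (\<lambda>_. {..<q\<^sup>2})"
    and dist: "\<And>w w'. w < Mn \<Longrightarrow> w' < Mn \<Longrightarrow> w \<noteq> w' \<Longrightarrow> 2 * r < card {p \<in> P \<times> {..<t0}. e w p \<noteq> e w' p}"
begin

abbreviation "J \<equiv> P \<times> {..<t0}"
definition "mate p = (m (fst p), snd p)" for p :: "nat \<times> nat"
text \<open>The representative in \<open>P\<close> of the pair containing \<open>f\<close>. For
  slots outside all pairs its value is irrelevant, because \<open>X\<close> is zero there.\<close>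

definition "first_slot f = (if f \<in> P then f else inv_into P m f)"
text \<open>All users share one codebook, so the right-hand side does not mention
  \<open>k\<close>.\<close>

definition X :: "nat \<Rightarrow> nat \<Rightarrow> nat \<times> nat \<Rightarrow> complex" where
  "X k w p = (if fst p \<in> P \<union> m ` P \<and> snd p < t0 then qam D q (e w (first_slot (fst p), snd p)) else 0)"
definition "gain k f = H k k f - H k k (m f)"
text \<open>A pair is represented by its slot in \<open>P\<close>. The threshold is half of
  \<open>c * D\<close>, the distance that different symbols keep at least after multiplication by
  the gain.\<close>

definition bad :: "nat \<Rightarrow> nat \<Rightarrow> (nat \<times> nat \<Rightarrow> complex) \<Rightarrow> (nat \<times> nat) set" where
  "bad k w y = {p \<in> J. c * D / 2 \<le> cmod (y p - y (mate p) - gain k (fst p) * qam D q (e w p))}"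
text \<open>For \<open>k < K\<close> at most one message has so few bad pairs, so
  \<open>LEAST\<close> merely selects it; without such a message the value is unspecified.\<close>

definition dec :: "nat \<Rightarrow> (nat \<times> nat \<Rightarrow> complex) \<Rightarrow> nat" where
  "dec k y = (LEAST w. w < Mn \<and> card (bad k w y) \<le> r)"

lemma P_sub: "P \<subseteq> {..<f0}" "m ` P \<subseteq> {..<f0}" "inj_on m P" "P \<inter> m ` P = {}"
  using pairs by (auto simp: aligned_pairs_def)

lemma finite_J: "finite J"
  using P_sub(1) by (auto intro: finite_subset)

lemma J_blk: "p \<in> J \<Longrightarrow> p \<in> blk f0 t0" "p \<in> J \<Longrightarrow> mate p \<in> blk f0 t0"
  using P_sub(1,2) by (auto simp: blk_def mate_def)

lemma X_pair:
  assumes "p \<in> J"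
  shows "X k w p = qam D q (e w p)" "X k w (mate p) = qam D q (e w p)"
proof -
  have "m (fst p) \<notin> P" "inv_into P m (m (fst p)) = fst p"
    using assms P_sub(3,4) by auto
  then show "X k w p = qam D q (e w p)" "X k w (mate p) = qam D q (e w p)"
    using assms by (auto simp: X_def mate_def first_slot_def)
qed

lemma X_power:
  assumes "w < Mn"
  shows "(\<Sum>p\<in>blk f0 t0. (cmod (X k w p))\<^sup>2) \<le> 2 * D\<^sup>2 * (real q)\<^sup>2 * real (f0 * t0)"
proof -
  have "(cmod (X k w p))\<^sup>2 \<le> 2 * D\<^sup>2 * (real q)\<^sup>2" for p
  proof (cases "fst p \<in> P \<union> m ` P \<and> snd p < t0")
    case True
    then have "first_slot (fst p) \<in> P"
      by (auto simp: first_slot_def inv_into_into)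
    then have "e w (first_slot (fst p), snd p) < q\<^sup>2"
      using e[OF assms] True by auto
    then show ?thesis
      using True q by (simp add: X_def qam_power)
  next
    case False
    then have "X k w p = 0" by (auto simp: X_def)
    then show ?thesis by simp
  qed
  then have "(\<Sum>p\<in>blk f0 t0. (cmod (X k w p))\<^sup>2) \<le> (\<Sum>p\<in>blk f0 t0. 2 * D\<^sup>2 * (real q)\<^sup>2)"
    by (rule sum_mono)
  then show ?thesis by (simp add: mult.commute)
qed

text \<open>At a pair that is bad for neither message, the triangle inequality puts the two scaled
  symbols closer than \<open>c * D\<close>, so they coincide. Different codewords would then differ
  in at most \<open>2 * r\<close> places, against the minimum distance.\<close>

lemma few_bad_unique:
  assumes k: "k < K" and w: "w < Mn" "w' < Mn" and few: "card (bad k w y) \<le> r" "card (bad k w' y) \<le> r"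
  shows "w = w'"
proof (rule ccontr)
  assume "w \<noteq> w'"
  have "{p \<in> J. e w p \<noteq> e w' p} \<subseteq> bad k w y \<union> bad k w' y"
  proof (rule subsetI, rule ccontr)
    fix p assume p: "p \<in> {p \<in> J. e w p \<noteq> e w' p}" and n: "p \<notin> bad k w y \<union> bad k w' y"
    let ?y = "y p - y (mate p)" and ?g = "gain k (fst p)"
    have "cmod (?y - ?g * qam D q (e w p)) < c * D / 2" "cmod (?y - ?g * qam D q (e w' p)) < c * D / 2"
      using p n by (auto simp: bad_def)
    then have "cmod ((?y - ?g * qam D q (e w' p)) - (?y - ?g * qam D q (e w p))) < c * D"
      using norm_triangle_ineq4[of "?y - ?g * qam D q (e w' p)" "?y - ?g * qam D q (e w p)"] by linarith
    then have "cmod ?g * cmod (qam D q (e w p) - qam D q (e w' p)) < c * D"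
      by (simp add: norm_mult[symmetric] right_diff_distrib)
    moreover have "c * D \<le> cmod ?g * cmod (qam D q (e w p) - qam D q (e w' p))"
    proof (intro mult_mono)
      show "c \<le> cmod ?g"
        using pairs p k by (auto simp: aligned_pairs_def gain_def)
      show "D \<le> cmod (qam D q (e w p) - qam D q (e w' p))"
        using p D by (intro qam_separated) auto
    qed (use D in auto)
    ultimately show False by linarith
  qed
  then have "card {p \<in> J. e w p \<noteq> e w' p} \<le> card (bad k w y \<union> bad k w' y)"
    using finite_J by (intro card_mono) (auto simp: bad_def)
  also have "\<dots> \<le> card (bad k w y) + card (bad k w' y)"
    by (rule card_Un_le)
  finally show False
    using dist[OF w \<open>w \<noteq> w'\<close>] few by linarith
qed

text \<open>By \<open>sep\<close>, residual interference and two noise samples of modulus at most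
  \<open>L\<close> stay below the threshold. Each bad pair therefore contains a large noise
  sample.\<close>

lemma few_bad_of_small_noise:
  assumes k: "k < K" and w: "w \<in> PiE {..<K} (\<lambda>_. {..<Mn})"
    and z: "card {p \<in> blk f0 t0. L < cmod (z p)} \<le> r"
  shows "card (bad k (w k) (rx K H f0 t0 X w k z)) \<le> r"
proof -
  let ?y = "rx K H f0 t0 X w k z"
  let ?N = "{p \<in> blk f0 t0. L < cmod (z p)}"
  \<comment> \<open>Picks a slot with large noise from each bad pair. Pairs are disjoint, so this is
    injective and bad pairs are at most as many as large samples.\<close>
  let ?h = "\<lambda>p. if L < cmod (z p) then p else mate p"
  have large: "L < cmod (z p) \<or> L < cmod (z (mate p))" if p: "p \<in> bad k (w k) ?y" for p
  proof (rule ccontr)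
    assume n: "\<not> (L < cmod (z p) \<or> L < cmod (z (mate p)))"
    have J: "p \<in> J" using p by (simp add: bad_def)
    let ?s = "\<lambda>j. qam D q (e (w j) p)"
    let ?d = "\<lambda>j. H k j (fst p) - H k j (m (fst p))"
    have "?y p - ?y (mate p) = (\<Sum>j<K. ?d j * ?s j) + (z p - z (mate p))"
      using J_blk[OF J] by (simp add: rx_eq rx_signal_def X_pair[OF J] left_diff_distrib sum_subtractf)
        (simp add: mate_def)
    moreover have "(\<Sum>j<K. ?d j * ?s j) = gain k (fst p) * ?s k + (\<Sum>j\<in>{..<K} - {k}. ?d j * ?s j)"
      using k by (simp add: sum.remove[of _ k] gain_def)
    ultimately have "?y p - ?y (mate p) - gain k (fst p) * ?s k
        = (\<Sum>j\<in>{..<K} - {k}. ?d j * ?s j) + (z p - z (mate p))"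
      by simp
    also have "cmod \<dots> \<le> (\<Sum>j\<in>{..<K} - {k}. b * (2 * D * real q)) + (L + L)"
    proof (intro order_trans[OF norm_triangle_ineq] add_mono order_trans[OF norm_sum] sum_mono
        order_trans[OF norm_triangle_ineq4])
      fix j assume j: "j \<in> {..<K} - {k}"
      have "cmod (?d j) \<le> b"
        using pairs J j k by (auto simp: aligned_pairs_def)
      moreover have "e (w j) p < q\<^sup>2"
        using e[of "w j"] w j J by auto
      then have "cmod (?s j) \<le> 2 * D * real q"
        using q D by (intro qam_norm) auto
      ultimately show "cmod (?d j * ?s j) \<le> b * (2 * D * real q)"
        using b by (simp add: norm_mult mult_mono)
    qed (use n in auto)
    also have "\<dots> \<le> real K * b * (2 * D * real q) + 2 * L"
    proof -
      have "real (card ({..<K} - {k})) * (b * (2 * D * real q)) \<le> real K * (b * (2 * D * real q))"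
        using b D card_mono[of "{..<K}" "{..<K} - {k}"] by (intro mult_right_mono) auto
      then show ?thesis by (simp add: mult.assoc)
    qed
    also have "\<dots> < c * D / 2" by (rule sep)
    finally show False using p by (simp add: bad_def)
  qed
  have "inj_on ?h (bad k (w k) ?y)"
  proof (rule inj_onI)
    fix p p' assume p: "p \<in> bad k (w k) ?y" "p' \<in> bad k (w k) ?y" and eq: "?h p = ?h p'"
    have J: "fst p \<in> P" "fst p' \<in> P" using p by (auto simp: bad_def)
    have "m (fst p) \<notin> P" "m (fst p') \<notin> P" using J P_sub(4) by auto
    moreover have "m (fst p) = m (fst p') \<Longrightarrow> fst p = fst p'"
      using J P_sub(3) by (auto dest: inj_onD)
    ultimately show "p = p'"
      using eq J by (auto simp: mate_def prod_eq_iff split: if_splits)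
  qed
  moreover have "?h ` bad k (w k) ?y \<subseteq> ?N"
  proof (rule image_subsetI)
    fix p assume p: "p \<in> bad k (w k) ?y"
    then have "p \<in> J" by (simp add: bad_def)
    then show "?h p \<in> ?N" using large[OF p] J_blk[of p] by (cases "L < cmod (z p)") simp_all
  qed
  moreover have "finite ?N" by simp
  ultimately have "card (bad k (w k) ?y) \<le> card ?N"
    by (rule card_inj_on_le)
  then show ?thesis using z by simp
qed

lemma dec_correct:
  assumes k: "k < K" and w: "w \<in> PiE {..<K} (\<lambda>_. {..<Mn})"
    and z: "card {p \<in> blk f0 t0. L < cmod (z p)} \<le> r"
  shows "dec k (rx K H f0 t0 X w k z) = w k"
  unfolding dec_def
proof (rule Least_equality)
  have wk: "w k < Mn" using w k by auto
  show 1: "w k < Mn \<and> card (bad k (w k) (rx K H f0 t0 X w k z)) \<le> r"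
    using wk few_bad_of_small_noise[OF assms] by simp
  show "w k \<le> v" if "v < Mn \<and> card (bad k v (rx K H f0 t0 X w k z)) \<le> r" for v
    using few_bad_unique[OF k _ wk, of v] that 1 by auto
qed

lemma dec_measurable: "dec k \<in> measurable (PiM (blk f0 t0) (\<lambda>_. borel)) (count_space UNIV)"
proof -
  have "Measurable.pred (PiM (blk f0 t0) (\<lambda>_. borel)) (\<lambda>y. card (bad k w y) \<le> r)" for w
  proof -
    have [measurable]: "(\<lambda>y. real (card (bad k w y))) \<in> borel_measurable (PiM (blk f0 t0) (\<lambda>_. borel))"
      unfolding bad_def
    proof (rule borel_measurable_card[OF finite_J])
      fix p assume "p \<in> J"
      from J_blk[OF this] have [measurable]: "(\<lambda>y. y p) \<in> borel_measurable (PiM (blk f0 t0) (\<lambda>_. borel))"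
        "(\<lambda>y. y (mate p)) \<in> borel_measurable (PiM (blk f0 t0) (\<lambda>_. borel))"
        by (auto intro: measurable_component_singleton)
      show "Measurable.pred (PiM (blk f0 t0) (\<lambda>_. borel))
          (\<lambda>y. c * D / 2 \<le> cmod (y p - y (mate p) - gain k (fst p) * qam D q (e w p)))"
        by measurable
    qed
    have "Measurable.pred (PiM (blk f0 t0) (\<lambda>_. borel)) (\<lambda>y. real (card (bad k w y)) \<le> real r)"
      by measurable
    then show ?thesis by simp
  qed
  note [measurable] = this
  show ?thesis unfolding dec_def by measurable
qed

lemma is_code: "2 * real K * D\<^sup>2 * (real q)\<^sup>2 \<le> \<rho> \<Longrightarrow> is_code K \<rho> f0 t0 (\<lambda>_. Mn) X dec"
proof -
  assume \<rho>: "2 * real K * D\<^sup>2 * (real q)\<^sup>2 \<le> \<rho>"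
  have "(\<Sum>w<Mn. \<Sum>p\<in>blk f0 t0. (cmod (X k w p))\<^sup>2) / real Mn \<le> 2 * D\<^sup>2 * (real q)\<^sup>2 * real (f0 * t0)" for k
  proof -
    have "(\<Sum>w<Mn. \<Sum>p\<in>blk f0 t0. (cmod (X k w p))\<^sup>2) \<le> (\<Sum>w<Mn. 2 * D\<^sup>2 * (real q)\<^sup>2 * real (f0 * t0))"
      by (intro sum_mono X_power) simp
    then show ?thesis using Mn by (simp add: pos_divide_le_eq mult.commute)
  qed
  then have "(\<Sum>k<K. (\<Sum>w<Mn. \<Sum>p\<in>blk f0 t0. (cmod (X k w p))\<^sup>2) / real Mn)
      \<le> (\<Sum>k<K. 2 * D\<^sup>2 * (real q)\<^sup>2 * real (f0 * t0))"
    by (intro sum_mono)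
  also have "\<dots> = (2 * real K * D\<^sup>2 * (real q)\<^sup>2) * real (f0 * t0)"
    by simp
  also have "\<dots> \<le> \<rho> * real (f0 * t0)"
    using \<rho> by (intro mult_right_mono) auto
  finally show ?thesis
    using Mn dec_measurable by (auto simp: is_code_def Suc_le_eq)
qed

lemma err_le:
  assumes k: "k < K"
  shows "err K H f0 t0 (\<lambda>_. Mn) X dec k \<le> 2 ^ (f0 * t0) * measure cgauss {z. L < cmod z} ^ Suc r"
proof -
  let ?N = "noise_space f0 t0" and ?W = "PiE {..<K} (\<lambda>_. {..<Mn})"
  let ?B = "2 ^ (f0 * t0) * measure cgauss {z. L < cmod z} ^ Suc r"
  interpret N: prob_space ?N by (rule prob_space_noise_space)
  have "measure ?N {z \<in> space ?N. dec k (rx K H f0 t0 X w k z) \<noteq> w k} \<le> ?B" if w: "w \<in> ?W" for w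
  proof -
    have "{z \<in> space ?N. Suc r \<le> card {p \<in> blk f0 t0. L < cmod (z p)}} \<in> sets ?N"
    proof -
      have [measurable]: "(\<lambda>z. real (card {p \<in> blk f0 t0. L < cmod (z p)})) \<in> borel_measurable ?N"
        by (intro borel_measurable_card finite_blk) measurable
      have "{z \<in> space ?N. real (Suc r) \<le> real (card {p \<in> blk f0 t0. L < cmod (z p)})} \<in> sets ?N"
        by measurable
      then show ?thesis by (simp only: of_nat_le_iff)
    qed
    then have "measure ?N {z \<in> space ?N. dec k (rx K H f0 t0 X w k z) \<noteq> w k}
      \<le> measure ?N {z \<in> space ?N. Suc r \<le> card {p \<in> blk f0 t0. L < cmod (z p)}}"
      using dec_correct[OF k w] by (intro N.finite_measure_mono) (auto simp: not_less_eq_eq[symmetric])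
    also have "\<dots> \<le> ?B"
      using measure_many_large_noise[where I = "blk f0 t0" and r = "Suc r" and L = L] by (simp add: noise_space_def)
    finally show ?thesis .
  qed
  then have "(\<Sum>w\<in>?W. measure ?N {z \<in> space ?N. dec k (rx K H f0 t0 X w k z) \<noteq> w k}) \<le> (\<Sum>w\<in>?W. ?B)"
    by (rule sum_mono)
  also have "\<dots> = ?B * (\<Prod>j<K. real Mn)"
    by (simp add: card_PiE)
  finally show ?thesis
    using Mn by (simp add: err_def pos_divide_le_eq)
qed

end

section \<open>Rates achieved over aligned pairs\<close>

lemma aligned_pairs_achievable:
  assumes pairs: "aligned_pairs K H f0 P m c b" and f0: "0 < f0"
    and c: "0 < c" and b: "0 \<le> b" and D: "0 < D" and q: "0 < q" and T: "0 < T"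
    and sep: "real K * b * (2 * D * real q) + 2 * L < c * D / 2"
    and power: "2 * real K * D\<^sup>2 * (real q)\<^sup>2 \<le> \<rho>"
    and tail: "measure cgauss {z. L < cmod z} \<le> (1 / 4) ^ T"
    and dens: "(1 - \<eta>) * real f0 \<le> 2 * real (card P)"
  shows "achievable K H \<rho> (\<lambda>k. if k < K then ((1 - \<eta>) / 2 - 2 / real T) * ln (real (q\<^sup>2)) - ln 2 else 0)"
  unfolding achievable_def
proof (intro allI impI)
  fix \<epsilon> :: real assume \<epsilon>: "0 < \<epsilon>"
  obtain t where t: "(1 / 2 :: real) ^ t < \<epsilon>"
    using real_arch_pow_inv[OF \<epsilon>, of "1 / 2"] by auto
  \<comment> \<open>\<open>f0\<close> is dictated by the pairing, so only \<open>t0\<close> can make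
    the error small. \<open>Suc\<close> keeps it positive.\<close>
  define t0 where "t0 = Suc t"
  define n where "n = f0 * t0"
  \<comment> \<open>The number of tolerated large samples. From \<open>n < T * Suc r\<close> the
    error is at most \<open>2 ^ n * (1 / 4) ^ n\<close>, while the minimum distance
    \<open>2 * r\<close> costs only the fraction \<open>2 / T\<close> of
    \<open>ln (q\<^sup>2)\<close>.\<close>
  define r where "r = n div T"
  define B where "B = P \<times> {..<t0}"
  let ?Q = "q\<^sup>2"
  have P: "P \<subseteq> {..<f0}" "m ` P \<subseteq> {..<f0}" "inj_on m P" "P \<inter> m ` P = {}"
    using pairs by (auto simp: aligned_pairs_def)
  have B: "finite B" using P(1) by (auto simp: B_def intro: finite_subset)
  have Q: "0 < ?Q" using q by simp
  obtain C where C: "C \<subseteq> PiE B (\<lambda>_. {..<?Q})"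
    "\<And>x y. x \<in> C \<Longrightarrow> y \<in> C \<Longrightarrow> x \<noteq> y \<Longrightarrow> 2 * r < card {p \<in> B. x p \<noteq> y p}"
    "?Q ^ card B \<le> card C * (2 ^ card B * ?Q ^ (2 * r))"
    by (rule gilbert_varshamov[OF B Q, where d = "2 * r"]) (rule that)
  have "finite (PiE B (\<lambda>_. {..<?Q}))" using B by (intro finite_PiE) auto
  then have finC: "finite C" using C(1) by (rule finite_subset[rotated])
  have cardC: "0 < card C"
  proof (rule ccontr)
    assume "\<not> 0 < card C"
    then have "?Q ^ card B \<le> 0" using C(3) by simp
    then show False using Q by simp
  qed
  obtain e where e: "bij_betw e {..<card C} C"
    using ex_bij_betw_nat_finite[OF finC] by (auto simp: atLeast0LessThan)
  interpret aligned_code K f0 t0 H P m c b D L q r "card C" e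
  proof
    show "e w \<in> PiE (P \<times> {..<t0}) (\<lambda>_. {..<?Q})" if "w < card C" for w
      using C(1) bij_betwE[OF e] that unfolding B_def by auto
    show "2 * r < card {p \<in> P \<times> {..<t0}. e w p \<noteq> e w' p}"
      if "w < card C" "w' < card C" "w \<noteq> w'" for w w'
    proof -
      have "e w \<noteq> e w'"
        using e that by (auto simp: bij_betw_def dest: inj_onD)
      then show ?thesis
        using C(2)[of "e w" "e w'"] bij_betwE[OF e] that unfolding B_def by auto
    qed
  qed (use pairs c b D q sep cardC in auto)
  have "1 * t0 \<le> n" unfolding n_def using f0 by (intro mult_le_mono1) simp
  then have n: "0 < n" "t \<le> n" by (auto simp: t0_def)
  have e_le: "err K H f0 t0 (\<lambda>_. card C) X dec k \<le> \<epsilon>" if k: "k < K" for k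
  proof -
    have "n < T * Suc r"
      using T by (simp add: r_def dividend_less_times_div)
    have "err K H f0 t0 (\<lambda>_. card C) X dec k \<le> 2 ^ n * measure cgauss {z. L < cmod z} ^ Suc r"
      using err_le[OF k] by (simp add: n_def)
    also have "\<dots> \<le> 2 ^ n * ((1 / 4) ^ T) ^ Suc r"
      by (intro mult_left_mono power_mono tail) auto
    also have "\<dots> = 2 ^ n * (1 / 4) ^ (T * Suc r)"
      by (simp only: power_mult)
    also have "\<dots> \<le> 2 ^ n * (1 / 4) ^ n"
      using \<open>n < T * Suc r\<close> by (intro mult_left_mono power_decreasing) auto
    also have "\<dots> = (1 / 2) ^ n"
      by (simp add: power_mult_distrib[symmetric])
    also have "\<dots> \<le> (1 / 2) ^ t"
      using n by (intro power_decreasing) auto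
    finally show ?thesis using t by simp
  qed
  \<comment> \<open>The loss \<open>ln 2\<close> covers the factor \<open>2 ^ card B\<close> of the
    Gilbert-Varshamov bound, as \<open>card B \<le> n\<close>.\<close>
  have rate: "((1 - \<eta>) / 2 - 2 / real T) * ln (real ?Q) - ln 2 \<le> ln (real (card C)) / real n"
  proof -
    have cP: "2 * card P \<le> f0"
    proof -
      have "finite P" using P(1) by (auto intro: finite_subset)
      then have "card (P \<union> m ` P) = 2 * card P"
        using P by (simp add: card_Un_disjoint card_image)
      moreover have "card (P \<union> m ` P) \<le> card {..<f0}"
        using P by (intro card_mono) auto
      ultimately show ?thesis by simp
    qed
    have cB: "card B = card P * t0" by (simp add: B_def card_cartesian_product)
    have cBn: "real (card B) \<le> real n"
      using cP unfolding cB n_def of_nat_mult by (intro mult_right_mono) auto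
    have dB: "(1 - \<eta>) / 2 * real n \<le> real (card B)"
    proof -
      have "(1 - \<eta>) * real f0 * real t0 \<le> 2 * real (card P) * real t0"
        using dens by (intro mult_right_mono) auto
      then show ?thesis by (simp add: cB n_def)
    qed
    have rn: "real r \<le> real n / real T"
      unfolding r_def by (rule of_nat_div_le_of_nat)
    have lnQ: "0 \<le> ln (real ?Q)"
      using Q by (intro ln_ge_zero) (simp add: Suc_le_eq)
    have "ln (real ?Q ^ card B) \<le> ln (real (card C) * (2 ^ card B * real ?Q ^ (2 * r)))"
    proof (rule ln_mono)
      have "real (?Q ^ card B) \<le> real (card C * (2 ^ card B * ?Q ^ (2 * r)))"
        using C(3) by (rule of_nat_mono)
      then show "real ?Q ^ card B \<le> real (card C) * (2 ^ card B * real ?Q ^ (2 * r))"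
        by simp
    qed (use Q in auto)
    also have "\<dots> = ln (real (card C)) + (real (card B) * ln 2 + real (2 * r) * ln (real ?Q))"
    proof -
      have "ln (u * (2 ^ i * v ^ j)) = ln u + (real i * ln 2 + real j * ln v)" if "0 < u" "0 < v" for u v :: real and i j
        using that by (simp add: ln_mult ln_realpow)
      then show ?thesis using Q cardC by (simp only: of_nat_0_less_iff)
    qed
    also have "ln (real ?Q ^ card B) = real (card B) * ln (real ?Q)"
      using Q by (simp only: ln_realpow of_nat_0_less_iff)
    finally have "real (card B) * ln (real ?Q) - real (card B) * ln 2 - 2 * real r * ln (real ?Q) \<le> ln (real (card C))"
      by simp
    moreover have "(1 - \<eta>) / 2 * real n * ln (real ?Q) \<le> real (card B) * ln (real ?Q)"
      by (rule mult_right_mono[OF dB lnQ])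
    moreover have "real (card B) * ln 2 \<le> real n * ln 2"
      using cBn by (rule mult_right_mono) simp
    moreover have "2 * real r * ln (real ?Q) \<le> 2 * (real n / real T) * ln (real ?Q)"
      using rn lnQ by (intro mult_right_mono mult_left_mono) auto
    ultimately have "(1 - \<eta>) / 2 * real n * ln (real ?Q) - real n * ln 2 - 2 * (real n / real T) * ln (real ?Q)
        \<le> ln (real (card C))"
      by linarith
    then have "(((1 - \<eta>) / 2 - 2 / real T) * ln (real ?Q) - ln 2) * real n \<le> ln (real (card C))"
      by (simp add: algebra_simps)
    then show ?thesis
      using n by (simp add: pos_le_divide_eq)
  qed
  show "\<exists>f0 t0 M X g. 0 < f0 \<and> 0 < t0 \<and> is_code K \<rho> f0 t0 M X g \<and>
      (\<forall>k<K. (if k < K then ((1 - \<eta>) / 2 - 2 / real T) * ln (real (q\<^sup>2)) - ln 2 else 0) - \<epsilon>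
          \<le> ln (real (M k)) / real (f0 * t0) \<and> err K H f0 t0 M X g k \<le> \<epsilon>)"
  proof (intro exI conjI allI impI)
    show "is_code K \<rho> f0 t0 (\<lambda>_. card C) X dec" by (rule is_code[OF power])
    fix k assume k: "k < K"
    show "(if k < K then ((1 - \<eta>) / 2 - 2 / real T) * ln (real (q\<^sup>2)) - ln 2 else 0) - \<epsilon>
        \<le> ln (real (card C)) / real (f0 * t0)"
      using rate k \<epsilon> unfolding n_def by simp
    show "err K H f0 t0 (\<lambda>_. card C) X dec k \<le> \<epsilon>" by (rule e_le[OF k])
  qed (use f0 in \<open>auto simp: t0_def\<close>)
qed

text \<open>\<open>T\<close> determines \<open>L\<close>, and \<open>L\<close> and \<open>c\<close>
  determine \<open>D\<close>, all before \<rho>. Only \<open>q\<close> and the tolerance depend on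
  \<rho>, so \<open>C\<close> is a genuine constant.\<close>

lemma capacity_lower_bound:
  assumes c: "0 < c" and K: "0 < K" and T: "5 < T"
    and pairs: "\<And>i. \<exists>f0>0. \<exists>P m. aligned_pairs K H f0 P m c (1 / real (Suc i)) \<and>
      (1 - 1 / real T) * real f0 \<le> 2 * real (card P)"
  shows "\<exists>C. eventually (\<lambda>\<rho>. \<exists>R. ((1 - 1 / real T) / 2 - 2 / real T) * (ln \<rho> - C) - ln 2 \<le> R \<and>
      (\<lambda>k. if k < K then R else 0) \<in> capacity_region K H \<rho>) at_top"
proof -
  define \<kappa> where "\<kappa> = (1 - 1 / real T) / 2 - 2 / real T"
  \<comment> \<open>In fact \<open>\<kappa> = (T - 5) / (2 * T)\<close>, which is the origin of
    \<open>5 < T\<close>.\<close>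
  have \<kappa>: "0 < \<kappa>" using T by (simp add: \<kappa>_def field_simps)
  \<comment> \<open>Makes Chebyshev's bound \<open>4 / L\<^sup>2\<close> equal to
    \<open>(1 / 4) ^ T\<close>.\<close>
  define L :: real where "L = 2 * 2 ^ T"
  have L: "0 < L" by (simp add: L_def)
  have tail: "measure cgauss {z. L < cmod z} \<le> (1 / 4) ^ T"
  proof -
    have "4 / L\<^sup>2 = (1 / 4 :: real) ^ T"
      by (simp add: L_def power_mult_distrib power_divide power_mult[symmetric] mult.commute[of T] power_mult)
    then show ?thesis using measure_cgauss_tail[OF L] by simp
  qed
  \<comment> \<open>Then \<open>c * D / 2 = 8 * L\<close>, which leaves room for interference up to
    \<open>L\<close> and for noise up to \<open>2 * L\<close>.\<close>
  define D where "D = 16 * L / c"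
  have D: "0 < D" using L c by (simp add: D_def)
  define C where "C = ln (8 * real K * D\<^sup>2)"
  have KD: "0 < 8 * real K * D\<^sup>2" using K D by simp
  \<comment> \<open>The second threshold gives \<open>2 \<le> x\<close> below, so that rounding down
    at most halves \<open>x\<close>; the third makes the rate nonnegative, as membership in the
    capacity region demands.\<close>
  have "eventually (\<lambda>\<rho>. max 1 (max (8 * real K * D\<^sup>2) (exp (ln 2 / \<kappa> + C))) \<le> \<rho>) at_top"
    by (rule eventually_ge_at_top)
  then have "eventually (\<lambda>\<rho>. \<exists>R. \<kappa> * (ln \<rho> - C) - ln 2 \<le> R \<and>
      (\<lambda>k. if k < K then R else 0) \<in> capacity_region K H \<rho>) at_top"
  proof eventually_elim
    case (elim \<rho>)
    then have \<rho>: "0 < \<rho>" "8 * real K * D\<^sup>2 \<le> \<rho>" "exp (ln 2 / \<kappa> + C) \<le> \<rho>" by auto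
    \<comment> \<open>The side length that would exhaust the power:
      \<open>2 * K * D\<^sup>2 * x\<^sup>2 = \<rho>\<close>.\<close>
    define x where "x = sqrt (\<rho> / (2 * real K * D\<^sup>2))"
    define q where "q = nat \<lfloor>x\<rfloor>"
    have x2: "x\<^sup>2 = \<rho> / (2 * real K * D\<^sup>2)"
      using \<rho>(1) by (simp add: x_def)
    have "2\<^sup>2 \<le> x\<^sup>2"
      unfolding x2 using \<rho>(2) K D by (simp add: le_divide_eq)
    then have x: "2 \<le> x"
      using \<rho>(1) K by (intro power2_le_imp_le[of 2 x]) (auto simp: x_def)
    have qx: "x / 2 \<le> real q" "real q \<le> x"
      using x unfolding q_def by linarith+
    then have q: "0 < q" using x by (cases q) auto
    have power: "2 * real K * D\<^sup>2 * (real q)\<^sup>2 \<le> \<rho>"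
    proof -
      have "(real q)\<^sup>2 \<le> x\<^sup>2" using qx by (intro power_mono) auto
      then have "2 * real K * D\<^sup>2 * (real q)\<^sup>2 \<le> 2 * real K * D\<^sup>2 * x\<^sup>2"
        by (intro mult_left_mono) auto
      then show ?thesis unfolding x2 using K D by simp
    qed
    have lnq: "ln \<rho> - C \<le> ln (real (q\<^sup>2))"
    proof -
      have "(x / 2)\<^sup>2 \<le> (real q)\<^sup>2" using qx x by (intro power_mono) auto
      moreover have "(x / 2)\<^sup>2 = \<rho> / (8 * real K * D\<^sup>2)"
        by (simp add: power_divide x2)
      ultimately have "ln (\<rho> / (8 * real K * D\<^sup>2)) \<le> ln (real (q\<^sup>2))"
        using \<rho>(1) KD by (intro ln_mono) auto
      moreover have "ln (u / v) = ln u - ln v" if "0 < u" "0 < v" for u v :: real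
        using that by (simp add: ln_div)
      ultimately show ?thesis using \<rho>(1) KD by (simp only: C_def)
    qed
    \<comment> \<open>The interference from cross gains agreeing up to \<open>1 / Suc i\<close> is
      then at most \<open>L\<close>. Since \<open>q\<close> grows with \<rho>, so does
      \<open>i\<close>, and the block of slots changes with it.\<close>
    obtain i :: nat where i: "real K * (2 * D * real q) / L \<le> real i"
      using real_arch_simple by blast
    obtain f0 P m where f0: "0 < f0" and am: "aligned_pairs K H f0 P m c (1 / real (Suc i))"
      and dens: "(1 - 1 / real T) * real f0 \<le> 2 * real (card P)"
      using pairs[of i] by auto
    have sep: "real K * (1 / real (Suc i)) * (2 * D * real q) + 2 * L < c * D / 2"
    proof -
      have "real K * (2 * D * real q) \<le> L * real (Suc i)"
      proof -
        have "real K * (2 * D * real q) \<le> real i * L"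
          using i L by (simp add: pos_divide_le_eq)
        also have "\<dots> \<le> L * real (Suc i)" using L by simp
        finally show ?thesis .
      qed
      then have "real K * (1 / real (Suc i)) * (2 * D * real q) \<le> L"
        by (simp add: divide_le_eq mult.commute)
      moreover have "c * D / 2 = 8 * L" using c by (simp add: D_def)
      ultimately show ?thesis using L by linarith
    qed
    define R where "R = \<kappa> * ln (real (q\<^sup>2)) - ln 2"
    have "achievable K H \<rho> (\<lambda>k. if k < K then R else 0)"
      unfolding R_def \<kappa>_def
      by (rule aligned_pairs_achievable[OF am f0 c _ D q _ sep power tail dens]) (use T in auto)
    moreover have le: "\<kappa> * (ln \<rho> - C) - ln 2 \<le> R"
      unfolding R_def using lnq \<kappa> by simp
    moreover have "0 \<le> R"
    proof -
      have "ln 2 / \<kappa> + C \<le> ln \<rho>"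
        using \<rho>(1,3) by (subst ln_ge_iff) auto
      then have "\<kappa> * (ln 2 / \<kappa>) \<le> \<kappa> * (ln \<rho> - C)"
        using \<kappa> by (intro mult_left_mono) auto
      then show ?thesis using le \<kappa> by simp
    qed
    ultimately show ?case
      by (intro exI[of _ R]) (auto simp: capacity_region_def)
  qed
  then show ?thesis unfolding \<kappa>_def by blast
qed

text \<open>Every \<open>n\<close> comes with its own \<open>c\<close> and falls short of
  \<open>1 / 2\<close> by a multiple of \<open>1 / Suc n\<close>. The right-hand side of each
  defining inequality does not depend on \<open>n\<close>, so the limit may be taken after the limit
  superior in \<rho>.\<close>

lemma half_in_dof_region:
  assumes K: "0 < K"
    and pairs: "\<And>n. \<exists>c>0. \<forall>i. \<exists>f0>0. \<exists>P m. aligned_pairs K H f0 P m c (1 / real (Suc i)) \<and>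
      (1 - 1 / real (Suc n)) * real f0 \<le> 2 * real (card P)"
  shows "(\<lambda>k. if k < K then 1 / 2 else 0) \<in> dof_region K H"
proof -
  have "ereal (\<Sum>k<K. w k * (if k < K then 1 / 2 else 0))
      \<le> Limsup at_top (\<lambda>\<rho>::real. (SUP R\<in>capacity_region K H \<rho>. ereal (\<Sum>k<K. w k * R k)) / ereal (ln \<rho>))"
    (is "_ \<le> ?lim") if w: "\<forall>k<K. 0 \<le> w k" for w :: "nat \<Rightarrow> real"
  proof -
    define W where "W = (\<Sum>k<K. w k)"
    have W: "0 \<le> W" using w by (auto simp: W_def intro: sum_nonneg)
    have sum_eq: "(\<Sum>k<K. w k * (if k < K then R else 0)) = W * R" for R
      by (simp add: W_def sum_distrib_right)
    have le: "ereal (W * ((1 - 1 / real (Suc n)) / 2 - 2 / real (Suc n))) \<le> ?lim" if n: "5 \<le> n" for n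
    proof -
      define \<kappa> where "\<kappa> = (1 - 1 / real (Suc n)) / 2 - 2 / real (Suc n)"
      obtain c where c: "0 < c" and pn: "\<And>i. \<exists>f0>0. \<exists>P m. aligned_pairs K H f0 P m c (1 / real (Suc i)) \<and>
          (1 - 1 / real (Suc n)) * real f0 \<le> 2 * real (card P)"
        using pairs[of n] by auto
      obtain C where C: "eventually (\<lambda>\<rho>. \<exists>R. \<kappa> * (ln \<rho> - C) - ln 2 \<le> R \<and>
          (\<lambda>k. if k < K then R else 0) \<in> capacity_region K H \<rho>) at_top"
        using capacity_lower_bound[OF c K _ pn] n unfolding \<kappa>_def by auto
      have "((\<lambda>\<rho>::real. (W * (\<kappa> * (ln \<rho> - C) - ln 2)) / ln \<rho>) \<longlongrightarrow> W * \<kappa>) at_top"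
        by real_asymp
      then have "((\<lambda>\<rho>::real. ereal ((W * (\<kappa> * (ln \<rho> - C) - ln 2)) / ln \<rho>)) \<longlongrightarrow> ereal (W * \<kappa>)) at_top"
        by simp
      then have "ereal (W * \<kappa>) = Limsup at_top (\<lambda>\<rho>::real. ereal ((W * (\<kappa> * (ln \<rho> - C) - ln 2)) / ln \<rho>))"
        by (intro lim_imp_Limsup[symmetric]) auto
      also have "\<dots> \<le> ?lim"
      proof (rule Limsup_mono)
        show "eventually (\<lambda>\<rho>. ereal ((W * (\<kappa> * (ln \<rho> - C) - ln 2)) / ln \<rho>)
          \<le> (SUP R\<in>capacity_region K H \<rho>. ereal (\<Sum>k<K. w k * R k)) / ereal (ln \<rho>)) at_top"
          using C eventually_gt_at_top[of 1]
        proof eventually_elim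
          case (elim \<rho>)
          then obtain R where R: "\<kappa> * (ln \<rho> - C) - ln 2 \<le> R"
            "(\<lambda>k. if k < K then R else 0) \<in> capacity_region K H \<rho>" by auto
          have "ereal (W * (\<kappa> * (ln \<rho> - C) - ln 2)) \<le> ereal (\<Sum>k<K. w k * (if k < K then R else 0))"
            unfolding sum_eq using R(1) W by (simp add: mult_left_mono)
          also have "\<dots> \<le> (SUP R\<in>capacity_region K H \<rho>. ereal (\<Sum>k<K. w k * R k))"
            by (rule SUP_upper2[OF R(2)]) simp
          finally have "ereal (W * (\<kappa> * (ln \<rho> - C) - ln 2)) / ereal (ln \<rho>)
            \<le> (SUP R\<in>capacity_region K H \<rho>. ereal (\<Sum>k<K. w k * R k)) / ereal (ln \<rho>)"
            using elim(2) by (intro ereal_divide_right_mono) auto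
          then show ?case using elim(2) by simp
        qed
      qed
      finally show ?thesis unfolding \<kappa>_def .
    qed
    have "(\<lambda>n. W * ((1 - 1 / real (Suc n)) / 2 - 2 / real (Suc n))) \<longlonglongrightarrow> W * (1 / 2)"
      by real_asymp
    then have "(\<lambda>n. ereal (W * ((1 - 1 / real (Suc n)) / 2 - 2 / real (Suc n)))) \<longlonglongrightarrow> ereal (W * (1 / 2))"
      by simp
    then have "ereal (W * (1 / 2)) \<le> ?lim"
      by (rule LIMSEQ_le_const2) (use le in auto)
    then show ?thesis unfolding sum_eq .
  qed
  then show ?thesis by (simp add: dof_region_def)
qed

section \<open>The degrees of freedom\<close>

theorem theorem1:
  fixes K :: nat and \<mu> :: "complex measure"
  assumes "2 \<le> K"
    and "prob_space \<mu>"
    and "sets \<mu> = sets borel"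
    and "absolutely_continuous lborel \<mu>"
    and "\<exists>hmin hmax. 0 < hmin \<and> hmin \<le> hmax \<and>
           (AE h in \<mu>. hmin \<le> cmod h \<and> cmod h \<le> hmax)"
  shows "AE H in PiM UNIV (\<lambda>_::nat \<times> nat \<times> nat. \<mu>).
           (\<exists>d\<in>dof_region K (\<lambda>k j f. H (k, j, f)). (\<Sum>k<K. d k) = real K / 2) \<and>
           (\<forall>d\<in>dof_region K (\<lambda>k j f. H (k, j, f)). (\<Sum>k<K. d k) \<le> real K / 2)"
proof -
  interpret iid_channel \<mu>
    using assms(2,3) by (rule iid_channel.intro)
  obtain hmin hmax where h: "0 < hmin" "hmin \<le> hmax" and ae: "AE h in \<mu>. hmin \<le> cmod h \<and> cmod h \<le> hmax"
    using assms(5) by auto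
  have K: "0 < K" using assms(1) by simp
  have bounded: "AE H in \<Omega>. \<forall>i. hmin \<le> cmod (H i) \<and> cmod (H i) \<le> hmax"
    unfolding AE_all_countable
    by (intro allI AE_PiM_component[where M = "\<lambda>_. \<mu>" and P = "\<lambda>h. hmin \<le> cmod h \<and> cmod h \<le> hmax"] ae)
      (auto intro: prob_mu)
  have ae': "AE h in \<mu>. cmod h \<le> hmax"
    using ae by eventually_elim auto
  have "\<forall>n. \<exists>c>0. \<forall>b>0. AE H in \<Omega>. \<exists>f0>0. \<exists>P m.
      aligned_pairs K (\<lambda>k j f. H (k, j, f)) f0 P m c b \<and> (1 - 1 / real (Suc n)) * real f0 \<le> 2 * real (card P)"
    by (intro allI AE_exists_aligned_pairs[OF assms(4) ae' K]) simp
  \<comment> \<open>\<open>c n\<close> is chosen outside the almost sure quantifier, so one gap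
    serves all channels \<open>H\<close> and all tolerances.\<close>
  from choice[OF this] obtain c where "\<forall>n. 0 < c n \<and> (\<forall>b>0. AE H in \<Omega>. \<exists>f0>0. \<exists>P m.
      aligned_pairs K (\<lambda>k j f. H (k, j, f)) f0 P m (c n) b \<and> (1 - 1 / real (Suc n)) * real f0 \<le> 2 * real (card P))"
    by (rule exE)
  then have c: "\<And>n. 0 < c n" and pairs: "\<And>n b. 0 < b \<Longrightarrow> AE H in \<Omega>. \<exists>f0>0. \<exists>P m.
      aligned_pairs K (\<lambda>k j f. H (k, j, f)) f0 P m (c n) b \<and> (1 - 1 / real (Suc n)) * real f0 \<le> 2 * real (card P)"
    by simp_all
  \<comment> \<open>With the tolerances \<open>1 / Suc i\<close> only countably many null sets are
    discarded.\<close>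
  have "AE H in \<Omega>. \<forall>n i. \<exists>f0>0. \<exists>P m.
      aligned_pairs K (\<lambda>k j f. H (k, j, f)) f0 P m (c n) (1 / real (Suc i)) \<and>
      (1 - 1 / real (Suc n)) * real f0 \<le> 2 * real (card P)"
    unfolding AE_all_countable by (intro allI pairs) simp
  with bounded show ?thesis
  proof eventually_elim
    case (elim H)
    let ?H = "\<lambda>k j f. H (k, j, f)"
    have "(\<lambda>k. if k < K then 1 / 2 else 0) \<in> dof_region K ?H"
      using elim(2) c by (intro half_in_dof_region K) blast
    moreover have "(\<Sum>k<K. if k < K then 1 / 2 else 0 :: real) = real K / 2"
      by simp
    moreover have "(\<Sum>k<K. d k) \<le> real K / 2" if d: "d \<in> dof_region K ?H" for d
    proof (rule sum_le_of_pairs[OF assms(1)])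
      show "d i + d j \<le> 1" if "i < K" "j < K" "i \<noteq> j" for i j
        by (rule dof_pair_le[OF that h _ d]) (use elim(1) in auto)
    qed
    ultimately show ?case by blast
  qed
qed

end
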